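(* Let $s,t$ be fixed distinct vertices of $K_n$ whose edges carry i.i.d.\ weights, either all uniform $U(0,1)$ or all exponential with mean $1$. Let $P_k$ and $X_k$ be as in the context, and let $W_{(k)}$ be the $k$-th smallest of $n-1$ i.i.d.\ random variables with the edge-weight distribution. Then for every $k\le n-1$, asymptotically almost surely $P_k$ exists, and $$\mathbb{E}[X_k\mid P_k\text{ exists}]=(1+o(1))\bigl(2\,\mathbb{E}W_{(k)}+\ln n/n\bigr),$$ where the $o(1)$ term tends to $0$ as $n\to\infty$ uniformly in $k\le n-1$.
   Context: The cost of a path is the sum of its edge weights. $P_1$ is a minimum-cost $s$--$t$ path; for $k\ge2$, $P_k$ is a minimum-cost $s$--$t$ path edge-disjoint from $P_1\cup\dots\cup P_{k-1}$, if one exists; $X_k$ is its cost. In the uniform model $\mathbb{E}W_{(k)}=k/n$; in the exponential model $\mathbb{E}W_{(k)}=\sum_{i=1}^k\frac1{n-i}$. "Asymptotically almost surely" means with probability tending to $1$ as $n\to\infty$. *)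

theory Defs
  imports "HOL-Probability.Probability"
begin

definition K_edges :: "nat \<Rightarrow> nat set set" where
  "K_edges n = {e. e \<subseteq> {..<n} \<and> card e = 2}"

text \<open>A path is represented by its list of vertices.\<close>

definition st_paths :: "nat \<Rightarrow> nat \<Rightarrow> nat \<Rightarrow> nat list set" where
  "st_paths n s t =
     {p. p \<noteq> [] \<and> hd p = s \<and> last p = t \<and> distinct p \<and> set p \<subseteq> {..<n}}"

definition path_edges :: "nat list \<Rightarrow> nat set set" where
  "path_edges p = {{p ! i, p ! Suc i} | i. Suc i < length p}"

definition path_cost :: "(nat set \<Rightarrow> real) \<Rightarrow> nat list \<Rightarrow> real" where
  "path_cost w p = (\<Sum>e\<in>path_edges p. w e)"

text \<open>The path \<open>P\<^sub>k\<close> for \<open>k \<ge> 1\<close> (the value at \<open>k = 0\<close> is not used);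
  \<open>None\<close> means that \<open>P\<^sub>k\<close> does not exist, and then no later path exists either.
  Ties are broken by the choice in \<open>arg_min\<close>, which depends on the weights only through
  the set of minimisers; for independent continuous weights ties have probability 0.\<close>

fun succ_path ::
    "nat \<Rightarrow> nat \<Rightarrow> nat \<Rightarrow> (nat set \<Rightarrow> real) \<Rightarrow> nat \<Rightarrow> nat list option" where
  "succ_path n s t w k =
     (let C = {p \<in> st_paths n s t. \<forall>j\<in>{1..<k}. \<exists>q. succ_path n s t w j = Some q \<and>
                 path_edges p \<inter> path_edges q = {}}
      in if C = {} then None else Some (arg_min (path_cost w) (\<lambda>p. p \<in> C)))"

declare succ_path.simps [simp del]

definition succ_path_exists ::
    "nat \<Rightarrow> nat \<Rightarrow> nat \<Rightarrow> (nat set \<Rightarrow> real) \<Rightarrow> nat \<Rightarrow> bool" where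
  "succ_path_exists n s t w k \<longleftrightarrow> succ_path n s t w k \<noteq> None"

text \<open>The cost \<open>X\<^sub>k\<close>, meaningful only if \<open>P\<^sub>k\<close> exists.\<close>

definition succ_cost :: "nat \<Rightarrow> nat \<Rightarrow> nat \<Rightarrow> (nat set \<Rightarrow> real) \<Rightarrow> nat \<Rightarrow> real" where
  "succ_cost n s t w k = path_cost w (the (succ_path n s t w k))"

definition edge_weights :: "real measure \<Rightarrow> nat \<Rightarrow> (nat set \<Rightarrow> real) measure" where
  "edge_weights D n = PiM (K_edges n) (\<lambda>_. D)"

definition cond_expectation :: "'a measure \<Rightarrow> ('a \<Rightarrow> real) \<Rightarrow> ('a \<Rightarrow> bool) \<Rightarrow> real" where
  "cond_expectation M X Q =
     (LINT w:{w \<in> space M. Q w}|M. X w) / measure M {w \<in> space M. Q w}"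

definition kth_smallest :: "nat \<Rightarrow> (nat \<Rightarrow> real) \<Rightarrow> nat \<Rightarrow> real" where
  "kth_smallest m x k = sort (map x [0..<m]) ! (k - 1)"

text \<open>\<open>\<bbbE> W\<^bsub>(k)\<^esub>\<close>, where \<open>W\<^bsub>(k)\<^esub>\<close> is the
  \<open>k\<close>-th smallest of \<open>n - 1\<close> independent variables with law \<open>D\<close>.\<close>

definition expected_order_stat :: "real measure \<Rightarrow> nat \<Rightarrow> nat \<Rightarrow> real" where
  "expected_order_stat D n k =
     (LINT x|PiM {..<n - 1} (\<lambda>_. D). kth_smallest (n - 1) x k)"

definition uniform_law :: "real measure" where
  "uniform_law = uniform_measure lborel {0<..<1}"

definition exponential_law :: "real measure" where
  "exponential_law = density lborel (exponential_density 1)"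

end

theory Submission imports Defs "HOL-Real_Asymp.Real_Asymp" begin

text \<open>Let \<open>W\<^sup>s\<^sub>k\<close> and \<open>W\<^sup>t\<^sub>k\<close> be the \<open>k\<close>-th smallest weights of the edges at \<open>s\<close> and at \<open>t\<close>. The process
  uses the end edges almost in increasing order, so \<open>X\<^sub>k\<close> is close to \<open>W\<^sup>s\<^sub>k + W\<^sup>t\<^sub>k\<close> plus the
  cost of the inner part of \<open>P\<^sub>k\<close>, and it remains to see that inner parts cost about \<open>ln n / n\<close>.

  If \<open>k \<ge> ln\<^sup>7 n\<close>, the light edges form an expander that survives the deletion of
  \<open>P\<^sub>1, \<dots>, P\<^bsub>k-1\<^esub>\<close> as long as these paths put little load on the inner vertices; cheap connections in turn
  keep the load small. Hence inner parts cost \<open>o(k / n)\<close>, and so does \<open>ln n / n\<close>. This holds outside an event of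
  superpolynomially small probability.

  If \<open>k < ln\<^sup>7 n\<close>, a first-moment estimate shows that no inner path between ends of cheap edges costs less than
  \<open>(1 - \<epsilon>) ln n / n\<close>, and that those of cost at most \<open>(1 + \<epsilon>) ln n / n\<close> with distinct ends do not share an edge, so
  that earlier paths do not obstruct later ones. Such connections exist: for exponential weights the exploration of the graph
  from a vertex is memoryless, which makes an exponential moment of the exploration time computable step by step, and
  uniform weights are dominated by exponential ones through a coupling. The exceptional event is only
  polynomially small here, but outside the event of the first case the costs are still \<open>O(ln\<^sup>8 n / n)\<close>,
  which bounds its contribution to the expectation.\<close>


subsection \<open>Paths\<close>

text \<open>The obstacle is that the removed paths depend on all weights, so conditioning on them is
  hopeless. What survives a deletion is therefore controlled deterministically: expansion is used
  against every deleted set of bounded load, disjointness against every pair of cheap paths, and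
  only the weights are random. The edge joining s and t may itself be one of the paths. It has no
  inner part, which costs one index in the order statistics for large k; this is repaired by
  comparing consecutive expected order statistics. The threshold \<open>ln n ^ 7\<close> makes n *
  \<theta> at least \<open>ln n ^ 5\<close> for every window size \<theta> in use, so failures have
  probability about exp (- ln^5 n / 200), and it keeps the deleted weight within the expansion
  budget. A large negative power of n is wanted there because on that event the cost is bounded only
  by the total weight of the graph. For small k the failure probability n^(-c) is weighed against
  costs of order ln^8 n / n; the loss relative to ln n / n is ln^7 n * n^(-c), which tends to
  0.\<close>

lemma path_edges_Nil [simp]: "path_edges [] = {}"
  and path_edges_single [simp]: "path_edges [x] = {}"
  by (auto simp: path_edges_def)

lemma path_edges_Cons_Cons [simp]:
  "path_edges (x # y # p) = insert {x, y} (path_edges (y # p))"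
proof (intro equalityI subsetI)
  fix e assume "e \<in> path_edges (x # y # p)"
  then obtain i where i: "Suc i < length (x # y # p)" "e = {(x # y # p) ! i, (x # y # p) ! Suc i}"
    by (auto simp: path_edges_def)
  then show "e \<in> insert {x, y} (path_edges (y # p))"
    by (cases i) (auto simp: path_edges_def)
next
  fix e assume "e \<in> insert {x, y} (path_edges (y # p))"
  then consider "e = {x, y}" | i where "Suc i < length (y # p)" "e = {(y # p) ! i, (y # p) ! Suc i}"
    by (auto simp: path_edges_def)
  then show "e \<in> path_edges (x # y # p)"
  proof cases
    case 1
    then show ?thesis by (auto simp: path_edges_def intro!: exI[of _ 0])
  next
    case 2
    then show ?thesis by (auto simp: path_edges_def intro!: exI[of _ "Suc i"])
  qed
qed

lemma path_edges_Cons: "p \<noteq> [] \<Longrightarrow> path_edges (x # p) = insert {x, hd p} (path_edges p)"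
  by (cases p) auto

lemma path_edges_append:
  "p \<noteq> [] \<Longrightarrow> q \<noteq> [] \<Longrightarrow>
     path_edges (p @ q) = insert {last p, hd q} (path_edges p \<union> path_edges q)"
  by (induction p rule: induct_list012) (auto simp: path_edges_Cons)

lemma path_edges_rev [simp]: "path_edges (rev p) = path_edges p"
proof (induction p)
  case (Cons x p)
  then show ?case
    by (cases "p = []") (auto simp: path_edges_append path_edges_Cons last_rev insert_commute)
qed simp

lemma path_edges_subset: "e \<in> path_edges p \<Longrightarrow> e \<subseteq> set p"
  by (auto simp: path_edges_def)

lemma path_edges_in_K_edges:
  assumes "distinct p" "set p \<subseteq> {..<n}"
  shows "path_edges p \<subseteq> K_edges n"
proof
  fix e assume "e \<in> path_edges p"
  then obtain i where "Suc i < length p" "e = {p ! i, p ! Suc i}"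
    by (auto simp: path_edges_def)
  then show "e \<in> K_edges n"
    using assms nth_eq_iff_index_eq[OF assms(1), of i "Suc i"]
    by (auto simp: K_edges_def card_2_iff subset_iff dest: nth_mem)
qed

lemma path_edges_card2: "distinct p \<Longrightarrow> e \<in> path_edges p \<Longrightarrow> card e = 2"
  using path_edges_in_K_edges[of p "Suc (Max (set p))"]
  by (fastforce simp: K_edges_def less_Suc_eq_le)

lemma finite_path_edges [simp]: "finite (path_edges p)"
  by (induction p rule: induct_list012) auto

lemma card_path_edges: "distinct p \<Longrightarrow> card (path_edges p) = length p - 1"
proof (induction p rule: induct_list012)
  case (3 x y p)
  then have "{x, y} \<notin> path_edges (y # p)"
    using path_edges_subset[of "{x, y}" "y # p"] by auto
  with 3 show ?case by simp
qed auto

lemma path_cost_Nil [simp]: "path_cost w [] = 0"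
  and path_cost_single [simp]: "path_cost w [x] = 0"
  by (simp_all add: path_cost_def)

lemma path_cost_Cons:
  assumes "distinct (x # p)" "p \<noteq> []"
  shows "path_cost w (x # p) = w {x, hd p} + path_cost w p"
proof -
  have "{x, hd p} \<notin> path_edges p"
    using path_edges_subset[of "{x, hd p}" p] assms by auto
  then show ?thesis using assms by (simp add: path_cost_def path_edges_Cons)
qed

lemma path_cost_snoc:
  assumes "distinct (p @ [x])" "p \<noteq> []"
  shows "path_cost w (p @ [x]) = path_cost w p + w {last p, x}"
proof -
  have "{last p, x} \<notin> path_edges p"
    using path_edges_subset[of "{last p, x}" p] assms by auto
  then show ?thesis using assms by (simp add: path_cost_def path_edges_append)
qed

lemma path_cost_rev [simp]: "path_cost w (rev p) = path_cost w p"
  by (simp add: path_cost_def)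

section \<open>Cheap connections that avoid deleted edges\<close>

definition conn :: "nat set \<Rightarrow> nat set set \<Rightarrow> (nat set \<Rightarrow> real) \<Rightarrow> nat \<Rightarrow> nat \<Rightarrow> real \<Rightarrow> bool" where
  "conn A R w x y c \<longleftrightarrow> (\<exists>q. q \<noteq> [] \<and> hd q = x \<and> last q = y \<and> distinct q \<and> set q \<subseteq> A \<and>
     path_edges q \<inter> R = {} \<and> path_cost w q \<le> c)"

lemma conn_refl: "x \<in> A \<Longrightarrow> 0 \<le> c \<Longrightarrow> conn A R w x x c"
  unfolding conn_def by (rule exI[of _ "[x]"]) auto

lemma conn_mono: "conn A R w x y c \<Longrightarrow> c \<le> c' \<Longrightarrow> conn A R w x y c'"
  unfolding conn_def by (elim exE, rule exI) auto

lemma conn_sym: "conn A R w x y c \<Longrightarrow> conn A R w y x c"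
  unfolding conn_def by (metis distinct_rev hd_rev last_rev path_cost_rev path_edges_rev rev_is_Nil_conv set_rev)

lemma path_edges_append_subset: "path_edges p \<subseteq> path_edges (p @ q)" "path_edges q \<subseteq> path_edges (p @ q)"
  by (cases "p = []"; cases "q = []"; auto simp: path_edges_append)+

definition nonneg_weights :: "nat set \<Rightarrow> (nat set \<Rightarrow> real) \<Rightarrow> bool" where
  "nonneg_weights A w \<longleftrightarrow> (\<forall>e. e \<subseteq> A \<and> card e = 2 \<longrightarrow> 0 \<le> w e)"

lemma nonneg_path_edges:
  "nonneg_weights A w \<Longrightarrow> distinct p \<Longrightarrow> set p \<subseteq> A \<Longrightarrow> e \<in> path_edges p \<Longrightarrow> 0 \<le> w e"
  using path_edges_subset[of e p] path_edges_card2[of p e] unfolding nonneg_weights_def by blast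

lemma path_cost_nonneg:
  "nonneg_weights A w \<Longrightarrow> distinct p \<Longrightarrow> set p \<subseteq> A \<Longrightarrow> 0 \<le> path_cost w p"
  unfolding path_cost_def by (intro sum_nonneg) (auto intro: nonneg_path_edges)

text \<open>If the path already visits \<open>z\<close>, it is cut there instead of extended: it
  stays simple, and nonnegative weights make it no dearer.\<close>

lemma conn_step:
  assumes "conn A R w x y c" "z \<in> A" "{y, z} \<notin> R" "y \<noteq> z" "w {y, z} \<le> c'" "nonneg_weights A w"
  shows "conn A R w x z (c + c')"
proof -
  obtain q where q: "q \<noteq> []" "hd q = x" "last q = y" "distinct q" "set q \<subseteq> A"
     "path_edges q \<inter> R = {}" "path_cost w q \<le> c"
    using assms(1) by (auto simp: conn_def)
  have "y \<in> A" using q by auto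
  then have w: "0 \<le> w {y, z}" using assms by (auto simp: nonneg_weights_def)
  show ?thesis
  proof (cases "z \<in> set q")
    case False
    have "path_cost w (q @ [z]) \<le> c + c'"
      using path_cost_snoc[of q z w] False q assms(5) by auto
    moreover have "path_edges (q @ [z]) \<inter> R = {}"
      using q assms(3) by (auto simp: path_edges_append)
    ultimately show ?thesis
      unfolding conn_def using q False assms(2) by (intro exI[of _ "q @ [z]"]) auto
  next
    case True
    then obtain u v where uv: "q = u @ z # v" by (meson split_list)
    let ?p = "u @ [z]"
    have sub: "path_edges ?p \<subseteq> path_edges q"
      using path_edges_append_subset(1)[of ?p v] uv by simp
    have "path_cost w ?p \<le> path_cost w q"
      unfolding path_cost_def using sub q assms(6) by (intro sum_mono2) (auto intro: nonneg_path_edges)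
    then have "path_cost w ?p \<le> c + c'" using q w assms(5) by linarith
    then show ?thesis
      unfolding conn_def using q uv sub by (intro exI[of _ ?p]) (auto simp: hd_append)
  qed
qed

text \<open>The concatenation of two simple paths need not be simple. The second path is appended
  vertex by vertex, so that \<open>conn_step\<close> removes every loop as it arises.\<close>

lemma conn_trans:
  assumes "conn A R w x y c" "conn A R w y z c'" and nn: "nonneg_weights A w"
  shows "conn A R w x z (c + c')"
proof -
  obtain q where q: "q \<noteq> []" "hd q = y" "last q = z" "distinct q" "set q \<subseteq> A"
     "path_edges q \<inter> R = {}" "path_cost w q \<le> c'"
    using assms(2) by (auto simp: conn_def)
  have "conn A R w x (last q) (c + path_cost w q)"
    using q(1,2,4-6)
  proof (induction q rule: rev_induct)
    case (snoc v q)
    show ?case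
    proof (cases "q = []")
      case True
      then show ?thesis using snoc assms(1) by simp
    next
      case False
      have *: "path_edges (q @ [v]) = insert {last q, v} (path_edges q)"
        using path_edges_append[of q "[v]"] False by simp
      have "conn A R w x v ((c + path_cost w q) + w {last q, v})"
      proof (rule conn_step[OF snoc.IH _ _ _ order_refl nn])
        show "last q \<noteq> v" using False snoc.prems by auto
      qed (use False snoc.prems * in auto)
      then show ?thesis using path_cost_snoc[of q v w] snoc.prems False by (simp add: algebra_simps)
    qed
  qed simp
  then show ?thesis using q conn_mono by (metis add_left_mono)
qed

subsection \<open>Successive shortest paths\<close>

text \<open>For an earlier path that does not exist, \<open>the\<close> yields an arbitrary list.
  The set is meaningful once all earlier paths exist, and then the candidates for the next path are
  exactly the paths that avoid it.\<close>

definition used_edges :: "nat \<Rightarrow> nat \<Rightarrow> nat \<Rightarrow> (nat set \<Rightarrow> real) \<Rightarrow> nat \<Rightarrow> nat set set" where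
  "used_edges n s t w k = (\<Union>j\<in>{1..<k}. path_edges (the (succ_path n s t w j)))"

lemma finite_st_paths: "finite (st_paths n s t)"
proof (rule finite_subset)
  show "st_paths n s t \<subseteq> {p. set p \<subseteq> {..<n} \<and> distinct p}" by (auto simp: st_paths_def)
  show "finite {p. set p \<subseteq> {..<n} \<and> distinct p}"
    by (rule finite_subset_distinct) simp
qed

lemma succ_path_candidates:
  assumes "\<forall>j\<in>{1..<k}. succ_path_exists n s t w j"
  shows "{p \<in> st_paths n s t. \<forall>j\<in>{1..<k}. \<exists>q. succ_path n s t w j = Some q \<and>
                 path_edges p \<inter> path_edges q = {}} =
         {p \<in> st_paths n s t. path_edges p \<inter> used_edges n s t w k = {}}"
  using assms unfolding succ_path_exists_def used_edges_def by fastforce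

lemma succ_path_eq:
  assumes "\<forall>j\<in>{1..<k}. succ_path_exists n s t w j"
  shows "succ_path n s t w k =
     (let C = {p \<in> st_paths n s t. path_edges p \<inter> used_edges n s t w k = {}}
      in if C = {} then None else Some (arg_min (path_cost w) (\<lambda>p. p \<in> C)))"
  by (subst succ_path.simps) (simp only: succ_path_candidates[OF assms])

lemma arg_min_in_finite:
  fixes f :: "'a \<Rightarrow> 'b::linorder"
  assumes "finite C" "C \<noteq> {}"
  shows "arg_min f (\<lambda>p. p \<in> C) \<in> C \<and> (\<forall>q\<in>C. f (arg_min f (\<lambda>p. p \<in> C)) \<le> f q)"
  using ex_is_arg_min_if_finite[OF assms, of f]
  by (metis arg_min_def is_arg_min_linorder someI_ex)

lemma succ_path_exists_earlier:
  assumes "succ_path_exists n s t w k" "j \<in> {1..<k}"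
  shows "succ_path_exists n s t w j"
  using assms unfolding succ_path_exists_def
  by (subst (asm) succ_path.simps) (auto simp: Let_def split: if_splits)

lemma succ_path_exists_iff:
  "succ_path_exists n s t w k \<longleftrightarrow> (\<forall>j\<in>{1..<k}. succ_path_exists n s t w j) \<and>
     (\<exists>p\<in>st_paths n s t. path_edges p \<inter> used_edges n s t w k = {})"
proof (cases "\<forall>j\<in>{1..<k}. succ_path_exists n s t w j")
  case True
  then show ?thesis
    unfolding succ_path_exists_def[of _ _ _ _ k] succ_path_eq[OF True] by (auto simp: Let_def)
next
  case False
  then show ?thesis using succ_path_exists_earlier by blast
qed

lemma succ_path_minimal:
  assumes "succ_path_exists n s t w k"
  defines "p \<equiv> the (succ_path n s t w k)"
  shows "p \<in> st_paths n s t" "path_edges p \<inter> used_edges n s t w k = {}"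
    "\<And>q. q \<in> st_paths n s t \<Longrightarrow> path_edges q \<inter> used_edges n s t w k = {} \<Longrightarrow>
        succ_cost n s t w k \<le> path_cost w q"
proof -
  let ?C = "{p \<in> st_paths n s t. path_edges p \<inter> used_edges n s t w k = {}}"
  have ex: "\<forall>j\<in>{1..<k}. succ_path_exists n s t w j" using assms(1) succ_path_exists_earlier by blast
  have ne: "?C \<noteq> {}" using succ_path_exists_iff[of n s t w k] assms(1) by auto
  have eq: "succ_path n s t w k = Some (arg_min (path_cost w) (\<lambda>p. p \<in> ?C))"
    using ne by (simp add: succ_path_eq[OF ex] Let_def)
  have "p \<in> ?C \<and> (\<forall>q\<in>?C. path_cost w p \<le> path_cost w q)"
    unfolding p_def eq option.sel by (rule arg_min_in_finite) (use finite_st_paths ne in auto)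
  then show "p \<in> st_paths n s t" "path_edges p \<inter> used_edges n s t w k = {}"
    "\<And>q. q \<in> st_paths n s t \<Longrightarrow> path_edges q \<inter> used_edges n s t w k = {} \<Longrightarrow>
        succ_cost n s t w k \<le> path_cost w q"
    by (auto simp: succ_cost_def p_def)
qed

lemma used_edges_mono: "j \<le> k \<Longrightarrow> used_edges n s t w j \<subseteq> used_edges n s t w k"
  unfolding used_edges_def by (intro UN_mono) auto

text \<open>The later path was already a candidate at the earlier step, where fewer edges had been
  removed.\<close>

lemma succ_cost_mono:
  assumes "succ_path_exists n s t w k" "1 \<le> j" "j \<le> k"
  shows "succ_cost n s t w j \<le> succ_cost n s t w k"
proof -
  have "succ_path_exists n s t w j" using assms succ_path_exists_earlier[of n s t w k j]
    by (cases "j = k") auto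
  then show ?thesis
    using succ_path_minimal[OF assms(1)] succ_path_minimal(3)[of n s t w j "the (succ_path n s t w k)"]
      used_edges_mono[OF assms(3), of n s t w] by (auto simp: succ_cost_def)
qed

lemma st_path_cases:
  assumes "p \<in> st_paths n s t" "s \<noteq> t"
  obtains q where "p = s # q @ [t]" "distinct q" "set q \<subseteq> {..<n} - {s, t}"
proof -
  have p: "p \<noteq> []" "hd p = s" "last p = t" "distinct p" "set p \<subseteq> {..<n}"
    using assms by (auto simp: st_paths_def)
  then obtain r where r: "p = s # r" by (cases p) auto
  with p assms(2) have "r \<noteq> []" by auto
  then have "r = butlast r @ [t]" using p r by (metis append_butlast_last_id last_ConsR)
  then have "p = s # butlast r @ [t]" using r by simp
  moreover define q where "q = butlast r"
  ultimately have pq: "p = s # q @ [t]" by simp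
  then have "distinct q" "set q \<subseteq> {..<n} - {s, t}" using p(4,5) by auto
  with pq show ?thesis using that by blast
qed

section \<open>Order statistics of the weights at a vertex\<close>

definition nb :: "nat \<Rightarrow> nat \<Rightarrow> nat" where
  "nb s i = (if i < s then i else Suc i)"

text \<open>Since \<open>nb s\<close> enumerates the vertices other than \<open>s\<close> by
  \<open>{..<n - 1}\<close>, the star of \<open>s\<close> becomes a family indexed like the n - 1
  independent variables of \<open>expected_order_stat\<close>; in law the two order statistics then
  agree literally.\<close>

definition order_stat :: "nat \<Rightarrow> nat \<Rightarrow> (nat set \<Rightarrow> real) \<Rightarrow> nat \<Rightarrow> real" where
  "order_stat n s w k = kth_smallest (n - 1) (\<lambda>i. w {s, nb s i}) k"

lemma sorted_nth_le_iff:
  fixes xs :: "real list"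
  assumes "sorted xs" "k < length xs"
  shows "xs ! k \<le> c \<longleftrightarrow> k < length (filter (\<lambda>x. x \<le> c) xs)"
  using assms
proof (induction xs arbitrary: k)
  case (Cons x xs)
  show ?case
  proof (cases "x \<le> c")
    case True
    with Cons show ?thesis by (cases k) auto
  next
    case False
    with Cons.prems have "filter (\<lambda>x. x \<le> c) (x # xs) = []"
      by (auto simp: filter_empty_conv)
    moreover have "x \<le> (x # xs) ! k" using Cons.prems by (cases k) auto
    ultimately show ?thesis using False by auto
  qed
qed simp

text \<open>Counting replaces sorting from here on: bounds, measurability and the law of an order
  statistic are all read off from this equivalence.\<close>

lemma kth_smallest_le_iff:
  assumes "1 \<le> k" "k \<le> m"
  shows "kth_smallest m x k \<le> c \<longleftrightarrow> k \<le> card {i. i < m \<and> x i \<le> c}"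
proof -
  have "kth_smallest m x k \<le> c \<longleftrightarrow> k - 1 < length (filter (\<lambda>x. x \<le> c) (sort (map x [0..<m])))"
    unfolding kth_smallest_def by (rule sorted_nth_le_iff) (use assms in auto)
  also have "length (filter (\<lambda>x. x \<le> c) (sort (map x [0..<m])))
      = length (filter (\<lambda>i. x i \<le> c) [0..<m])"
    by (simp add: filter_sort filter_map o_def)
  also have "\<dots> = card {i. i < m \<and> x i \<le> c}"
    by (subst distinct_card[symmetric]) (auto intro!: arg_cong[where f = card])
  finally show ?thesis using assms by linarith
qed

lemma bij_betw_nb: "s < n \<Longrightarrow> bij_betw (nb s) {..<n - 1} ({..<n} - {s})"
  by (rule bij_betwI[where g = "\<lambda>v. if v < s then v else v - 1"])
    (auto simp: nb_def split: if_splits)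

lemma order_stat_le_iff:
  assumes "1 \<le> k" "k \<le> n - 1" "s < n"
  shows "order_stat n s w k \<le> c \<longleftrightarrow> k \<le> card {v \<in> {..<n} - {s}. w {s, v} \<le> c}"
proof -
  have "bij_betw (nb s) {i. i < n - 1 \<and> w {s, nb s i} \<le> c} {v \<in> {..<n} - {s}. w {s, v} \<le> c}"
    using bij_betw_nb[OF assms(3)] unfolding bij_betw_def by (auto simp: inj_on_def)
  then show ?thesis
    unfolding order_stat_def by (simp only: kth_smallest_le_iff[OF assms(1,2)] bij_betw_same_card)
qed

lemma order_stat_le:
  assumes "finite V" "V \<subseteq> {..<n} - {s}" "\<And>v. v \<in> V \<Longrightarrow> w {s, v} \<le> c" "1 \<le> card V" "s < n"
  shows "order_stat n s w (card V) \<le> c"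
proof -
  have "card V \<le> card ({..<n} - {s})" by (rule card_mono) (use assms in auto)
  then have le: "card V \<le> n - 1" using assms by simp
  have "card V \<le> card {v \<in> {..<n} - {s}. w {s, v} \<le> c}"
    by (rule card_mono) (use assms in auto)
  then show ?thesis using order_stat_le_iff[OF assms(4) le assms(5)] by blast
qed

lemma order_stat_mono:
  assumes "1 \<le> j" "j \<le> k" "k \<le> n - 1" "s < n"
  shows "order_stat n s w j \<le> order_stat n s w k"
  using order_stat_le_iff[of k n s w "order_stat n s w k"] order_stat_le_iff[of j n s w] assms by auto

section \<open>The process for fixed nonnegative weights\<close>

locale weighted_instance =
  fixes n s t :: nat and w :: "nat set \<Rightarrow> real"
  assumes s_less: "s < n" and t_less: "t < n" and s_neq_t: "s \<noteq> t"
    and nonneg: "nonneg_weights {..<n} w"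
begin

definition A :: "nat set" where "A = {..<n} - {s, t}"

abbreviation "E k \<equiv> succ_path_exists n s t w k"
abbreviation "X k \<equiv> succ_cost n s t w k"
abbreviation "U k \<equiv> used_edges n s t w k"

text \<open>The list of inner vertices of the path; it is empty exactly when the path is the single
  edge between \<open>s\<close> and \<open>t\<close>.\<close>

definition mid :: "nat \<Rightarrow> nat list" where
  "mid j = butlast (tl (the (succ_path n s t w j)))"

lemma nonneg_A: "nonneg_weights A w"
  using nonneg unfolding nonneg_weights_def A_def by (meson Diff_subset order_trans)

lemma weight_nonneg: "u < n \<Longrightarrow> v < n \<Longrightarrow> u \<noteq> v \<Longrightarrow> 0 \<le> w {u, v}"
  using nonneg unfolding nonneg_weights_def by auto

lemma finite_A: "finite A" by (simp add: A_def)

lemma mid_props: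
  assumes "E k"
  shows "the (succ_path n s t w k) = s # mid k @ [t]" "distinct (mid k)" "set (mid k) \<subseteq> A"
proof -
  obtain q where "the (succ_path n s t w k) = s # q @ [t]" "distinct q" "set q \<subseteq> A"
    using st_path_cases[OF succ_path_minimal(1)[OF assms] s_neq_t] unfolding A_def by metis
  then show "the (succ_path n s t w k) = s # mid k @ [t]" "distinct (mid k)" "set (mid k) \<subseteq> A"
    by (auto simp: mid_def butlast_append)
qed

lemma path_edges_st:
  "q \<noteq> [] \<Longrightarrow> path_edges (s # q @ [t]) = insert {s, hd q} (insert {last q, t} (path_edges q))"
  by (simp add: path_edges_Cons path_edges_append)

lemma st_path_distinct: "distinct q \<Longrightarrow> set q \<subseteq> A \<Longrightarrow> distinct (s # q @ [t])"
  using s_neq_t by (auto simp: A_def)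

lemma path_cost_st:
  assumes "q \<noteq> []" "distinct q" "set q \<subseteq> A"
  shows "path_cost w (s # q @ [t]) = w {s, hd q} + path_cost w q + w {last q, t}"
  using path_cost_Cons[of s "q @ [t]" w] path_cost_snoc[of q t w] st_path_distinct[OF assms(2,3)] assms
  by simp

lemma st_path_in: "distinct q \<Longrightarrow> set q \<subseteq> A \<Longrightarrow> s # q @ [t] \<in> st_paths n s t"
  using st_path_distinct[of q] s_less t_less by (auto simp: st_paths_def A_def)

text \<open>A free edge at each end and a free connection between them form a candidate path, which
  witnesses existence and bounds the cost at once.\<close>

lemma step_upper:
  assumes "\<And>j. j \<in> {1..<k} \<Longrightarrow> E j" "conn A (U k) w a b c" "{s, a} \<notin> U k" "{b, t} \<notin> U k"
  shows "E k \<and> X k \<le> w {s, a} + w {b, t} + c"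
proof -
  obtain q where q: "q \<noteq> []" "hd q = a" "last q = b" "distinct q" "set q \<subseteq> A"
     "path_edges q \<inter> U k = {}" "path_cost w q \<le> c"
    using assms(2) by (auto simp: conn_def)
  have p: "s # q @ [t] \<in> st_paths n s t" "path_edges (s # q @ [t]) \<inter> U k = {}"
    using st_path_in[of q] q assms(3,4) by (simp_all add: path_edges_st del: append.append_Cons)
  then have "E k" using succ_path_exists_iff assms(1) by blast
  then show ?thesis using succ_path_minimal(3)[OF _ p] path_cost_st[of q] q by auto
qed

lemma step_upper_direct:
  assumes "\<And>j. j \<in> {1..<k} \<Longrightarrow> E j" "{s, t} \<notin> U k"
  shows "E k \<and> X k \<le> w {s, t}"
proof -
  have p: "[s, t] \<in> st_paths n s t" "path_edges [s, t] \<inter> U k = {}"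
    using st_path_in[of "[]"] assms(2) by simp_all
  then have "E k" using succ_path_exists_iff assms(1) by blast
  then show ?thesis using succ_path_minimal(3)[OF _ p] s_neq_t by (auto simp: path_cost_Cons)
qed

lemma path_edges_at_s:
  assumes "distinct q" "set q \<subseteq> A"
  shows "{s, v} \<in> path_edges (s # q @ [t]) \<longleftrightarrow> v = hd (q @ [t])"
proof -
  have "s \<notin> set (q @ [t])" using assms s_neq_t by (auto simp: A_def)
  then have "{s, v} \<notin> path_edges (q @ [t])" using path_edges_subset by blast
  then show ?thesis using \<open>s \<notin> set (q @ [t])\<close> by (auto simp: path_edges_Cons doubleton_eq_iff)
qed

lemma path_edges_at_t:
  assumes "distinct q" "set q \<subseteq> A"
  shows "{v, t} \<in> path_edges (s # q @ [t]) \<longleftrightarrow> v = last (s # q)"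
proof -
  have t: "t \<notin> set (s # q)" using assms s_neq_t by (auto simp: A_def)
  then have "{v, t} \<notin> path_edges (s # q)" using path_edges_subset by blast
  moreover have "path_edges (s # q @ [t]) = insert {last (s # q), t} (path_edges (s # q))"
    using path_edges_append[of "s # q" "[t]"] by simp
  ultimately show ?thesis using t by (auto simp: doubleton_eq_iff)
qed

text \<open>Appending \<open>t\<close> and prepending \<open>s\<close> gives the direct path the
  ends \<open>t\<close> and \<open>s\<close>, so that \<open>{s, fst (ends j)}\<close> and
  \<open>{snd (ends j), t}\<close> are its end edges in every case.\<close>

definition ends :: "nat \<Rightarrow> nat \<times> nat" where
  "ends j = (hd (mid j @ [t]), last (s # mid j))"

lemma used_at_s:
  "(\<And>j. j \<in> {1..<k} \<Longrightarrow> E j) \<Longrightarrow> {s, v} \<in> U k \<longleftrightarrow> v \<in> (fst \<circ> ends) ` {1..<k}"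
  unfolding used_edges_def ends_def using mid_props path_edges_at_s by auto

lemma used_at_t:
  "(\<And>j. j \<in> {1..<k} \<Longrightarrow> E j) \<Longrightarrow> {v, t} \<in> U k \<longleftrightarrow> v \<in> (snd \<circ> ends) ` {1..<k}"
  unfolding used_edges_def ends_def using mid_props path_edges_at_t by auto

text \<open>End edges of a later path are still free at every earlier step; this is what permits the
  exchange of ends between two paths.\<close>

lemma ends_unused:
  assumes "E k" "j \<le> k"
  shows "{s, fst (ends k)} \<notin> U j" "{snd (ends k), t} \<notin> U j"
proof -
  have "{s, fst (ends k)} \<in> path_edges (the (succ_path n s t w k))"
    "{snd (ends k), t} \<in> path_edges (the (succ_path n s t w k))"
    using mid_props[OF assms(1)] path_edges_at_s path_edges_at_t by (auto simp: ends_def)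
  then show "{s, fst (ends k)} \<notin> U j" "{snd (ends k), t} \<notin> U j"
    using succ_path_minimal(2)[OF assms(1)] used_edges_mono[OF assms(2), of n s t w] by auto
qed

lemma E_earlier: "E k \<Longrightarrow> 1 \<le> j \<Longrightarrow> j \<le> k \<Longrightarrow> E j"
  using succ_path_exists_earlier[of n s t w k j] by (cases "j = k") auto

text \<open>Edge-disjoint paths use different edges at \<open>s\<close> and different edges at
  \<open>t\<close>.\<close>

lemma inj_ends:
  assumes "\<And>j. j \<in> {1..<k} \<Longrightarrow> E j"
  shows "inj_on (fst \<circ> ends) {1..<k}" "inj_on (snd \<circ> ends) {1..<k}"
proof -
  have *: "fst (ends i) \<noteq> fst (ends j) \<and> snd (ends i) \<noteq> snd (ends j)" if "i < j" "1 \<le> i" "E j" for i j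
  proof -
    have exj: "E m" if "m \<in> {1..<j}" for m using E_earlier[OF \<open>E j\<close>] that by auto
    have "i \<in> {1..<j}" using that by auto
    then have "fst (ends i) \<in> (fst \<circ> ends) ` {1..<j}" "snd (ends i) \<in> (snd \<circ> ends) ` {1..<j}" by auto
    then have "{s, fst (ends i)} \<in> U j" "{snd (ends i), t} \<in> U j"
      using used_at_s[OF exj] used_at_t[OF exj] by blast+
    then show ?thesis using ends_unused[OF \<open>E j\<close> order_refl] by metis
  qed
  show "inj_on (fst \<circ> ends) {1..<k}"
    by (rule linorder_inj_onI) (use * assms in auto)
  show "inj_on (snd \<circ> ends) {1..<k}"
    by (rule linorder_inj_onI) (use * assms in auto)
qed

text \<open>Pigeonhole: at least k edges at \<open>s\<close> weigh no more than the k-th order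
  statistic, and only k - 1 of them have been used.\<close>

lemma available_s:
  assumes "\<And>j. j \<in> {1..<k} \<Longrightarrow> E j" "1 \<le> k" "k \<le> n - 1"
  obtains v where "v < n" "v \<noteq> s" "{s, v} \<notin> U k" "w {s, v} \<le> order_stat n s w k"
proof -
  let ?N = "{v \<in> {..<n} - {s}. w {s, v} \<le> order_stat n s w k}"
  have "k \<le> card ?N" using order_stat_le_iff[OF assms(2,3) s_less] by blast
  moreover have "card ((fst \<circ> ends) ` {1..<k}) \<le> k - 1"
    using card_image_le[of "{1..<k}" "fst \<circ> ends"] by simp
  moreover have "?N \<subseteq> (fst \<circ> ends) ` {1..<k} \<Longrightarrow> card ?N \<le> card ((fst \<circ> ends) ` {1..<k})"
    by (rule card_mono) auto
  ultimately have "\<not> ?N \<subseteq> (fst \<circ> ends) ` {1..<k}" using assms(2) by linarith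
  then show ?thesis using that used_at_s[OF assms(1)] by blast
qed

lemma available_t:
  assumes "\<And>j. j \<in> {1..<k} \<Longrightarrow> E j" "1 \<le> k" "k \<le> n - 1"
  obtains v where "v < n" "v \<noteq> t" "{v, t} \<notin> U k" "w {v, t} \<le> order_stat n t w k"
proof -
  let ?N = "{v \<in> {..<n} - {t}. w {t, v} \<le> order_stat n t w k}"
  have "k \<le> card ?N" using order_stat_le_iff[OF assms(2,3) t_less] by blast
  moreover have "card ((snd \<circ> ends) ` {1..<k}) \<le> k - 1"
    using card_image_le[of "{1..<k}" "snd \<circ> ends"] by simp
  moreover have "?N \<subseteq> (snd \<circ> ends) ` {1..<k} \<Longrightarrow> card ?N \<le> card ((snd \<circ> ends) ` {1..<k})"
    by (rule card_mono) auto
  ultimately have "\<not> ?N \<subseteq> (snd \<circ> ends) ` {1..<k}" using assms(2) by linarith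
  then obtain v where "v \<in> ?N" "v \<notin> (snd \<circ> ends) ` {1..<k}" by blast
  then show ?thesis using that[of v] used_at_t[of k v] assms(1) by (auto simp: insert_commute)
qed

text \<open>Free light edges at both ends exist by pigeonhole. If one of them is the edge between
  \<open>s\<close> and \<open>t\<close>, it is itself a candidate path and needs no
  connection.\<close>

lemma cost_le_order_stats:
  assumes ex: "\<And>j. j \<in> {1..<k} \<Longrightarrow> E j" and k: "1 \<le> k" "k \<le> n - 1" and c: "0 \<le> c"
    and conn: "\<And>a b. a \<in> A \<Longrightarrow> b \<in> A \<Longrightarrow> {s, a} \<notin> U k \<Longrightarrow> {b, t} \<notin> U k \<Longrightarrow>
        w {s, a} \<le> order_stat n s w k \<Longrightarrow> w {b, t} \<le> order_stat n t w k \<Longrightarrow> conn A (U k) w a b c"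
  shows "E k \<and> X k \<le> order_stat n s w k + order_stat n t w k + c"
proof -
  obtain a where a: "a < n" "a \<noteq> s" "{s, a} \<notin> U k" "w {s, a} \<le> order_stat n s w k"
    using available_s[OF ex k] by blast
  obtain b where b: "b < n" "b \<noteq> t" "{b, t} \<notin> U k" "w {b, t} \<le> order_stat n t w k"
    using available_t[OF ex k] by blast
  have nn: "0 \<le> w {s, a}" "0 \<le> w {b, t}"
    using a b by (auto intro!: weight_nonneg simp: s_less t_less)
  show ?thesis
  proof (cases "a = t \<or> b = s")
    case True
    then have "{s, t} \<notin> U k" "w {s, t} \<le> max (order_stat n s w k) (order_stat n t w k)"
      using a b by auto
    moreover from this have "E k \<and> X k \<le> w {s, t}" using step_upper_direct[OF ex] by blast
    ultimately show ?thesis using a b c nn by linarith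
  next
    case False
    then have "a \<in> A" "b \<in> A" using a b by (auto simp: A_def)
    then show ?thesis using step_upper[OF ex conn[OF _ _ a(3) b(3) a(4) b(4)] a(3) b(3)] a b by auto
  qed
qed

lemma X_eq:
  assumes "E k" "mid k \<noteq> []"
  shows "X k = w {s, fst (ends k)} + w {snd (ends k), t} + path_cost w (mid k)"
    "fst (ends k) \<in> A" "snd (ends k) \<in> A"
proof -
  show "X k = w {s, fst (ends k)} + w {snd (ends k), t} + path_cost w (mid k)"
    using mid_props[OF assms(1)] path_cost_st[of "mid k"] assms(2)
    by (simp add: succ_cost_def ends_def)
  show "fst (ends k) \<in> A" "snd (ends k) \<in> A"
    using mid_props(3)[OF assms(1)] assms(2) by (auto simp: ends_def)
qed

text \<open>When \<open>P\<^sub>i\<close> is chosen, the end edges of the later path \<open>P\<^sub>k\<close> are still available,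
  so \<open>P\<^sub>i\<close> is compared with a path that starts like \<open>P\<^sub>k\<close> and ends like \<open>P\<^sub>i\<close>, or conversely.
  Hence the end edges are used almost in increasing order.\<close>

lemma order_stats_le_cost:
  assumes "E k" "I \<subseteq> {1..k}" "k \<in> I" and nd: "\<And>i. i \<in> I \<Longrightarrow> mid i \<noteq> []"
    and mu: "\<And>i. i \<in> I \<Longrightarrow> \<mu> \<le> path_cost w (mid i)"
    and nu: "\<And>i a b. i \<in> I \<Longrightarrow> a \<in> A \<Longrightarrow> b \<in> A \<Longrightarrow> {s, a} \<notin> U i \<Longrightarrow> {b, t} \<notin> U i \<Longrightarrow>
        X i \<le> w {s, a} + w {b, t} + \<nu>"
  shows "order_stat n s w (card I) + order_stat n t w (card I) + 3 * \<mu> - 2 * \<nu> \<le> X k"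
proof -
  have ex: "E i" if "i \<in> I" for i using E_earlier[OF assms(1)] assms(2) that by auto
  have ik: "i \<le> k" if "i \<in> I" for i using that assms(2) by auto
  have nek: "mid k \<noteq> []" using nd assms(3) by blast
  have fin: "finite I" using assms(2) finite_subset by blast
  have c1: "1 \<le> card I" using assms(3) fin card_gt_0_iff by (metis Suc_leI One_nat_def empty_iff)
  have inj: "inj_on (fst \<circ> ends) I" "inj_on (snd \<circ> ends) I"
  proof -
    have e: "E j" if "j \<in> {1..<Suc k}" for j using E_earlier[OF assms(1)] that by auto
    have sub: "I \<subseteq> {1..<Suc k}" using assms(2) by auto
    show "inj_on (fst \<circ> ends) I" by (rule inj_on_subset[OF inj_ends(1)[OF e] sub])
    show "inj_on (snd \<circ> ends) I" by (rule inj_on_subset[OF inj_ends(2)[OF e] sub])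
  qed
  have le: "w {s, fst (ends i)} \<le> w {s, fst (ends k)} + (\<nu> - \<mu>) \<and>
      w {snd (ends i), t} \<le> w {snd (ends k), t} + (\<nu> - \<mu>)" if i: "i \<in> I" for i
  proof -
    note Xi = X_eq[OF ex[OF i] nd[OF i]] and Xk = X_eq[OF assms(1) nek]
    have "X i \<le> w {s, fst (ends k)} + w {snd (ends i), t} + \<nu>"
      by (intro nu i Xi Xk ends_unused[OF assms(1) ik[OF i]] ends_unused[OF ex[OF i] order_refl])
    moreover have "X i \<le> w {s, fst (ends i)} + w {snd (ends k), t} + \<nu>"
      by (intro nu i Xi Xk ends_unused[OF assms(1) ik[OF i]] ends_unused[OF ex[OF i] order_refl])
    ultimately show ?thesis using Xi(1) mu[OF i] by linarith
  qed
  have inA: "fst (ends i) \<in> A" "snd (ends i) \<in> A" if "i \<in> I" for i using X_eq ex nd that by auto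
  \<comment> \<open>Each end edge of the last path falls short of its order statistic by at most
    \<open>\<nu> - \<mu>\<close>, and the inner part contributes at least \<mu>; this gives the
    correction 3 * \<mu> - 2 * \<nu>.\<close>
  have "order_stat n s w (card ((fst \<circ> ends) ` I)) \<le> w {s, fst (ends k)} + (\<nu> - \<mu>)"
    by (rule order_stat_le[OF _ _ _ c1[folded card_image[OF inj(1)]] s_less])
      (use le fin inA in \<open>auto simp: A_def\<close>)
  moreover have "order_stat n t w (card ((snd \<circ> ends) ` I)) \<le> w {snd (ends k), t} + (\<nu> - \<mu>)"
    by (rule order_stat_le[OF _ _ _ c1[folded card_image[OF inj(2)]] t_less])
      (use le fin inA in \<open>auto simp: A_def insert_commute\<close>)
  ultimately show ?thesis
    using X_eq(1)[OF assms(1) nek] mu[OF assms(3)]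
    unfolding card_image[OF inj(1)] card_image[OF inj(2)] by linarith
qed

end

subsection \<open>Expansion\<close>

text \<open>The lower bound \<theta> / 2 on the weights makes every deleted edge of the window
  consume at least \<theta> / 2 of the load, so that a small load cannot destroy many window
  edges.\<close>

definition win :: "(nat set \<Rightarrow> real) \<Rightarrow> real \<Rightarrow> nat set \<Rightarrow> nat set \<Rightarrow> (nat \<times> nat) set" where
  "win w \<theta> B V = {(u, v) \<in> B \<times> V. \<theta> / 2 < w {u, v} \<and> w {u, v} \<le> \<theta>}"

text \<open>The last premise pays for the union bound: choosing the complement of \<open>V\<close>
  costs about (n - card V) * ln n in the exponent, which must be small against the expected number
  card B * card V * \<theta> / 4 of window edges. As \<open>V\<close> contains a fifth of the
  vertices, that number is at least of order card B * n * \<theta>.\<close>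

definition expander :: "nat \<Rightarrow> (nat set \<Rightarrow> real) \<Rightarrow> real \<Rightarrow> bool" where
  "expander n w \<theta> \<longleftrightarrow> (\<forall>B V. B \<subseteq> {..<n} \<longrightarrow> V \<subseteq> {..<n} \<longrightarrow> B \<inter> V = {} \<longrightarrow> B \<noteq> {} \<longrightarrow>
     n \<le> 5 * card V \<longrightarrow> 400 * real (n - card V) * ln (real n) \<le> real (card B) * real n * \<theta> \<longrightarrow>
     real (card B) * real n * \<theta> / 50 < real (card (win w \<theta> B V)))"

context weighted_instance
begin

text \<open>Edges at \<open>s\<close> and \<open>t\<close> are left out, so that only inner parts of
  removed paths count.\<close>

definition load :: "nat set set \<Rightarrow> nat set \<Rightarrow> real" where
  "load R B = (\<Sum>e\<in>{e \<in> R. e \<subseteq> A \<and> card e = 2 \<and> e \<inter> B \<noteq> {}}. w e)"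

lemma edge_meets: "e \<subseteq> V \<Longrightarrow> card e = 2 \<Longrightarrow> e \<inter> V \<noteq> {}"
  by (auto simp: card_2_iff)

lemma load_mono:
  assumes "finite R'" "R \<subseteq> R'" "B \<subseteq> B'"
  shows "load R B \<le> load R' B'"
  unfolding load_def using assms nonneg_A
  by (intro sum_mono2) (auto simp: nonneg_weights_def)

lemma load_nonneg: "0 \<le> load R B"
  unfolding load_def using nonneg_A by (intro sum_nonneg) (auto simp: nonneg_weights_def)

text \<open>Let \<open>V\<close> consist of the vertices outside \<open>B\<close>, \<open>N\<close>,
  \<open>s\<close> and \<open>t\<close>. Every window edge between \<open>B\<close> and
  \<open>V\<close> lies in \<open>R\<close>, since its end in \<open>V\<close> would otherwise
  belong to \<open>N\<close>. If \<open>V\<close> met the size conditions of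
  \<open>expander\<close>, these edges alone would outweigh the load allowed at \<open>B\<close>.
  The two alternatives are the ways in which the size conditions fail.\<close>

lemma expand_one:
  assumes R: "finite R" and ex: "expander n w \<theta>" and \<theta>: "0 < \<theta>" and B: "B \<subseteq> A" "B \<noteq> {}"
    and load: "load R B \<le> real (card B) * real n * \<theta>\<^sup>2 / 100"
    and N: "N = {v \<in> A - B. \<exists>u\<in>B. {u, v} \<notin> R \<and> w {u, v} \<le> \<theta>}"
  shows "4 * n < 5 * (card (B \<union> N) + 2) \<or>
    real (card B) * real n * \<theta> < 400 * real (card (B \<union> N) + 2) * ln (real n)"
proof (rule ccontr)
  assume neg: "\<not> ?thesis"
  define V where "V = {..<n} - (B \<union> N \<union> {s, t})"
  have sub: "B \<union> N \<subseteq> A" using B N by auto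
  have finBN: "finite (B \<union> N)" using sub finite_A finite_subset by blast
  have "card (B \<union> N \<union> {s, t}) = card (B \<union> N) + 2"
    using sub finBN s_neq_t by (subst card_Un_disjoint) (auto simp: A_def)
  moreover have "B \<union> N \<union> {s, t} \<subseteq> {..<n}" using sub s_less t_less by (auto simp: A_def)
  moreover have "finite (B \<union> N \<union> {s, t})" using finBN by simp
  ultimately have cV: "card V = n - (card (B \<union> N) + 2)" and le: "card (B \<union> N) + 2 \<le> n"
    unfolding V_def using card_Diff_subset[of "B \<union> N \<union> {s, t}" "{..<n}"]
      card_mono[of "{..<n}" "B \<union> N \<union> {s, t}"] by auto
  have "real (card B) * real n * \<theta> / 50 < real (card (win w \<theta> B V))"
    by (rule ex[unfolded expander_def, rule_format])
      (use neg B cV le in \<open>auto simp: V_def A_def\<close>)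
  moreover have "real (card (win w \<theta> B V)) * (\<theta> / 2) \<le> load R B"
  proof -
    let ?f = "\<lambda>(u, v). {u, v}"
    have fw: "finite (win w \<theta> B V)"
      by (rule finite_subset[of _ "{..<n} \<times> {..<n}"]) (use B in \<open>auto simp: win_def V_def A_def\<close>)
    have inj: "inj_on ?f (win w \<theta> B V)"
      by (auto simp: inj_on_def win_def V_def doubleton_eq_iff)
    have "real (card (win w \<theta> B V)) * (\<theta> / 2) = (\<Sum>p\<in>win w \<theta> B V. \<theta> / 2)" by simp
    also have "\<dots> \<le> (\<Sum>p\<in>win w \<theta> B V. w (?f p))"
      by (intro sum_mono) (auto simp: win_def)
    also have "\<dots> = (\<Sum>e\<in>?f ` win w \<theta> B V. w e)" using inj by (simp add: sum.reindex)
    also have "\<dots> \<le> load R B"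
      unfolding load_def
    proof (rule sum_mono2)
      show "?f ` win w \<theta> B V \<subseteq> {e \<in> R. e \<subseteq> A \<and> card e = 2 \<and> e \<inter> B \<noteq> {}}"
        using B by (auto simp: win_def V_def A_def N card_insert_if)
    qed (use R nonneg_A in \<open>auto simp: nonneg_weights_def\<close>)
    finally show ?thesis .
  qed
  moreover have "real (card B) * real n * \<theta>\<^sup>2 / 100 = (real (card B) * real n * \<theta> / 50) * (\<theta> / 2)"
    by (simp add: power2_eq_square)
  moreover from calculation(1) have
    "(real (card B) * real n * \<theta> / 50) * (\<theta> / 2) < real (card (win w \<theta> B V)) * (\<theta> / 2)"
    using \<theta> by (intro mult_strict_right_mono) auto
  ultimately show False using load by linarith
qed

fun grow :: "nat set set \<Rightarrow> real \<Rightarrow> nat set \<Rightarrow> nat \<Rightarrow> nat set" where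
  "grow R \<theta> B 0 = B"
| "grow R \<theta> B (Suc i) = grow R \<theta> B i \<union> {v \<in> A - grow R \<theta> B i. \<exists>u\<in>grow R \<theta> B i. {u, v} \<notin> R \<and> w {u, v} \<le> \<theta>}"

lemma grow_subset: "B \<subseteq> A \<Longrightarrow> grow R \<theta> B i \<subseteq> A"
  by (induction i) auto

lemma grow_increasing: "B \<subseteq> grow R \<theta> B i"
  by (induction i) auto

lemma grow_conn:
  assumes "B \<subseteq> A" "0 \<le> \<theta>" "v \<in> grow R \<theta> B i"
  shows "\<exists>u\<in>B. conn A R w u v (real i * \<theta>)"
  using assms(3)
proof (induction i arbitrary: v)
  case 0
  then show ?case using assms by (auto intro!: bexI[of _ v] conn_refl)
next
  case (Suc i)
  show ?case
  proof (cases "v \<in> grow R \<theta> B i")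
    case True
    then obtain u where "u \<in> B" "conn A R w u v (real i * \<theta>)" using Suc.IH by blast
    then show ?thesis using assms(2) by (auto intro!: bexI[of _ u] conn_mono[of A R w u v "real i * \<theta>"] mult_right_mono)
  next
    case False
    with Suc.prems obtain u where u: "v \<in> A" "u \<in> grow R \<theta> B i" "{u, v} \<notin> R" "w {u, v} \<le> \<theta>" "u \<noteq> v"
      by auto
    then obtain x where "x \<in> B" "conn A R w x u (real i * \<theta>)" using Suc.IH by blast
    then have "conn A R w x v (real i * \<theta> + \<theta>)" using u conn_step nonneg_A by blast
    then show ?thesis using \<open>x \<in> B\<close> by (auto simp: algebra_simps)
  qed
qed

text \<open>The factor 1600 is four times the 400 of \<open>expander\<close>: failure of the size
  condition then means that the set grows at least twofold. The load allowance of the initial set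
  suffices throughout because the sets only increase.\<close>

lemma grow_card:
  assumes R: "finite R" and ex: "expander n w \<tau>" and B: "B \<subseteq> A" "B \<noteq> {}"
    and load: "load R A \<le> real (card B) * real n * \<tau>\<^sup>2 / 100"
    and \<tau>: "1600 * ln (real n) \<le> real n * \<tau>" "0 < \<tau>" and n: "20 \<le> n"
  shows "2 ^ i * card B \<le> card (grow R \<tau> B i) \<or> n < 2 * card (grow R \<tau> B i)"
proof (induction i)
  case (Suc i)
  define G where "G = grow R \<tau> B i"
  define N where "N = {v \<in> A - G. \<exists>u\<in>G. {u, v} \<notin> R \<and> w {u, v} \<le> \<tau>}"
  have G: "G \<subseteq> A" "B \<subseteq> G" unfolding G_def using grow_subset B grow_increasing by auto
  have fin: "finite (G \<union> N)" by (rule finite_subset[OF _ finite_A]) (use G in \<open>auto simp: N_def\<close>)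
  have mono: "card G \<le> card (G \<union> N)" using fin by (intro card_mono) auto
  have BG: "card B \<le> card G" using G fin by (intro card_mono) auto
  have pos: "0 < card B" using B finite_A by (meson card_gt_0_iff finite_subset)
  have L: "0 < ln (real n)" using n by simp
  have "load R G \<le> load R A" by (rule load_mono) (use R G in auto)
  also have "\<dots> \<le> real (card B) * real n * \<tau>\<^sup>2 / 100" by fact
  also have "\<dots> \<le> real (card G) * real n * \<tau>\<^sup>2 / 100"
    using BG by (intro divide_right_mono mult_right_mono) auto
  finally have lG: "load R G \<le> real (card G) * real n * \<tau>\<^sup>2 / 100" .
  have "G \<noteq> {}" using G B by auto
  from expand_one[OF R ex \<tau>(2) G(1) this lG N_def]
  have "4 * n < 5 * (card (G \<union> N) + 2) \<or> 2 * card G \<le> card (G \<union> N)"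
  proof
    assume *: "real (card G) * real n * \<tau> < 400 * real (card (G \<union> N) + 2) * ln (real n)"
    have "real (card G) * (1600 * ln (real n)) \<le> real (card G) * (real n * \<tau>)"
      using \<tau> by (intro mult_left_mono) auto
    with * have "(4 * real (card G)) * (400 * ln (real n)) < real (card (G \<union> N) + 2) * (400 * ln (real n))"
      by (simp add: algebra_simps)
    then have "4 * real (card G) < real (card (G \<union> N) + 2)"
      using L by (simp add: mult_less_cancel_right)
    then have "4 * card G < card (G \<union> N) + 2" by linarith
    then show ?thesis using pos BG by linarith
  qed auto
  moreover have "grow R \<tau> B (Suc i) = G \<union> N" by (simp add: G_def N_def)
  ultimately show ?case using Suc mono n unfolding G_def[symmetric] by auto
qed simp

text \<open>Two scales are at work. One step with a window \<open>\<theta>\<close> adapted to the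
  load at the end vertex reaches more than \<open>u\<close> vertices; from there the allowance is
  large enough for the much smaller window \<tau>, which doubles the set until it holds more than
  half of the vertices. Two such sets, grown from both ends, must meet.\<close>

lemma conn_expander:
  assumes R: "finite R" and ex: "expander n w \<tau>" "expander n w \<theta>\<^sub>x" "expander n w \<theta>\<^sub>y" and xy: "x \<in> A" "y \<in> A"
    and \<theta>: "0 < \<theta>\<^sub>x" "0 < \<theta>\<^sub>y" "load R {x} \<le> real n * \<theta>\<^sub>x\<^sup>2 / 100" "load R {y} \<le> real n * \<theta>\<^sub>y\<^sup>2 / 100"
    and u: "0 < u" "u + 2 \<le> 4 * real n / 5" "400 * (u + 2) * ln (real n) \<le> real n * \<theta>\<^sub>x" "400 * (u + 2) * ln (real n) \<le> real n * \<theta>\<^sub>y"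
    and load: "load R A \<le> u * real n * \<tau>\<^sup>2 / 100"
    and \<tau>: "1600 * ln (real n) \<le> real n * \<tau>" "0 < \<tau>" and n: "20 \<le> n" and I: "n \<le> 2 ^ I"
  shows "conn A R w x y (\<theta>\<^sub>x + \<theta>\<^sub>y + 2 * real I * \<tau>)"
proof -
  have half: "n < 2 * card (grow R \<tau> (grow R \<theta> {z} 1) I)"
    if z: "z \<in> A" and \<theta>: "0 < \<theta>" "load R {z} \<le> real n * \<theta>\<^sup>2 / 100" "400 * (u + 2) * ln (real n) \<le> real n * \<theta>"
      "expander n w \<theta>" for z \<theta>
  proof -
    define N where "N = {v \<in> A - {z}. \<exists>u\<in>{z}. {u, v} \<notin> R \<and> w {u, v} \<le> \<theta>}"
    define B where "B = {z} \<union> N"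
    have BA: "B \<subseteq> A" "B \<noteq> {}" using z by (auto simp: N_def B_def)
    have BE: "grow R \<theta> {z} 1 = B" by (auto simp: B_def N_def)
    have "4 * n < 5 * (card B + 2) \<or> real n * \<theta> < 400 * real (card B + 2) * ln (real n)"
      using expand_one[OF R \<theta>(4,1) _ _ _ N_def] z \<theta>(2) unfolding B_def by auto
    then have uB: "u < card B"
    proof
      assume "n * \<theta> < 400 * real (card B + 2) * ln (real n)"
      with \<theta>(3) have "(400 * ln (real n)) * (u + 2) < (400 * ln (real n)) * real (card B + 2)"
        by (simp add: algebra_simps)
      then have "u + 2 < real (card B + 2)" using n by (simp only: mult_less_cancel_left) auto
      then show ?thesis by simp
    next
      assume "4 * n < 5 * (card B + 2)"
      then have "real (4 * n) < real (5 * (card B + 2))" by (simp only: of_nat_less_iff)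
      then have "4 * real n < 5 * (real (card B) + 2)" by simp
      moreover have "5 * (u + 2) \<le> 4 * real n" using u(2) by simp
      ultimately have "5 * (u + 2) < 5 * (real (card B) + 2)" by linarith
      then show ?thesis by simp
    qed
    have "u * real n * \<tau>\<^sup>2 / 100 \<le> real (card B) * real n * \<tau>\<^sup>2 / 100"
      using uB by (intro divide_right_mono mult_right_mono) auto
    with load have "load R A \<le> real (card B) * real n * \<tau>\<^sup>2 / 100" by linarith
    from grow_card[OF R ex(1) BA this \<tau> n, of I]
    have "2 ^ I * card B \<le> card (grow R \<tau> B I) \<or> n < 2 * card (grow R \<tau> B I)" .
    \<comment> \<open>Full doubling would produce at least n vertices inside \<open>A\<close>, which
      has only n - 2; so the set has passed half of the vertices.\<close>
    moreover have "card (grow R \<tau> B I) \<le> n - 2"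
    proof -
      have "card (grow R \<tau> B I) \<le> card A" using grow_subset[OF BA(1)] finite_A by (intro card_mono)
      also have "card A = n - 2" using s_less t_less s_neq_t by (simp add: A_def)
      finally show ?thesis .
    qed
    moreover have "0 < card B" using uB u(1) by linarith
    moreover from this have "n \<le> 2 ^ I * card B" using I by (metis Suc_leI le_trans mult.right_neutral mult_le_mono2 One_nat_def)
    ultimately show ?thesis unfolding BE using n by linarith
  qed
  define Gx where "Gx = grow R \<tau> (grow R \<theta>\<^sub>x {x} 1) I"
  define Gy where "Gy = grow R \<tau> (grow R \<theta>\<^sub>y {y} 1) I"
  have sub: "grow R \<theta>\<^sub>x {x} 1 \<subseteq> A" "grow R \<theta>\<^sub>y {y} 1 \<subseteq> A" using xy by auto
  have "Gx \<subseteq> A" "Gy \<subseteq> A" unfolding Gx_def Gy_def using grow_subset sub by auto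
  then have "card (Gx \<union> Gy) \<le> card {..<n}" by (intro card_mono) (auto simp: A_def)
  moreover have "n < 2 * card Gx" "n < 2 * card Gy"
    unfolding Gx_def Gy_def using half xy \<theta> u ex by auto
  moreover have "finite Gx" "finite Gy" using \<open>Gx \<subseteq> A\<close> \<open>Gy \<subseteq> A\<close> finite_A finite_subset by auto
  ultimately have "Gx \<inter> Gy \<noteq> {}"
    using card_Un_disjoint[of Gx Gy] by (intro notI) auto
  then obtain v where v: "v \<in> Gx" "v \<in> Gy" by blast
  have half_conn: "conn A R w z v (\<theta> + real I * \<tau>)"
    if z: "z \<in> A" "0 < \<theta>" "v \<in> grow R \<tau> (grow R \<theta> {z} 1) I" for z \<theta>
  proof -
    have "grow R \<theta> {z} 1 \<subseteq> A" using z by auto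
    then obtain b where b: "b \<in> grow R \<theta> {z} 1" "conn A R w b v (real I * \<tau>)"
      using grow_conn[OF _ _ z(3)] \<tau> by auto
    have "conn A R w z b \<theta>" using grow_conn[of "{z}" \<theta> b R 1] z b by auto
    then show ?thesis using conn_trans[OF _ b(2) nonneg_A] by blast
  qed
  have "conn A R w x v (\<theta>\<^sub>x + real I * \<tau>)" "conn A R w y v (\<theta>\<^sub>y + real I * \<tau>)"
    using half_conn xy \<theta> v unfolding Gx_def Gy_def by auto
  then have "conn A R w x y ((\<theta>\<^sub>x + real I * \<tau>) + (\<theta>\<^sub>y + real I * \<tau>))"
    using conn_trans[OF _ conn_sym nonneg_A] by blast
  then show ?thesis by (simp add: algebra_simps)
qed

section \<open>Bookkeeping of the load of the removed paths\<close>

lemma load_sum_vertices: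
  assumes "finite R" "V \<subseteq> A"
  shows "(\<Sum>x\<in>V. load R {x}) \<le> 2 * load R A"
proof -
  let ?R = "{e \<in> R. e \<subseteq> A \<and> card e = 2}"
  have fin: "finite ?R" "finite V" using assms finite_A finite_subset by auto
  have "(\<Sum>x\<in>V. load R {x}) = (\<Sum>x\<in>V. \<Sum>e\<in>?R. if x \<in> e then w e else 0)"
    unfolding load_def
  proof (rule sum.cong[OF refl])
    fix x
    have "{e \<in> R. e \<subseteq> A \<and> card e = 2 \<and> e \<inter> {x} \<noteq> {}} = {e \<in> ?R. x \<in> e}" by auto
    then show "(\<Sum>e\<in>{e \<in> R. e \<subseteq> A \<and> card e = 2 \<and> e \<inter> {x} \<noteq> {}}. w e) = (\<Sum>e\<in>?R. if x \<in> e then w e else 0)"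
      using fin by (simp only: sum.inter_filter)
  qed
  also have "\<dots> = (\<Sum>e\<in>?R. \<Sum>x\<in>V. if x \<in> e then w e else 0)" by (rule sum.swap)
  also have "\<dots> \<le> (\<Sum>e\<in>?R. 2 * w e)"
  proof (rule sum_mono)
    fix e assume e: "e \<in> ?R"
    then have w: "0 \<le> w e" using nonneg_A by (auto simp: nonneg_weights_def)
    have "finite e" using e by (auto intro: card_ge_0_finite)
    have "(\<Sum>x\<in>V. if x \<in> e then w e else 0) = real (card (V \<inter> e)) * w e"
      using fin by (simp add: sum.If_cases Int_def)
    also have "\<dots> \<le> 2 * w e"
      using card_mono[of e "V \<inter> e"] e w \<open>finite e\<close> by (intro mult_right_mono) auto
    finally show "(\<Sum>x\<in>V. if x \<in> e then w e else 0) \<le> 2 * w e" .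
  qed
  also have "\<dots> = 2 * load R A"
    unfolding load_def sum_distrib_left using edge_meets by (intro sum.cong) auto
  finally show ?thesis .
qed

subsection \<open>The process when \<open>k\<close> is large\<close>

lemma finite_used [simp]: "finite (U k)"
  by (simp add: used_edges_def)

lemma inner_edges:
  assumes "E j"
  shows "{e \<in> path_edges (the (succ_path n s t w j)). e \<subseteq> A} = path_edges (mid j)"
proof -
  note m = mid_props[OF assms]
  have "{e \<in> path_edges (s # q @ [t]). e \<subseteq> A} = path_edges q" if "set q \<subseteq> A" for q
    using that path_edges_subset[of _ q] path_edges_st[of q]
    by (cases "q = []") (auto simp: A_def)
  then show ?thesis using m by simp
qed

text \<open>Edge-disjointness makes the costs of the inner parts add up exactly.\<close>

lemma load_used:
  assumes "\<And>j. j \<in> {1..<k} \<Longrightarrow> E j"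
  shows "load (U k) A = (\<Sum>j\<in>{1..<k}. path_cost w (mid j))"
proof -
  have eq: "{e \<in> U k. e \<subseteq> A \<and> card e = 2 \<and> e \<inter> A \<noteq> {}} = (\<Union>j\<in>{1..<k}. path_edges (mid j))"
  proof (intro equalityI subsetI)
    fix e assume "e \<in> (\<Union>j\<in>{1..<k}. path_edges (mid j))"
    then obtain j where j: "j \<in> {1..<k}" "e \<in> path_edges (mid j)" by auto
    then have "e \<in> path_edges (the (succ_path n s t w j))" "e \<subseteq> A" using inner_edges[OF assms[OF j(1)]] by auto
    moreover have "card e = 2" using j path_edges_card2 mid_props(2)[OF assms[OF j(1)]] by blast
    ultimately show "e \<in> {e \<in> U k. e \<subseteq> A \<and> card e = 2 \<and> e \<inter> A \<noteq> {}}"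
      using j edge_meets by (auto simp: used_edges_def)
  next
    fix e assume "e \<in> {e \<in> U k. e \<subseteq> A \<and> card e = 2 \<and> e \<inter> A \<noteq> {}}"
    then show "e \<in> (\<Union>j\<in>{1..<k}. path_edges (mid j))"
      using inner_edges assms unfolding used_edges_def by blast
  qed
  have disj: "path_edges (mid i) \<inter> path_edges (mid j) = {}" if "i < j" "1 \<le> i" "E j" for i j
  proof -
    have i: "E i" using E_earlier[OF that(3,2)] that by simp
    have "path_edges (mid i) \<subseteq> U j"
      using inner_edges[OF i] that by (auto simp: used_edges_def)
    moreover have "path_edges (mid j) \<subseteq> path_edges (the (succ_path n s t w j))"
      using inner_edges[OF that(3)] by auto
    ultimately show ?thesis using succ_path_minimal(2)[OF that(3)] by blast
  qed
  have dj: "path_edges (mid i) \<inter> path_edges (mid j) = {}"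
    if "i \<in> {1..<k}" "j \<in> {1..<k}" "i \<noteq> j" for i j
    using disj[of i j] disj[of j i] that assms by (cases i j rule: linorder_cases) auto
  show ?thesis
    unfolding load_def eq path_cost_def
    by (rule sum.UNION_disjoint) (use dj in auto)
qed

text \<open>The assumption \<open>local\<close> is the form in which expansion enters: a connection
  between two vertices pays one eighth of the load at each of them. The factor 1/8 is small enough
  for the sum over all paths to be absorbed by the total load.\<close>

context
  fixes k :: nat and \<sigma> \<zeta> :: real
  assumes k: "k \<le> n - 1" and \<sigma>: "0 \<le> \<sigma>"
    and local: "\<And>R x y. finite R \<Longrightarrow> load R A \<le> 16 * \<sigma> * k \<Longrightarrow> x \<in> A \<Longrightarrow> y \<in> A \<Longrightarrow>
        conn A R w x y (8 * \<sigma> + (load R {x} + load R {y}) / 8)"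
begin

text \<open>The end edges of \<open>P_i\<close> are free at its own step, so its inner part cannot
  cost more than any free connection between the same two vertices.\<close>

lemma mid_le_local:
  assumes "E i" "mid i \<noteq> []" "load (U i) A \<le> 16 * \<sigma> * k"
  shows "path_cost w (mid i) \<le> 8 * \<sigma> + (load (U i) {fst (ends i)} + load (U i) {snd (ends i)}) / 8"
proof -
  have "E j" if "j \<in> {1..<i}" for j using E_earlier[OF assms(1)] that by auto
  from step_upper[OF this local[OF _ assms(3) X_eq(2,3)[OF assms(1,2)]] ends_unused[OF assms(1) order_refl]]
  show ?thesis using X_eq(1)[OF assms(1,2)] by simp
qed

text \<open>The first inner vertices of the paths are distinct, so the loads at them add up to at most twice
  the total load. This turns the local bound into a self-improving bound on the total load.\<close>

lemma load_bounded: "j \<le> k \<Longrightarrow> (\<forall>i\<in>{1..<Suc j}. E i) \<and> load (U (Suc j)) A \<le> 16 * \<sigma> * k"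
proof (induction j)
  case 0
  then show ?case using \<sigma> by (simp add: used_edges_def load_def)
next
  case (Suc j)
  then have IH: "\<And>i. i \<in> {1..<Suc j} \<Longrightarrow> E i" "load (U (Suc j)) A \<le> 16 * \<sigma> * k" by auto
  \<comment> \<open>For mere existence the crude bound of the load at a vertex by the total load is
    enough; the sharper summation below needs the new path to exist.\<close>
  have "E (Suc j)"
  proof (rule cost_le_order_stats[THEN conjunct1, OF IH(1)])
    fix a b assume ab: "a \<in> A" "b \<in> A"
    have "load (U (Suc j)) {a} \<le> load (U (Suc j)) A" "load (U (Suc j)) {b} \<le> load (U (Suc j)) A"
      by (auto intro!: load_mono ab)
    then show "conn A (U (Suc j)) w a b (8 * \<sigma> + load (U (Suc j)) A / 4)"
      by (intro conn_mono[OF local[OF _ IH(2) ab]]) auto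
  qed (use k Suc \<sigma> load_nonneg in auto)
  with IH have E: "\<And>i. i \<in> {1..<Suc (Suc j)} \<Longrightarrow> E i" by (auto simp: less_Suc_eq)
  let ?R = "U (Suc (Suc j))"
  define I where "I = {i \<in> {1..<Suc (Suc j)}. mid i \<noteq> []}"
  have inj: "inj_on (fst \<circ> ends) I" "inj_on (snd \<circ> ends) I"
    using inj_on_subset[of "fst \<circ> ends" "{1..<Suc (Suc j)}" I] inj_on_subset[of "snd \<circ> ends" "{1..<Suc (Suc j)}" I]
      inj_ends[of "Suc (Suc j)"] E unfolding I_def by blast+
  have mid: "path_cost w (mid i) \<le> 8 * \<sigma> + (load ?R {fst (ends i)} + load ?R {snd (ends i)}) / 8"
    if "i \<in> I" for i
  proof -
    have i: "E i" "mid i \<noteq> []" "i \<le> Suc j" "1 \<le> i" using that E by (auto simp: I_def)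
    have "load (U i) A \<le> load (U (Suc j)) A"
      using i used_edges_mono[of i "Suc j"] by (intro load_mono) auto
    then have "load (U i) A \<le> 16 * \<sigma> * k" using IH(2) by linarith
    note mid_le_local[OF i(1,2) this]
    moreover have "load (U i) {x} \<le> load ?R {x}" for x
      using i used_edges_mono[of i "Suc (Suc j)"] by (intro load_mono) auto
    ultimately show ?thesis by (smt (verit) divide_right_mono)
  qed
  have "load ?R A = (\<Sum>i\<in>{1..<Suc (Suc j)}. path_cost w (mid i))" by (rule load_used[OF E])
  also have "\<dots> = (\<Sum>i\<in>I. path_cost w (mid i))"
    by (rule sum.mono_neutral_right) (auto simp: I_def)
  also have "\<dots> \<le> (\<Sum>i\<in>I. 8 * \<sigma> + (load ?R {fst (ends i)} + load ?R {snd (ends i)}) / 8)"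
    by (intro sum_mono mid)
  also have "\<dots> = real (card I) * (8 * \<sigma>) +
      ((\<Sum>i\<in>I. load ?R {(fst \<circ> ends) i}) + (\<Sum>i\<in>I. load ?R {(snd \<circ> ends) i})) / 8"
    by (simp add: sum.distrib sum_divide_distrib[symmetric])
  also have "(\<Sum>i\<in>I. load ?R {(fst \<circ> ends) i}) = (\<Sum>x\<in>(fst \<circ> ends) ` I. load ?R {x})"
    by (subst sum.reindex[OF inj(1)]) (simp add: comp_def)
  also have "(\<Sum>i\<in>I. load ?R {(snd \<circ> ends) i}) = (\<Sum>x\<in>(snd \<circ> ends) ` I. load ?R {x})"
    by (subst sum.reindex[OF inj(2)]) (simp add: comp_def)
  also have "(\<Sum>x\<in>(fst \<circ> ends) ` I. load ?R {x}) \<le> 2 * load ?R A"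
    by (rule load_sum_vertices) (use X_eq E in \<open>auto simp: I_def\<close>)
  also have "(\<Sum>x\<in>(snd \<circ> ends) ` I. load ?R {x}) \<le> 2 * load ?R A"
    by (rule load_sum_vertices) (use X_eq E in \<open>auto simp: I_def\<close>)
  \<comment> \<open>The two sums over end vertices contribute 4/8 of the total load, which moves to
    the left-hand side and leaves a factor 2.\<close>
  finally have "load ?R A \<le> 2 * (real (card I) * (8 * \<sigma>))" by simp
  also have "real (card I) * (8 * \<sigma>) \<le> real k * (8 * \<sigma>)"
  proof (rule mult_right_mono)
    have "card I \<le> card {1..<Suc (Suc j)}" unfolding I_def by (rule card_mono) auto
    then show "real (card I) \<le> real k" using Suc.prems by simp
  qed (use \<sigma> in simp)
  finally show ?case using E by (simp add: mult_ac)
qed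

text \<open>The direct path has no inner part, so the exchange of ends does not apply to it. It
  occurs at most once because its end at \<open>s\<close> is always \<open>t\<close>; this accounts
  for the index k - 1 in the lower bound. With \<mu> = 0 the correction is just -2 *
  \<zeta>.\<close>

lemma large_sandwich:
  assumes k2: "2 \<le> k" and "0 \<le> \<zeta>" and glob: "\<And>R x y. finite R \<Longrightarrow> load R A \<le> 16 * \<sigma> * k \<Longrightarrow> x \<in> A \<Longrightarrow> y \<in> A \<Longrightarrow>
        conn A R w x y \<zeta>"
  shows "E k" "X k \<le> order_stat n s w k + order_stat n t w k + \<zeta>"
    "order_stat n s w (k - 1) + order_stat n t w (k - 1) - 2 * \<zeta> \<le> X k"
proof -
  have all: "\<And>i. i \<in> {1..<Suc k} \<Longrightarrow> E i" and load: "load (U (Suc k)) A \<le> 16 * \<sigma> * k"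
    using load_bounded[of k] by auto
  show Ek: "E k" using all k2 by simp
  have loadi: "load (U i) A \<le> 16 * \<sigma> * k" if "i \<le> k" for i
    using load load_mono[of "U (Suc k)" "U i" A A] used_edges_mono[of i "Suc k"] that by fastforce
  show "X k \<le> order_stat n s w k + order_stat n t w k + \<zeta>"
    by (rule cost_le_order_stats[THEN conjunct2])
      (use all k2 k assms(2) glob[OF _ loadi[OF order_refl]] in auto)
  have low: "order_stat n s w (card I) + order_stat n t w (card I) - 2 * \<zeta> \<le> X k'"
    if I: "I \<subseteq> {1..k'}" "k' \<in> I" "k' \<le> k" "\<And>i. i \<in> I \<Longrightarrow> mid i \<noteq> []" for I k'
  proof -
    have "order_stat n s w (card I) + order_stat n t w (card I) + 3 * 0 - 2 * \<zeta> \<le> X k'"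
    proof (rule order_stats_le_cost[OF _ I(1,2,4)])
      show "E k'" using all I by force
      show "0 \<le> path_cost w (mid i)" if "i \<in> I" for i
        using path_cost_nonneg[OF nonneg_A] mid_props(2,3)[OF all[of i]] that I by auto
      fix i a b assume i: "i \<in> I" and ab: "a \<in> A" "b \<in> A" "{s, a} \<notin> U i" "{b, t} \<notin> U i"
      then have ik: "i \<le> k" "1 \<le> i" using I by auto
      show "X i \<le> w {s, a} + w {b, t} + \<zeta>"
        using step_upper[OF _ glob[OF _ loadi[OF ik(1)] ab(1,2)] ab(3,4)] all ik by auto
    qed
    then show ?thesis by simp
  qed
  have uniq: "i = j" if "mid i = []" "mid j = []" "i \<in> {1..<Suc k}" "j \<in> {1..<Suc k}" for i j
    using inj_onD[OF inj_ends(1)[of "Suc k"], of i j] all that by (auto simp: ends_def)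
  show "order_stat n s w (k - 1) + order_stat n t w (k - 1) - 2 * \<zeta> \<le> X k"
  \<comment> \<open>If the last path is the direct one, all earlier paths have inner parts; the
    bound is proved for \<open>P_(k-1)\<close> and carried over by monotonicity of the
    costs.\<close>
  proof (cases "mid k = []")
    case True
    have "order_stat n s w (card {1..k - 1}) + order_stat n t w (card {1..k - 1}) - 2 * \<zeta> \<le> X (k - 1)"
      by (rule low) (use uniq[of _ k] True k2 in force)+
    also have "X (k - 1) \<le> X k" by (rule succ_cost_mono[OF Ek]) (use k2 in auto)
    finally show ?thesis by simp
  next
    case False
    define I where "I = {i \<in> {1..k}. mid i \<noteq> []}"
    have "card ({1..k} - I) \<le> 1"
      using uniq by (intro card_le_Suc0_iff_eq[THEN iffD2, simplified One_nat_def[symmetric]]) (auto simp: I_def)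
    moreover have "card ({1..k} - I) = k - card I" by (subst card_Diff_subset) (auto simp: I_def)
    ultimately have c: "k - 1 \<le> card I" by linarith
    have "card I \<le> card {1..k}" unfolding I_def by (rule card_mono) auto
    then have c': "card I \<le> n - 1" using k by simp
    have "order_stat n s w (k - 1) \<le> order_stat n s w (card I)" "order_stat n t w (k - 1) \<le> order_stat n t w (card I)"
      using c c' k2 s_less t_less by (auto intro!: order_stat_mono)
    moreover have "order_stat n s w (card I) + order_stat n t w (card I) - 2 * \<zeta> \<le> X k"
      by (rule low) (use False k2 in \<open>auto simp: I_def\<close>)
    ultimately show ?thesis by linarith
  qed
qed

end

end

subsection \<open>The process when \<open>k\<close> is small\<close>

lemma order_stat_nonneg:
  assumes "1 \<le> k" "k \<le> n - 1" "s < n" "\<And>v. v < n \<Longrightarrow> v \<noteq> s \<Longrightarrow> 0 \<le> w {s, v}"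
  shows "0 \<le> order_stat n s w k"
proof (rule ccontr)
  assume "\<not> ?thesis"
  then have c: "order_stat n s w k < 0" by simp
  then have "w {s, v} > order_stat n s w k" if "v < n" "v \<noteq> s" for v
    using assms(4)[OF that] by linarith
  then have "{v \<in> {..<n} - {s}. w {s, v} \<le> order_stat n s w k} = {}" by (force simp: not_le)
  with order_stat_le_iff[OF assms(1-3), of w "order_stat n s w k"] assms(1) show False
    by (simp only: card.empty order_refl le_zero_eq) simp
qed

context weighted_instance
begin

lemma X_direct: "E k \<Longrightarrow> mid k = [] \<Longrightarrow> X k = w {s, t}"
  using mid_props[of k] s_neq_t by (simp add: succ_cost_def path_cost_Cons)

lemma small_sandwich:
  fixes x z Y \<mu> :: real
  assumes k1: "k1 \<le> n - 1" and st: "z < w {s, t}"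
    and os: "order_stat n s w k1 \<le> x" "order_stat n t w k1 \<le> x" and Y: "0 \<le> Y" "2 * x + Y \<le> z"
    and E1: "\<And>a b. a \<in> A \<Longrightarrow> b \<in> A \<Longrightarrow> w {s, a} \<le> z \<Longrightarrow> w {b, t} \<le> z \<Longrightarrow> conn A {} w a b Y"
    and E2: "\<And>q q'. q \<noteq> [] \<Longrightarrow> distinct q \<Longrightarrow> set q \<subseteq> A \<Longrightarrow> q' \<noteq> [] \<Longrightarrow> distinct q' \<Longrightarrow> set q' \<subseteq> A \<Longrightarrow>
       w {s, hd q} \<le> z \<Longrightarrow> w {last q, t} \<le> z \<Longrightarrow> w {s, hd q'} \<le> z \<Longrightarrow> w {last q', t} \<le> z \<Longrightarrow>
       hd q \<noteq> hd q' \<Longrightarrow> last q \<noteq> last q' \<Longrightarrow> path_cost w q \<le> Y \<Longrightarrow> path_cost w q' \<le> Y \<Longrightarrow>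
       path_edges q \<inter> path_edges q' = {}"
    and E3: "\<And>q. q \<noteq> [] \<Longrightarrow> distinct q \<Longrightarrow> set q \<subseteq> A \<Longrightarrow> w {s, hd q} \<le> z \<Longrightarrow> w {last q, t} \<le> z \<Longrightarrow>
       \<mu> \<le> path_cost w q"
    and k: "1 \<le> k" "k \<le> k1"
  shows "E k" "X k \<le> order_stat n s w k + order_stat n t w k + Y"
    "order_stat n s w k + order_stat n t w k + 3 * \<mu> - 2 * Y \<le> X k"
proof -
  \<comment> \<open>The invariant carries the light ends and inner part needed to apply
    \<open>E2\<close> later, and the comparison with all free end edges needed for the exchange
    argument.\<close>
  define good where "good i \<longleftrightarrow> E i \<and> mid i \<noteq> [] \<and> w {s, fst (ends i)} \<le> z \<and> w {snd (ends i), t} \<le> z \<and>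
     path_cost w (mid i) \<le> Y \<and> X i \<le> order_stat n s w i + order_stat n t w i + Y \<and>
     (\<forall>a b. a \<in> A \<longrightarrow> b \<in> A \<longrightarrow> {s, a} \<notin> U i \<longrightarrow> {b, t} \<notin> U i \<longrightarrow> X i \<le> w {s, a} + w {b, t} + Y)" for i
  have "\<forall>i\<in>{1..<Suc j}. good i" if "j \<le> k1" for j
    using that
  proof (induction j)
    case (Suc j)
    then have IH: "\<And>i. i \<in> {1..<Suc j} \<Longrightarrow> good i" by auto
    then have ex: "\<And>i. i \<in> {1..<Suc j} \<Longrightarrow> E i" by (auto simp: good_def)
    have j: "1 \<le> Suc j" "Suc j \<le> n - 1" using Suc.prems k1 by auto
    have conn: "conn A (U (Suc j)) w a b Y"
      if ab: "a \<in> A" "b \<in> A" "{s, a} \<notin> U (Suc j)" "{b, t} \<notin> U (Suc j)" "w {s, a} \<le> z" "w {b, t} \<le> z" for a b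
    proof -
      obtain q where q: "q \<noteq> []" "hd q = a" "last q = b" "distinct q" "set q \<subseteq> A" "path_cost w q \<le> Y"
        using E1[OF ab(1,2,5,6)] by (auto simp: conn_def)
      have "e \<notin> U (Suc j)" if e: "e \<in> path_edges q" for e
      proof
        assume "e \<in> U (Suc j)"
        then obtain i where i: "i \<in> {1..<Suc j}" "e \<in> path_edges (the (succ_path n s t w i))"
          by (auto simp: used_edges_def)
        note g = IH[OF i(1), unfolded good_def]
        have "e \<subseteq> A" using path_edges_subset[OF e] q(5) by auto
        then have "e \<in> path_edges (mid i)" using i(2) inner_edges g by blast
        moreover have ends: "hd (mid i) = fst (ends i)" "last (mid i) = snd (ends i)"
          using g by (auto simp: ends_def)
        moreover have "fst (ends i) \<noteq> a" "snd (ends i) \<noteq> b"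
          using ab(3,4) i(1) used_at_s[OF ex, of "Suc j" a] used_at_t[OF ex, of "Suc j" b] by (auto simp: image_iff)
        ultimately have "path_edges q \<inter> path_edges (mid i) = {}"
          using g ab(5,6) mid_props[of i] q by (intro E2) auto
        then show False using \<open>e \<in> path_edges (mid i)\<close> e by blast
      qed
      then show ?thesis unfolding conn_def using q by (intro exI[of _ q]) auto
    qed
    have os': "order_stat n s w (Suc j) \<le> x" "order_stat n t w (Suc j) \<le> x"
      using order_stat_mono[OF j(1) Suc.prems k1 s_less, of w]
        order_stat_mono[OF j(1) Suc.prems k1 t_less, of w] os by auto
    have "0 \<le> order_stat n s w k1"
      by (rule order_stat_nonneg) (use k k1 s_less weight_nonneg[OF s_less] in auto)
    then have x: "0 \<le> x" using os by linarith
    have upper: "E (Suc j) \<and> X (Suc j) \<le> order_stat n s w (Suc j) + order_stat n t w (Suc j) + Y"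
      by (rule cost_le_order_stats[OF ex j Y(1)]) (use conn os' x Y in auto)
    then have Xz: "X (Suc j) \<le> z" using os' Y by linarith
    have nd: "mid (Suc j) \<noteq> []" using X_direct[of "Suc j"] upper Xz st by auto
    have Ej: "E (Suc j)" using upper by blast
    note Xe = X_eq[OF Ej nd]
    have nn: "0 \<le> w {s, a}" "0 \<le> w {a, t}" if "a \<in> A" for a
      using that weight_nonneg s_less t_less by (auto simp: A_def)
    have m0: "0 \<le> path_cost w (mid (Suc j))"
      using path_cost_nonneg[OF nonneg_A] mid_props[OF Ej] by blast
    have nu: "X (Suc j) \<le> w {s, a} + w {b, t} + Y"
      if ab: "a \<in> A" "b \<in> A" "{s, a} \<notin> U (Suc j)" "{b, t} \<notin> U (Suc j)" for a b
    proof (cases "w {s, a} \<le> z \<and> w {b, t} \<le> z")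
      case True
      then show ?thesis using step_upper[OF ex conn[OF ab] ab(3,4)] by blast
    next
      \<comment> \<open>An end edge heavier than \<open>z\<close> makes the right-hand side exceed
        \<open>z\<close>, while the cost of the new path is at most 2 * x + Y and hence at most
        \<open>z\<close>.\<close>
      case False
      then show ?thesis using Xz nn[OF ab(1)] nn[OF ab(2)] Y by auto
    qed
    have "path_cost w (mid (Suc j)) \<le> Y"
      using nu[OF Xe(2,3) ends_unused[OF Ej order_refl]] Xe(1) by linarith
    moreover have "w {s, fst (ends (Suc j))} \<le> z" "w {snd (ends (Suc j)), t} \<le> z"
      using Xe m0 nn[OF Xe(2)] nn[OF Xe(3)] Xz by linarith+
    ultimately have "good (Suc j)" unfolding good_def using upper nd nu by blast
    then show ?case using IH by (auto simp: less_Suc_eq)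
  qed simp
  then have good: "good i" if "i \<in> {1..k}" for i using that k by auto
  show Ek: "E k" "X k \<le> order_stat n s w k + order_stat n t w k + Y"
    using good[of k] k by (auto simp: good_def)
  have "order_stat n s w (card {1..k}) + order_stat n t w (card {1..k}) + 3 * \<mu> - 2 * Y \<le> X k"
  proof (rule order_stats_le_cost[OF Ek(1) order_refl])
    fix i assume i: "i \<in> {1..k}"
    note g = good[OF i, unfolded good_def]
    show "mid i \<noteq> []" using g by blast
    show "\<mu> \<le> path_cost w (mid i)"
      by (rule E3) (use g mid_props[of i] in \<open>auto simp: ends_def\<close>)
    show "X i \<le> w {s, a} + w {b, t} + Y"
      if "a \<in> A" "b \<in> A" "{s, a} \<notin> U i" "{b, t} \<notin> U i" for a b using g that by blast
  qed (use k in auto)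
  then show "order_stat n s w k + order_stat n t w k + 3 * \<mu> - 2 * Y \<le> X k" by simp
qed

end

subsection \<open>The edge-weight laws\<close>

locale edge_law =
  fixes D :: "real measure"
  assumes law: "D = uniform_law \<or> D = exponential_law"
begin

text \<open>Most estimates use no more than this about the two laws: the density is at most 1 and
  lives on the nonnegative reals, and it is at least 1/2 near 0. This treats both models at
  once.\<close>

lemma law_density:
  obtains f :: "real \<Rightarrow> real" where "f \<in> borel_measurable borel" "D = density lborel (\<lambda>x. ennreal (f x))"
    "\<And>x. 0 \<le> f x" "\<And>x. f x \<le> indicator {0..} x" "\<And>x. 0 < x \<Longrightarrow> x \<le> 1/2 \<Longrightarrow> 1/2 \<le> f x"
proof (cases "D = uniform_law")
  case True
  show ?thesis
  proof (rule that[of "indicator {0<..<1}"])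
    show "D = density lborel (\<lambda>x. ennreal (indicator {0<..<1} x))"
      unfolding True uniform_law_def uniform_measure_def by (simp add: ennreal_indicator divide_ennreal_def)
  qed (auto split: split_indicator)
next
  case False
  then have D: "D = density lborel (\<lambda>x. ennreal (exponential_density 1 x))"
    using law by (simp add: exponential_law_def)
  show ?thesis
  proof (rule that[OF _ D])
    fix x :: real assume "0 < x" "x \<le> 1/2"
    moreover have "1 + (-x) \<le> exp (-x)" by (rule exp_ge_add_one_self)
    ultimately show "1/2 \<le> exponential_density 1 x" by (simp add: exponential_density_def)
  qed (auto simp: exponential_density_def split: split_indicator)
qed

lemma prob_space_D: "prob_space D"
  using law prob_space_exponential_density[of 1]
  by (auto simp: uniform_law_def exponential_law_def intro!: prob_space_uniform_measure)

lemma sets_D [simp, measurable_cong]: "sets D = sets borel"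
  using law by (auto simp: uniform_law_def exponential_law_def)

lemma space_D [simp]: "space D = UNIV"
  using sets_eq_imp_space_eq[OF sets_D] by simp

lemma nn_integral_D_le:
  assumes [measurable]: "g \<in> borel_measurable borel"
  shows "(\<integral>\<^sup>+x. g x \<partial>D) \<le> (\<integral>\<^sup>+x. g x * indicator {0..} x \<partial>lborel)"
proof -
  obtain f :: "real \<Rightarrow> real" where f [measurable]: "f \<in> borel_measurable borel"
    and D: "D = density lborel (\<lambda>x. ennreal (f x))" and le: "\<And>x. f x \<le> indicator {0..} x"
    by (metis law_density)
  have "(\<integral>\<^sup>+x. g x \<partial>D) = (\<integral>\<^sup>+x. ennreal (f x) * g x \<partial>lborel)"
    unfolding D by (rule nn_integral_density) auto
  also have "\<dots> \<le> (\<integral>\<^sup>+x. g x * indicator {0..} x \<partial>lborel)"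
  proof (rule nn_integral_mono)
    fix x
    have "ennreal (f x) \<le> indicator {0..} x"
      using le[of x] ennreal_leI[OF le[of x]] by (simp add: ennreal_indicator)
    then show "ennreal (f x) * g x \<le> g x * indicator {0..} x"
      by (metis mult.commute mult_right_mono zero_le)
  qed
  finally show ?thesis .
qed

lemma emeasure_D_atMost: "0 \<le> x \<Longrightarrow> emeasure D {..x} \<le> ennreal x"
proof -
  assume x: "0 \<le> x"
  have "emeasure D {..x} = (\<integral>\<^sup>+y. indicator {..x} y \<partial>D)" by simp
  also have "\<dots> \<le> (\<integral>\<^sup>+y. indicator {..x} y * indicator {0..} y \<partial>lborel)"
    by (rule nn_integral_D_le) simp
  also have "\<dots> = (\<integral>\<^sup>+y. indicator {0..x} y \<partial>lborel)"
    by (intro nn_integral_cong) (auto split: split_indicator)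
  also have "\<dots> = ennreal x" using x by simp
  finally show ?thesis .
qed

lemma AE_D_nonneg: "AE x in D. 0 \<le> x"
proof -
  have "emeasure D {..<0} = (\<integral>\<^sup>+y. indicator {..<0} y \<partial>D)" by simp
  also have "\<dots> \<le> (\<integral>\<^sup>+(y::real). indicator {..<0} y * indicator {0..} y \<partial>lborel)"
    by (rule nn_integral_D_le) simp
  also have "\<dots> = (\<integral>\<^sup>+y. 0 \<partial>(lborel :: real measure))"
    by (intro nn_integral_cong) (auto split: split_indicator)
  finally have "emeasure D {..<0} = 0" by simp
  then show ?thesis by (intro AE_I[of _ _ "{..<0}"]) auto
qed

text \<open>A density bounded by 1 on the nonnegative reals has a Laplace transform bounded by that
  of Lebesgue measure there.\<close>

lemma nn_integral_D_exp:
  assumes l: "0 < l"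
  shows "(\<integral>\<^sup>+x. ennreal (exp (- l * x)) \<partial>D) \<le> ennreal (1 / l)"
proof -
  have "(\<integral>\<^sup>+x. ennreal (exp (- l * x)) \<partial>D) \<le> (\<integral>\<^sup>+x. ennreal (exp (- l * x)) * indicator {0..} x \<partial>lborel)"
    by (rule nn_integral_D_le) simp
  also have "\<dots> = (\<integral>\<^sup>+x. ennreal (1 / l) * ennreal (exponential_density l x) \<partial>lborel)"
    using l by (intro nn_integral_cong)
      (auto simp: exponential_density_def ennreal_mult[symmetric] mult_ac split: split_indicator)
  also have "\<dots> = ennreal (1 / l) * emeasure (density lborel (exponential_density l)) UNIV"
    by (subst nn_integral_cmult) (auto simp: emeasure_density)
  also have "emeasure (density lborel (exponential_density l)) UNIV = 1"
    using prob_space.emeasure_space_1[OF prob_space_exponential_density[OF l]] by simp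
  finally show ?thesis by simp
qed

lemma nn_integral_D_square: "(\<integral>\<^sup>+x. ennreal (x\<^sup>2) \<partial>D) \<le> 2"
proof -
  have "(\<integral>\<^sup>+x. ennreal (x\<^sup>2) \<partial>D) \<le> (\<integral>\<^sup>+x. ennreal (x\<^sup>2) \<partial>exponential_law)"
  proof (cases "D = uniform_law")
    case True
    have "(\<integral>\<^sup>+x. ennreal (x\<^sup>2) \<partial>D) = (\<integral>\<^sup>+x. ennreal (x\<^sup>2) * indicator {0<..<1} x \<partial>lborel)"
      unfolding True uniform_law_def by (subst nn_integral_uniform_measure) (auto simp: divide_ennreal_def)
    also have "\<dots> \<le> (\<integral>\<^sup>+x. indicator {0<..<1} x \<partial>(lborel :: real measure))"
      by (intro nn_integral_mono) (auto simp: ennreal_le_1 power_le_one split: split_indicator)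
    also have "\<dots> = 1" by simp
    also have "1 \<le> (\<integral>\<^sup>+x. ennreal (x\<^sup>2) \<partial>exponential_law)"
    proof -
      have "(\<integral>\<^sup>+x. ennreal (x\<^sup>2) \<partial>exponential_law) = 2"
        unfolding exponential_law_def
        using nn_integral_erlang_ith_moment[of 1 0 2] by (subst nn_integral_density) (auto simp: ennreal_mult[symmetric])
      then show ?thesis by simp
    qed
    finally show ?thesis .
  qed (use law in simp)
  also have "\<dots> = 2"
    unfolding exponential_law_def
    using nn_integral_erlang_ith_moment[of 1 0 2] by (subst nn_integral_density) (auto simp: ennreal_mult[symmetric])
  finally show ?thesis .
qed

text \<open>The window has length \<theta> / 2 and the density is at least 1/2 on it.\<close>

lemma measure_D_window:
  assumes "0 < \<theta>" "\<theta> \<le> 1/2"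
  shows "\<theta> / 4 \<le> measure D {\<theta>/2<..\<theta>}"
proof -
  interpret prob_space D by (rule prob_space_D)
  obtain f :: "real \<Rightarrow> real" where f [measurable]: "f \<in> borel_measurable borel"
    and D: "D = density lborel (\<lambda>x. ennreal (f x))" and ge: "\<And>x. 0 < x \<Longrightarrow> x \<le> 1/2 \<Longrightarrow> 1/2 \<le> f x"
    by (metis law_density)
  define c :: real where "c = 1/2"
  have "ennreal (\<theta> / 4) = ennreal (c * (\<theta> / 2))" by (simp add: c_def)
  also have "\<dots> = (\<integral>\<^sup>+x. ennreal c * indicator {\<theta>/2<..\<theta>} x \<partial>lborel)"
  proof -
    have "emeasure lborel {\<theta>/2<..\<theta>} = ennreal (\<theta> / 2)" using assms by simp
    moreover have "0 \<le> c" by (simp add: c_def)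
    ultimately show ?thesis using assms by (subst nn_integral_cmult_indicator) (auto simp: ennreal_mult[symmetric])
  qed
  also have "\<dots> \<le> (\<integral>\<^sup>+x. ennreal (f x) * indicator {\<theta>/2<..\<theta>} x \<partial>lborel)"
    using assms by (intro nn_integral_mono) (auto intro!: ennreal_leI ge simp: c_def simp del: ennreal_half split: split_indicator)
  also have "\<dots> = emeasure D {\<theta>/2<..\<theta>}" unfolding D by (subst emeasure_density) auto
  finally show ?thesis by (simp add: emeasure_eq_measure)
qed

text \<open>Markov's inequality in product form: the indicator of the event is dominated by a
  product of one-coordinate functions, whose integral factorises.\<close>

lemma measure_PiM_le_prod:
  assumes I: "finite I" and S: "S \<in> sets (PiM I (\<lambda>_. D))"
    and h [measurable]: "\<And>e. h e \<in> borel_measurable borel"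
    and le: "\<And>w. w \<in> S \<Longrightarrow> 1 \<le> ennreal c * (\<Prod>e\<in>I. h e (w e))"
    and b: "\<And>e. e \<in> I \<Longrightarrow> (\<integral>\<^sup>+x. h e x \<partial>D) \<le> ennreal (b e)" "\<And>e. 0 \<le> b e" "0 \<le> c"
  shows "measure (PiM I (\<lambda>_. D)) S \<le> c * (\<Prod>e\<in>I. b e)"
proof -
  interpret M: prob_space "PiM I (\<lambda>_. D)" by (rule prob_space_PiM) (rule prob_space_D)
  interpret D: prob_space D by (rule prob_space_D)
  interpret P: product_prob_space "\<lambda>_. D" by standard
  have "emeasure (PiM I (\<lambda>_. D)) S = (\<integral>\<^sup>+w. indicator S w \<partial>PiM I (\<lambda>_. D))"
    using S by simp
  also have "\<dots> \<le> (\<integral>\<^sup>+w. ennreal c * (\<Prod>e\<in>I. h e (w e)) \<partial>PiM I (\<lambda>_. D))"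
    using le by (intro nn_integral_mono) (auto split: split_indicator)
  also have "\<dots> = ennreal c * (\<integral>\<^sup>+w. (\<Prod>e\<in>I. h e (w e)) \<partial>PiM I (\<lambda>_. D))"
    using I by (intro nn_integral_cmult) measurable
  also have "(\<integral>\<^sup>+w. (\<Prod>e\<in>I. h e (w e)) \<partial>PiM I (\<lambda>_. D)) = (\<Prod>e\<in>I. \<integral>\<^sup>+x. h e x \<partial>D)"
    by (rule P.product_nn_integral_prod[OF I]) measurable
  also have "\<dots> \<le> (\<Prod>e\<in>I. ennreal (b e))" using b by (intro prod_mono_ennreal) auto
  also have "\<dots> = ennreal (\<Prod>e\<in>I. b e)" using b by (simp add: prod_ennreal)
  finally have "ennreal (measure (PiM I (\<lambda>_. D)) S) \<le> ennreal c * ennreal (\<Prod>e\<in>I. b e)"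
    by (simp add: M.emeasure_eq_measure mult_left_mono)
  then show ?thesis using b by (simp add: ennreal_mult[symmetric] prod_nonneg)
qed

lemma prod_if_power:
  fixes a b :: real
  assumes I: "finite I" and FG: "F \<subseteq> I" "G \<subseteq> I" "F \<inter> G = {}"
  shows "(\<Prod>e\<in>I. if e \<in> F then a else if e \<in> G then b else 1) = a ^ card F * b ^ card G"
proof -
  have fin: "finite F" "finite G" using FG I finite_subset by blast+
  have "(\<Prod>e\<in>I. if e \<in> F then a else if e \<in> G then b else 1) =
      (\<Prod>e\<in>F \<union> G. if e \<in> F then a else if e \<in> G then b else 1)"
    using I FG by (intro prod.mono_neutral_right) auto
  also have "\<dots> = (\<Prod>e\<in>F. if e \<in> F then a else if e \<in> G then b else 1) *
      (\<Prod>e\<in>G. if e \<in> F then a else if e \<in> G then b else 1)"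
    using FG fin by (intro prod.union_disjoint) auto
  also have "(\<Prod>e\<in>F. if e \<in> F then a else if e \<in> G then b else 1) = a ^ card F" by simp
  also have "(\<Prod>e\<in>G. if e \<in> F then a else if e \<in> G then b else 1) = (\<Prod>e\<in>G. b)"
    using FG by (intro prod.cong) auto
  finally show ?thesis by simp
qed

text \<open>An exponential Markov bound: each edge of \<open>F\<close> costs a factor
  \<open>z\<close> because the density is at most 1, each edge of \<open>G\<close> a factor 1 / l
  from the Laplace transform. The parameter \<open>l\<close> is left free; it will be a constant
  multiple of n.\<close>

lemma measure_light_le:
  assumes I: "finite I" and FG: "F \<subseteq> I" "G \<subseteq> I" "F \<inter> G = {}" and z: "0 \<le> z" and l: "0 < l"
  shows "measure (PiM I (\<lambda>_. D)) {w \<in> space (PiM I (\<lambda>_. D)). (\<forall>e\<in>F. w e \<le> z) \<and> (\<Sum>e\<in>G. w e) \<le> y}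
     \<le> z ^ card F * (exp (l * y) * (1 / l) ^ card G)"
    and "{w \<in> space (PiM I (\<lambda>_. D)). (\<forall>e\<in>F. w e \<le> z) \<and> (\<Sum>e\<in>G. w e) \<le> y} \<in> sets (PiM I (\<lambda>_. D))"
proof -
  let ?S = "{w \<in> space (PiM I (\<lambda>_. D)). (\<forall>e\<in>F. w e \<le> z) \<and> (\<Sum>e\<in>G. w e) \<le> y}"
  have fin: "finite F" "finite G" using FG I finite_subset by blast+
  have [measurable]: "(\<lambda>w. w e) \<in> borel_measurable (PiM I (\<lambda>_. D))" if "e \<in> F \<or> e \<in> G" for e
    using that FG measurable_component_singleton[of e I "\<lambda>_. D"] by (auto simp: measurable_def)
  show S: "?S \<in> sets (PiM I (\<lambda>_. D))" using fin by measurable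
  define h :: "'a \<Rightarrow> real \<Rightarrow> ennreal" where
    "h e x = (if e \<in> F then indicator {..z} x else if e \<in> G then ennreal (exp (- l * x)) else 1)" for e x
  have "measure (PiM I (\<lambda>_. D)) ?S \<le> exp (l * y) * (\<Prod>e\<in>I. if e \<in> F then z else if e \<in> G then 1 / l else 1)"
  proof (rule measure_PiM_le_prod[OF I S, where h = h])
    show "h e \<in> borel_measurable borel" for e unfolding h_def by measurable
    show "(\<integral>\<^sup>+x. h e x \<partial>D) \<le> ennreal (if e \<in> F then z else if e \<in> G then 1 / l else 1)" for e
      using emeasure_D_atMost[OF z] nn_integral_D_exp[OF l] prob_space.emeasure_space_1[OF prob_space_D]
      by (auto simp: h_def)
    fix w assume w: "w \<in> ?S"
    have "(\<Prod>e\<in>I. h e (w e)) = (\<Prod>e\<in>G. ennreal (exp (- l * w e)))"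
    proof -
      have "(\<Prod>e\<in>I. h e (w e)) = (\<Prod>e\<in>G. h e (w e))"
        using w I FG by (intro prod.mono_neutral_right) (auto simp: h_def)
      also have "\<dots> = (\<Prod>e\<in>G. ennreal (exp (- l * w e)))"
        using FG by (intro prod.cong) (auto simp: h_def)
      finally show ?thesis .
    qed
    also have "\<dots> = ennreal (exp (- l * (\<Sum>e\<in>G. w e)))"
      using fin by (subst prod_ennreal) (auto simp: exp_sum[symmetric] sum_distrib_left)
    also have "ennreal (exp (l * y)) * \<dots> = ennreal (exp (l * y - l * (\<Sum>e\<in>G. w e)))"
      by (simp add: ennreal_mult[symmetric] exp_diff exp_minus field_simps)
    also have "1 \<le> \<dots>"
    proof -
      have "l * (\<Sum>e\<in>G. w e) \<le> l * y" using w l by (intro mult_left_mono) auto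
      then have "1 \<le> exp (l * y - l * (\<Sum>e\<in>G. w e))" by simp
      then show ?thesis by (simp only: ennreal_1[symmetric] ennreal_leI)
    qed
    finally show "1 \<le> ennreal (exp (l * y)) * (\<Prod>e\<in>I. h e (w e))" by simp
  qed (use z l in auto)
  also have "(\<Prod>e\<in>I. if e \<in> F then z else if e \<in> G then 1 / l else 1) = z ^ card F * (1 / l) ^ card G"
    by (rule prod_if_power[OF I FG])
  finally show "measure (PiM I (\<lambda>_. D)) ?S \<le> z ^ card F * (exp (l * y) * (1 / l) ^ card G)"
    by (simp add: mult_ac)
qed

text \<open>Chernoff's lower tail with exponential parameter 1: one indicator contributes the factor
  1 - (1 - exp (-1)) * p, at most exp (- 3/5 * p).\<close>

lemma measure_few_le:
  assumes I: "finite I" and G: "G \<subseteq> I" and S: "S \<in> sets borel" and p: "p \<le> measure D S" and r: "0 \<le> r"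
  shows "measure (PiM I (\<lambda>_. D)) {w \<in> space (PiM I (\<lambda>_. D)). real (card {e \<in> G. w e \<in> S}) \<le> r}
     \<le> exp (r - 3/5 * p * card G)"
    and "{w \<in> space (PiM I (\<lambda>_. D)). real (card {e \<in> G. w e \<in> S}) \<le> r} \<in> sets (PiM I (\<lambda>_. D))"
proof -
  let ?B = "{w \<in> space (PiM I (\<lambda>_. D)). real (card {e \<in> G. w e \<in> S}) \<le> r}"
  interpret D: prob_space D by (rule prob_space_D)
  have fin: "finite G" using G I finite_subset by blast
  note S[measurable]
  have m: "(\<lambda>x. exp (- indicat_real S x)) \<in> borel_measurable D" by measurable
  have [measurable]: "(\<lambda>w. w e) \<in> borel_measurable (PiM I (\<lambda>_. D))" if "e \<in> G" for e
    using that G measurable_component_singleton[of e I "\<lambda>_. D"] by (auto simp: measurable_def)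
  have card: "real (card {e \<in> G. w e \<in> S}) = (\<Sum>e\<in>G. indicator S (w e))" for w :: "'a \<Rightarrow> real"
    using fin by (simp add: indicator_def sum.If_cases Int_def conj_commute)
  show B: "?B \<in> sets (PiM I (\<lambda>_. D))" unfolding card by measurable
  define h :: "'a \<Rightarrow> real \<Rightarrow> ennreal" where
    "h e x = (if e \<in> G then ennreal (exp (- indicator S x)) else 1)" for e x
  \<comment> \<open>This is the origin of the constant 3/5, as 1 - exp (-1) is at least 1 -
    2/5.\<close>
  have e: "5/2 \<le> exp (1::real)" using exp_lower_Taylor_quadratic[of "1::real"] by simp
  have int: "(\<integral>\<^sup>+x. ennreal (exp (- indicator S x)) \<partial>D) \<le> ennreal (exp (- 3/5 * p))"
  proof -
    have "(\<integral>\<^sup>+x. ennreal (exp (- indicator S x)) \<partial>D) =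
        ennreal (\<integral>x. exp (- indicator S x) \<partial>D)"
      by (intro nn_integral_eq_integral D.integrable_const_bound[where B = 1] m) (auto split: split_indicator)
    also have "(\<integral>x. exp (- indicator S x) \<partial>D) = (\<integral>x. 1 - (1 - exp (-1)) * indicator S x \<partial>D)"
      by (intro Bochner_Integration.integral_cong) (auto split: split_indicator)
    also have "\<dots> = 1 - (1 - exp (-1)) * measure D S"
      by (subst Bochner_Integration.integral_diff) (auto simp: D.prob_space[unfolded space_D] D.emeasure_eq_measure intro!: integrable_real_indicator)
    also have "\<dots> \<le> exp (- ((1 - exp (-1)) * measure D S))"
      using exp_ge_add_one_self[of "- ((1 - exp (-1)) * measure D S)"] by simp
    also have "\<dots> \<le> exp (- 3/5 * p)"
    proof -
      have "exp (-1) \<le> (2/5 :: real)" using e by (simp add: exp_minus field_simps)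
      then have "3/5 * measure D S \<le> (1 - exp (-1)) * measure D S" by (intro mult_right_mono) auto
      then show ?thesis using p by simp
    qed
    finally show ?thesis by (simp add: ennreal_leI)
  qed
  have "measure (PiM I (\<lambda>_. D)) ?B \<le> exp r * (\<Prod>e\<in>I. if e \<in> {} then 0 else if e \<in> G then exp (- 3/5 * p) else 1)"
  proof (rule measure_PiM_le_prod[OF I B, where h = h])
    show "h e \<in> borel_measurable borel" for e unfolding h_def by measurable
    show "(\<integral>\<^sup>+x. h e x \<partial>D) \<le> ennreal (if e \<in> {} then 0 else if e \<in> G then exp (- 3/5 * p) else 1)" for e
      using int D.emeasure_space_1 by (auto simp: h_def)
    fix w assume w: "w \<in> ?B"
    have "(\<Prod>e\<in>I. h e (w e)) = (\<Prod>e\<in>G. h e (w e))"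
      using I G by (intro prod.mono_neutral_right) (auto simp: h_def)
    also have "\<dots> = (\<Prod>e\<in>G. ennreal (exp (- indicator S (w e))))" by (intro prod.cong) (auto simp: h_def)
    also have "\<dots> = ennreal (exp (- (\<Sum>e\<in>G. indicator S (w e))))"
      using fin by (subst prod_ennreal) (auto simp: exp_sum[symmetric] sum_negf)
    also have "ennreal (exp r) * \<dots> = ennreal (exp (r - (\<Sum>e\<in>G. indicator S (w e))))"
      by (simp add: ennreal_mult[symmetric] exp_diff exp_minus field_simps)
    also have "1 \<le> \<dots>"
      using w unfolding card[symmetric] by (simp only: ennreal_1[symmetric]) (intro ennreal_leI, simp)
    finally show "1 \<le> ennreal (exp r) * (\<Prod>e\<in>I. h e (w e))" .
  qed auto
  also have "(\<Prod>e\<in>I. if e \<in> {} then 0 else if e \<in> G then exp (- 3/5 * p) else 1) = exp (- 3/5 * p) ^ card G"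
    by (subst prod_if_power[OF I _ G]) auto
  also have "exp r * exp (- 3/5 * p) ^ card G = exp (r - 3/5 * p * card G)"
    by (simp add: exp_of_nat_mult[symmetric] mult_exp_exp algebra_simps)
  finally show "measure (PiM I (\<lambda>_. D)) ?B \<le> exp (r - 3/5 * p * card G)" .
qed

subsection \<open>Typical instances are expanders\<close>

lemma finite_K_edges [simp]: "finite (K_edges n)"
  by (rule finite_subset[of _ "Pow {..<n}"]) (auto simp: K_edges_def)

lemma prob_space_edge_weights: "prob_space (edge_weights D n)"
  unfolding edge_weights_def by (rule prob_space_PiM) (rule prob_space_D)

lemma sum_Pow_power:
  fixes x :: real
  assumes "finite S"
  shows "(\<Sum>B\<in>Pow S. x ^ card B) = (1 + x) ^ card S" "(\<Sum>B\<in>Pow S. x ^ card (S - B)) = (1 + x) ^ card S"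
  using prod_add[OF assms, of "\<lambda>_. x" "\<lambda>_. 1"] prod_add[OF assms, of "\<lambda>_. 1" "\<lambda>_. x"] by (auto simp: add.commute)

text \<open>A union bound over all pairs. The tail estimate for one pair leaves room for a factor 1
  / n per element of \<open>B\<close> and per element of the complement of \<open>V\<close>; the sum
  over all pairs is then at most (1 + 1 / n) ^ (2 * n), hence at most 9.\<close>

lemma measure_not_expander_le:
  assumes n: "2 \<le> n" and \<theta>: "0 < \<theta>" "\<theta> \<le> 1/2" "400 * ln (real n) \<le> real n * \<theta>"
  shows "measure (edge_weights D n) {w \<in> space (edge_weights D n). \<not> expander n w \<theta>} \<le> 9 * exp (- real n * \<theta> / 200)"
    and "{w \<in> space (edge_weights D n). \<not> expander n w \<theta>} \<in> sets (edge_weights D n)"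
proof -
  interpret prob_space "edge_weights D n" by (rule prob_space_edge_weights)
  let ?M = "edge_weights D n"
  define Fam where "Fam = {(B, V). B \<subseteq> {..<n} \<and> V \<subseteq> {..<n} \<and> B \<inter> V = {} \<and> B \<noteq> {} \<and> n \<le> 5 * card V \<and>
     400 * real (n - card V) * ln (real n) \<le> real (card B) * n * \<theta>}"
  define G where "G = (\<lambda>(B, V). (\<lambda>(u, v). {u, v}) ` (B \<times> V) :: nat set set)"
  define bad where "bad p = {w \<in> space ?M. real (card {e \<in> G p. w e \<in> {\<theta>/2<..\<theta>}}) \<le> real (card (fst p)) * n * \<theta> / 50}" for p
  have fin: "finite Fam" by (rule finite_subset[of _ "Pow {..<n} \<times> Pow {..<n}"]) (auto simp: Fam_def)
  have inj: "inj_on (\<lambda>(u, v). {u, v}) (B \<times> V)" if "(B, V) \<in> Fam" for B V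
    using that by (auto simp: Fam_def inj_on_def doubleton_eq_iff)
  have winE: "card (win w \<theta> B V) = card {e \<in> G (B, V). w e \<in> {\<theta>/2<..\<theta>}}" if "(B, V) \<in> Fam" for B V and w :: "nat set \<Rightarrow> real"
  proof -
    have "{e \<in> G (B, V). w e \<in> {\<theta>/2<..\<theta>}} = (\<lambda>(u, v). {u, v}) ` win w \<theta> B V"
      by (auto simp: G_def win_def)
    moreover have "win w \<theta> B V \<subseteq> B \<times> V" by (auto simp: win_def)
    ultimately show ?thesis using inj[OF that] by (simp add: card_image inj_on_subset)
  qed
  have eq: "{w \<in> space ?M. \<not> expander n w \<theta>} = (\<Union>p\<in>Fam. bad p)"
  proof -
    have a: "\<not> expander n w \<theta> \<longleftrightarrow> (\<exists>p\<in>Fam. real (card (win w \<theta> (fst p) (snd p))) \<le> real (card (fst p)) * n * \<theta> / 50)" for w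
      unfolding expander_def Fam_def by (auto simp: not_less)
    have b: "card (win w \<theta> (fst p) (snd p)) = card {e \<in> G p. w e \<in> {\<theta>/2<..\<theta>}}" if "p \<in> Fam" for p and w :: "nat set \<Rightarrow> real"
      using winE[of "fst p" "snd p"] that by simp
    have "{w \<in> space ?M. \<not> expander n w \<theta>} = (\<Union>p\<in>Fam. {w \<in> space ?M. real (card (win w \<theta> (fst p) (snd p))) \<le> real (card (fst p)) * n * \<theta> / 50})"
      unfolding a by blast
    also have "\<dots> = (\<Union>p\<in>Fam. bad p)"
      unfolding bad_def by (rule SUP_cong[OF refl]) (simp only: b)
    finally show ?thesis .
  qed
  have GI: "G p \<subseteq> K_edges n" if "p \<in> Fam" for p
    using that by (auto simp: Fam_def G_def K_edges_def card_insert_if)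
  have badm: "bad p \<in> sets ?M" if "p \<in> Fam" for p
    unfolding bad_def edge_weights_def
    by (rule measure_few_le(2)[where p = 0]) (use GI[OF that] \<theta> in auto)
  have badp: "measure ?M (bad p) \<le> exp (- real n * \<theta> / 200) * ((1 / n) ^ card (fst p) * (1 / n) ^ card ({..<n} - snd p))"
    if p: "p \<in> Fam" for p
  proof -
    obtain B V where BV: "p = (B, V)" by (cases p)
    note F = p[unfolded BV Fam_def, simplified]
    have finBV: "finite B" "finite V" using F finite_subset by auto
    have b1: "1 \<le> real (card B)" using F finBV card_gt_0_iff[of B] by auto
    have nt: "0 \<le> real n * \<theta>" using \<theta> by simp
    have L: "0 < ln (real n)" using n by simp
    have "measure ?M (bad p) \<le> exp (real (card B) * n * \<theta> / 50 - 3/5 * (\<theta> / 4) * card (G p))"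
      unfolding bad_def edge_weights_def BV fst_conv
      by (rule measure_few_le(1)) (use GI[OF p] measure_D_window[OF \<theta>(1,2)] \<theta> in \<open>auto simp: BV\<close>)
    also have "card (G p) = card B * card V"
      unfolding G_def BV using inj[of B V] p BV by (simp add: card_image card_cartesian_product)
    \<comment> \<open>With card V at least n / 5 the mean term is 3/100 of card B * n * \<theta>.
      After subtracting 1/50 there remains 1/100, split as 1/200 for the final bound and 1/400 for
      each of the two counting factors.\<close>
    also have "real (card B) * n * \<theta> / 50 - 3/5 * (\<theta> / 4) * real (card B * card V) \<le>
        - real n * \<theta> / 200 - real (card B) * ln n - real (card ({..<n} - V)) * ln n"
    proof -
      have "real n \<le> real (5 * card V)" using F by (simp only: of_nat_le_iff)
      then have "(\<theta> * real (card B)) * (real n / 5) \<le> (\<theta> * real (card B)) * real (card V)"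
        using \<theta> by (intro mult_left_mono) auto
      then have 1: "3/5 * (\<theta> / 4) * real (card B * card V) \<ge> 3/100 * (real (card B) * (real n * \<theta>))"
        by (simp add: algebra_simps)
      have 2: "real n * \<theta> \<le> real (card B) * (real n * \<theta>)" using b1 nt by (simp add: mult_le_cancel_right1)
      have 3: "real (card B) * ln n \<le> real (card B) * (real n * \<theta>) / 400"
        using mult_left_mono[OF \<theta>(3), of "real (card B)"] by simp
      have "card ({..<n} - V) = n - card V" using F finBV by (simp add: card_Diff_subset)
      then have 4: "real (card ({..<n} - V)) * ln n \<le> real (card B) * (real n * \<theta>) / 400"
        using F by (simp add: algebra_simps)
      from 1 2 3 4 show ?thesis by (simp add: algebra_simps)
    qed
    also have "exp (- real n * \<theta> / 200 - real (card B) * ln n - real (card ({..<n} - V)) * ln n) =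
       exp (- real n * \<theta> / 200) * ((1 / n) ^ card B * (1 / n) ^ card ({..<n} - V))"
    proof -
      have "exp (- (real k * ln (real n))) = (1 / real n) ^ k" for k
        using n by (simp add: exp_minus exp_of_nat_mult power_one_over inverse_eq_divide)
      then show ?thesis by (simp only: diff_conv_add_uminus exp_add mult.assoc)
    qed
    finally show ?thesis by (simp add: BV)
  qed
  show "{w \<in> space ?M. \<not> expander n w \<theta>} \<in> sets ?M" unfolding eq using fin badm by auto
  have e3: "(1 + 1 / real n) ^ n \<le> 3"
  proof -
    have "(1 + 1 / real n) ^ n \<le> exp (1 / real n) ^ n"
      by (intro power_mono) (auto intro: exp_ge_add_one_self)
    also have "\<dots> = exp 1" using n by (simp add: exp_of_nat_mult[symmetric])
    also have "\<dots> \<le> 3" using exp_le by simp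
    finally show ?thesis .
  qed
  have "measure ?M {w \<in> space ?M. \<not> expander n w \<theta>} \<le> (\<Sum>p\<in>Fam. measure ?M (bad p))"
    unfolding eq using fin badm by (intro finite_measure_subadditive_finite) auto
  also have "\<dots> \<le> (\<Sum>p\<in>Fam. exp (- real n * \<theta> / 200) * ((1 / n) ^ card (fst p) * (1 / n) ^ card ({..<n} - snd p)))"
    by (intro sum_mono badp)
  \<comment> \<open>Dropping the constraints on the pairs makes the sum a product of two binomial
    sums.\<close>
  also have "\<dots> \<le> (\<Sum>p\<in>Pow {..<n} \<times> Pow {..<n}. exp (- real n * \<theta> / 200) * ((1 / n) ^ card (fst p) * (1 / n) ^ card ({..<n} - snd p)))"
    by (intro sum_mono2) (auto simp: Fam_def)
  also have "\<dots> = exp (- real n * \<theta> / 200) * ((\<Sum>B\<in>Pow {..<n}. (1 / real n) ^ card B) * (\<Sum>V\<in>Pow {..<n}. (1 / real n) ^ card ({..<n} - V)))"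
    by (simp add: sum_distrib_left[symmetric] sum.cartesian_product' sum_product)
  also have "\<dots> = exp (- real n * \<theta> / 200) * ((1 + 1 / real n) ^ n * (1 + 1 / real n) ^ n)"
    by (simp only: sum_Pow_power[OF finite_lessThan] card_lessThan)
  also have "\<dots> \<le> exp (- real n * \<theta> / 200) * (3 * 3)"
    using e3 by (intro mult_left_mono mult_mono) auto
  finally show "measure ?M {w \<in> space ?M. \<not> expander n w \<theta>} \<le> 9 * exp (- real n * \<theta> / 200)" by simp
qed

end

subsection \<open>First-moment estimates\<close>

text \<open>First moments are summed over all words in the vertices, so that the number of words of
  each length is a plain power and the sum becomes a geometric series.\<close>

definition short_lists :: "nat set \<Rightarrow> nat \<Rightarrow> nat list set" where
  "short_lists A N = {q. set q \<subseteq> A \<and> length q \<le> N}"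

lemma finite_short_lists: "finite A \<Longrightarrow> finite (short_lists A N)"
  unfolding short_lists_def by (rule finite_lists_length_le)

lemma sum_short_lists:
  fixes f :: "nat \<Rightarrow> real"
  assumes "finite A"
  shows "(\<Sum>q\<in>short_lists A N. f (length q)) = (\<Sum>l\<le>N. real (card A) ^ l * f l)"
proof -
  have eq: "short_lists A N = (\<Union>l\<in>{..N}. {q. set q \<subseteq> A \<and> length q = l})"
    by (auto simp: short_lists_def)
  have "(\<Sum>q\<in>short_lists A N. f (length q)) = (\<Sum>l\<le>N. \<Sum>q\<in>{q. set q \<subseteq> A \<and> length q = l}. f (length q))"
    unfolding eq by (rule sum.UNION_disjoint) (auto intro: finite_lists_length_eq assms)
  also have "\<dots> = (\<Sum>l\<le>N. real (card A) ^ l * f l)"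
    using card_lists_length_eq[OF assms] by (intro sum.cong refl) simp
  finally show ?thesis .
qed

lemma sum_short_lists_power_le:
  fixes x :: real
  assumes "finite A" "0 \<le> x" "real (card A) * x \<le> \<rho>" "\<rho> < 1"
  shows "(\<Sum>q\<in>short_lists A N. x ^ length q) \<le> 1 / (1 - \<rho>)"
proof -
  have "(\<Sum>q\<in>short_lists A N. x ^ length q) = (\<Sum>l\<le>N. (real (card A) * x) ^ l)"
    using sum_short_lists[OF assms(1), of "\<lambda>l. x ^ l" N] by (simp add: power_mult_distrib)
  also have "\<dots> \<le> (\<Sum>l\<le>N. \<rho> ^ l)" using assms by (intro sum_mono power_mono) auto
  also have "\<dots> \<le> (\<Sum>l. \<rho> ^ l)"
    by (rule sum_le_suminf) (use assms order_trans[of 0 "real (card A) * x" \<rho>] in \<open>auto intro!: summable_geometric\<close>)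
  also have "\<dots> = 1 / (1 - \<rho>)"
    by (rule suminf_geometric) (use assms order_trans[of 0 "real (card A) * x" \<rho>] in auto)
  finally show ?thesis .
qed

text \<open>The path \<open>q'\<close> is cut at its first vertex \<open>v\<close> and its last
  vertex \<open>v'\<close> on \<open>q\<close>; what lies in between is discarded. The outer pieces
  \<open>r\<close> and \<open>r'\<close> consist of new vertices only, so their edges are edges
  neither of \<open>q\<close> nor of each other. The conditional clauses cover empty pieces, where
  an end of \<open>q'\<close> lies on \<open>q\<close>.\<close>

lemma shared_edge_split:
  assumes "distinct q'" "path_edges q \<inter> path_edges q' \<noteq> {}"
  obtains r r' v v' where "v \<in> set q" "v' \<in> set q" "r \<noteq> [] \<Longrightarrow> hd q' = hd r" "r = [] \<Longrightarrow> hd q' = v"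
    "r' \<noteq> [] \<Longrightarrow> last q' = last r'" "r' = [] \<Longrightarrow> last q' = v'"
    "path_edges (r @ [v]) \<subseteq> path_edges q'" "path_edges (v' # r') \<subseteq> path_edges q'"
    "distinct (r @ [v])" "distinct (v' # r')" "set r \<union> set r' \<subseteq> set q' - set q"
    "path_edges (r @ [v]) \<inter> path_edges (v' # r') = {}"
proof -
  obtain e where e: "e \<in> path_edges q" "e \<in> path_edges q'" using assms(2) by blast
  then have "e \<noteq> {}" using path_edges_card2[OF assms(1)] by force
  then have "\<exists>x\<in>set q'. x \<in> set q" using path_edges_subset[OF e(1)] path_edges_subset[OF e(2)] by blast
  then obtain r v u where r: "q' = r @ v # u" "v \<in> set q" "\<forall>x\<in>set r. x \<notin> set q"
    using split_list_first_prop[of q' "\<lambda>x. x \<in> set q"] by blast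
  obtain u' v' r' where r': "q' = u' @ v' # r'" "v' \<in> set q" "\<forall>x\<in>set r'. x \<notin> set q"
    using split_list_last_prop[of q' "\<lambda>x. x \<in> set q"] \<open>\<exists>x\<in>set q'. x \<in> set q\<close> by blast
  \<comment> \<open>The last visit of \<open>q\<close> cannot precede the first one: otherwise
    \<open>v'\<close> would be among the vertices of \<open>r\<close>, which avoid
    \<open>q\<close>.\<close>
  have sub: "set r' \<subseteq> set (v # u)"
  proof -
    have "r @ (v # u) = u' @ (v' # r')" using r(1) r'(1) by simp
    then obtain x where "r = u' @ x \<and> x @ v # u = v' # r' \<or> r @ x = u' \<and> v # u = x @ v' # r'"
      unfolding append_eq_append_conv2 by blast
    then show ?thesis
    proof
      assume x: "r = u' @ x \<and> x @ v # u = v' # r'"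
      then have "x = []" using r(3) r'(2) by (cases x) auto
      then show ?thesis using x by auto
    qed auto
  qed
  have disj: "set (r @ [v]) \<inter> set (v' # r') \<subseteq> {v}"
    using sub r r' assms(1) by auto
  have "path_edges (r @ [v]) \<inter> path_edges (v' # r') = {}"
  proof (rule ccontr)
    assume "\<not> ?thesis"
    then obtain f where f: "f \<in> path_edges (r @ [v])" "f \<in> path_edges (v' # r')" by blast
    then have "f \<subseteq> {v}" using path_edges_subset disj by blast
    moreover have "card f = 2" using f(1) path_edges_card2[of "r @ [v]"] assms(1) r(1) by auto
    ultimately show False using card_mono[of "{v}" f] by simp
  qed
  moreover have "path_edges (r @ [v]) \<subseteq> path_edges q'" "path_edges (v' # r') \<subseteq> path_edges q'"
    using path_edges_append_subset(1)[of "r @ [v]" u] path_edges_append_subset(2)[of "v' # r'" u'] r(1) r'(1) by auto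
  moreover have "hd q' = hd r" if "r \<noteq> []" using r(1) that by simp
  moreover have "hd q' = v" if "r = []" using r(1) that by simp
  moreover have "last q' = last r'" if "r' \<noteq> []" using r'(1) that by simp
  moreover have "last q' = v'" if "r' = []" using r'(1) that by simp
  moreover have "distinct (r @ [v])" "distinct (v' # r')" "set r \<union> set r' \<subseteq> set q' - set q"
  proof -
    have "distinct (u' @ v' # r')" "set r' \<subseteq> set q'" using assms(1) r'(1) by auto
    then show "distinct (r @ [v])" "distinct (v' # r')" "set r \<union> set r' \<subseteq> set q' - set q"
      using assms(1) r r'(3) by auto
  qed
  ultimately show ?thesis using that[of v v' r r'] r(2) r'(2) by blast
qed

locale instance_law = edge_law +
  fixes n s t :: nat
  assumes s_less: "s < n" and t_less: "t < n" and s_neq_t: "s \<noteq> t"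
begin

abbreviation "A \<equiv> {..<n} - {s, t}"
abbreviation "M \<equiv> edge_weights D n"

lemma card_A: "real (card A) \<le> n"
  using card_mono[of "{..<n}" A] by auto

lemma A_edges_in: "distinct q \<Longrightarrow> set q \<subseteq> A \<Longrightarrow> path_edges q \<subseteq> K_edges n"
  using path_edges_in_K_edges by blast

lemma end_edges_in: "a \<in> A \<Longrightarrow> {s, a} \<in> K_edges n \<and> {a, t} \<in> K_edges n"
  using s_less t_less by (auto simp: K_edges_def card_insert_if)

lemma A_edges_avoid: "set q \<subseteq> A \<Longrightarrow> e \<in> path_edges q \<Longrightarrow> s \<notin> e \<and> t \<notin> e"
  using path_edges_subset[of e q] by auto

text \<open>First moment over all inner paths. The n possible choices of a vertex against a factor 1
  / l per edge give ratio n / l, so any \<open>l\<close> above n makes the sum converge.\<close>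

lemma measure_cheap_path_le:
  fixes z y l :: real
  assumes z: "0 \<le> z" and l: "0 < l" "real n / l \<le> \<rho>" "\<rho> < 1"
  obtains B where "B \<in> sets M" "measure M B \<le> z\<^sup>2 * exp (l * y) * l / (1 - \<rho>)"
    "\<And>w q. w \<in> space M - B \<Longrightarrow> q \<noteq> [] \<Longrightarrow> distinct q \<Longrightarrow> set q \<subseteq> A \<Longrightarrow> w {s, hd q} \<le> z \<Longrightarrow>
       w {last q, t} \<le> z \<Longrightarrow> y < path_cost w q"
proof -
  interpret prob_space M by (rule prob_space_edge_weights)
  let ?L = "{q \<in> short_lists A n. q \<noteq> [] \<and> distinct q}"
  define S where "S q = {w \<in> space M. (\<forall>e\<in>{{s, hd q}, {last q, t}}. w e \<le> z) \<and> (\<Sum>e\<in>path_edges q. w e) \<le> y}" for q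
  have fin: "finite ?L" "finite (short_lists A n)" using finite_short_lists[of A n] by auto
  have S: "S q \<in> sets M" "measure M (S q) \<le> (z\<^sup>2 * exp (l * y) * l) * (1 / l) ^ length q" if q: "q \<in> ?L" for q
  proof -
    have "q \<noteq> []" "distinct q" "set q \<subseteq> A" using q by (auto simp: short_lists_def)
    then have q': "q \<noteq> []" "distinct q" "set q \<subseteq> A" "hd q \<in> A" "last q \<in> A"
      using subsetD[of "set q" A "hd q"] subsetD[of "set q" A "last q"] by simp_all
    let ?F = "{{s, hd q}, {last q, t}}"
    have F: "?F \<subseteq> K_edges n" "?F \<inter> path_edges q = {}" "card ?F = 2"
      using end_edges_in[OF q'(4)] end_edges_in[OF q'(5)] A_edges_avoid[OF q'(3)] q'(4,5) s_neq_t
      by (auto simp: card_insert_if doubleton_eq_iff)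
    note G = A_edges_in[OF q'(2,3)]
    show "S q \<in> sets M" unfolding S_def edge_weights_def
      by (rule measure_light_le(2)[OF finite_K_edges F(1) G F(2) z l(1)])
    have "measure M (S q) \<le> z ^ card ?F * (exp (l * y) * (1 / l) ^ card (path_edges q))"
      unfolding S_def edge_weights_def
      by (rule measure_light_le(1)[OF finite_K_edges F(1) G F(2) z l(1)])
    \<comment> \<open>A path has one edge less than vertices, which leaves over one factor
      \<open>l\<close>.\<close>
    also have "\<dots> = (z\<^sup>2 * exp (l * y) * l) * (1 / l) ^ length q"
      using q'(1,2) F(3) l(1) by (cases q) (auto simp: card_path_edges)
    finally show "measure M (S q) \<le> (z\<^sup>2 * exp (l * y) * l) * (1 / l) ^ length q" .
  qed
  show ?thesis
  proof (rule that[of "\<Union>q\<in>?L. S q"])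
    show "(\<Union>q\<in>?L. S q) \<in> sets M" using fin S by auto
    have "measure M (\<Union>q\<in>?L. S q) \<le> (\<Sum>q\<in>?L. measure M (S q))"
      using fin S by (intro finite_measure_subadditive_finite) auto
    also have "\<dots> \<le> (\<Sum>q\<in>?L. (z\<^sup>2 * exp (l * y) * l) * (1 / l) ^ length q)" by (intro sum_mono S)
    also have "\<dots> \<le> (\<Sum>q\<in>short_lists A n. (z\<^sup>2 * exp (l * y) * l) * (1 / l) ^ length q)"
      using l fin by (intro sum_mono2) auto
    also have "\<dots> = (z\<^sup>2 * exp (l * y) * l) * (\<Sum>q\<in>short_lists A n. (1 / l) ^ length q)"
      by (simp only: sum_distrib_left)
    also have "\<dots> \<le> (z\<^sup>2 * exp (l * y) * l) * (1 / (1 - \<rho>))"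
    proof (intro mult_left_mono sum_short_lists_power_le)
      have "real (card A) * (1 / l) \<le> real n * (1 / l)" using card_A l by (intro mult_right_mono) auto
      then show "real (card A) * (1 / l) \<le> \<rho>" using l by simp
    qed (use l in auto)
    finally show "measure M (\<Union>q\<in>?L. S q) \<le> z\<^sup>2 * exp (l * y) * l / (1 - \<rho>)" by simp
    fix w q assume w: "w \<in> space M - (\<Union>q\<in>?L. S q)" and q: "q \<noteq> []" "distinct q" "set q \<subseteq> A" "w {s, hd q} \<le> z" "w {last q, t} \<le> z"
    have "length q = card (set q)" using q by (simp add: distinct_card)
    also have "\<dots> \<le> n" using card_mono[of "{..<n}" "set q"] q by auto
    finally have "q \<in> ?L" using q by (auto simp: short_lists_def)
    then show "y < path_cost w q" using w q by (auto simp: S_def path_cost_def not_le)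
  qed
qed

text \<open>Two cheap paths that share an edge form a single path with two pendant paths. Such a
  configuration has one free vertex less than needed to be likely.\<close>

lemma measure_touching_paths_le:
  fixes z y l :: real
  assumes z: "0 \<le> z" and l: "0 < l" "real n / l \<le> \<rho>" "\<rho> < 1"
    and C: "\<And>N. (\<Sum>k\<le>N. (real k)\<^sup>2 * \<rho> ^ k) \<le> C"
  obtains B where "B \<in> sets M" "measure M B \<le> z ^ 4 * exp (2 * l * y) * l * C / (1 - \<rho>)\<^sup>2"
    "\<And>w q q'. w \<in> space M - B \<Longrightarrow> nonneg_weights {..<n} w \<Longrightarrow>
       q \<noteq> [] \<Longrightarrow> distinct q \<Longrightarrow> set q \<subseteq> A \<Longrightarrow> q' \<noteq> [] \<Longrightarrow> distinct q' \<Longrightarrow> set q' \<subseteq> A \<Longrightarrow>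
       w {s, hd q} \<le> z \<Longrightarrow> w {last q, t} \<le> z \<Longrightarrow> w {s, hd q'} \<le> z \<Longrightarrow> w {last q', t} \<le> z \<Longrightarrow>
       hd q \<noteq> hd q' \<Longrightarrow> last q \<noteq> last q' \<Longrightarrow> path_cost w q \<le> y \<Longrightarrow> path_cost w q' \<le> y \<Longrightarrow>
       path_edges q \<inter> path_edges q' = {}"
proof -
  interpret prob_space M by (rule prob_space_edge_weights)
  let ?L = "short_lists A n"
  \<comment> \<open>A configuration is the path \<open>q\<close> with pendant pieces
    \<open>r\<close> and \<open>r'\<close> attached at its vertices \<open>v\<close> and
    \<open>v'\<close>; \<open>F\<close> collects the four end edges at \<open>s\<close> and
    \<open>t\<close>, and \<open>G\<close> the inner edges.\<close>
  define F where "F = (\<lambda>((q, r, r'), v, v'). {{s, hd q}, {last q, t}, {s, hd (r @ [v])}, {last (v' # r'), t}})"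
  define G where "G = (\<lambda>((q, r, r'), v, v'). path_edges q \<union> (path_edges (r @ [v]) \<union> path_edges (v' # r')))"
  define J where "J = {((q, r, r'), v, v'). (q, r, r') \<in> ?L \<times> ?L \<times> ?L \<and> (v, v') \<in> set q \<times> set q}"
  \<comment> \<open>Only configurations with the right incidences and edge counts enter the moment
    bound; a touching pair of cheap paths is shown at the end to produce one of them.\<close>
  define J' where "J' = {p \<in> J. F p \<subseteq> K_edges n \<and> G p \<subseteq> K_edges n \<and> F p \<inter> G p = {} \<and> card (F p) = 4 \<and>
     card (G p) + 1 = length (fst (fst p)) + length (fst (snd (fst p))) + length (snd (snd (fst p)))}"
  define S where "S p = {w \<in> space M. (\<forall>e\<in>F p. w e \<le> z) \<and> (\<Sum>e\<in>G p. w e) \<le> 2 * y}" for p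
  define c where "c = z ^ 4 * exp (2 * l * y) * l"
  define x where "x = 1 / l"
  have x0: "0 \<le> x" using l by (simp add: x_def)
  have c0: "0 \<le> c" using l z by (simp add: c_def)
  have finL: "finite ?L" by (rule finite_short_lists) simp
  have JS: "J = (SIGMA p:?L \<times> ?L \<times> ?L. set (fst p) \<times> set (fst p))" by (auto simp: J_def)
  then have fin: "finite J" using finL by auto
  then have fin': "finite J'" by (auto simp: J'_def)
  have S: "S p \<in> sets M" "measure M (S p) \<le> c * (x ^ length (fst (fst p)) * (x ^ length (fst (snd (fst p))) * x ^ length (snd (snd (fst p)))))"
    if p: "p \<in> J'" for p
  proof -
    note P = p[unfolded J'_def, simplified]
    show "S p \<in> sets M" unfolding S_def edge_weights_def
      by (rule measure_light_le(2)[OF finite_K_edges _ _ _ z l(1)]) (use P in auto)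
    have "measure M (S p) \<le> z ^ card (F p) * (exp (l * (2 * y)) * (1 / l) ^ card (G p))"
      unfolding S_def edge_weights_def
      by (rule measure_light_le(1)[OF finite_K_edges _ _ _ z l(1)]) (use P in auto)
    \<comment> \<open>The edges of \<open>q\<close> are one fewer than its vertices, while each
      pendant piece has as many edges as new vertices. So a single factor \<open>l\<close> remains
      against four end edges; two disjoint paths would have left two.\<close>
    also have "(1 / l) ^ card (G p) = l * x ^ (card (G p) + 1)" using l by (simp add: x_def)
    also have "card (G p) + 1 = length (fst (fst p)) + length (fst (snd (fst p))) + length (snd (snd (fst p)))"
      using P by simp
    finally show "measure M (S p) \<le> c * (x ^ length (fst (fst p)) * (x ^ length (fst (snd (fst p))) * x ^ length (snd (snd (fst p)))))"
      using P by (simp add: c_def power_add mult_ac)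
  qed
  have xr: "real (card A) * x \<le> \<rho>"
  proof -
    have "real (card A) * x \<le> real n * x" using card_A l by (intro mult_right_mono) (auto simp: x_def)
    then show ?thesis using l by (simp add: x_def)
  qed
  show ?thesis
  proof (rule that[of "\<Union>p\<in>J'. S p"])
    show "(\<Union>p\<in>J'. S p) \<in> sets M" using fin' S by auto
    define g where "g p = c * (x ^ length (fst p) * (x ^ length (fst (snd p)) * x ^ length (snd (snd p))))" for p :: "nat list \<times> nat list \<times> nat list"
    have "measure M (\<Union>p\<in>J'. S p) \<le> (\<Sum>p\<in>J'. measure M (S p))"
      using fin' S by (intro finite_measure_subadditive_finite) auto
    also have "\<dots> \<le> (\<Sum>p\<in>J'. g (fst p))" unfolding g_def by (intro sum_mono S)
    also have "\<dots> \<le> (\<Sum>p\<in>J. g (fst p))"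
      using fin c0 x0 by (intro sum_mono2) (auto simp: J'_def g_def)
    also have "\<dots> = (\<Sum>p\<in>?L \<times> ?L \<times> ?L. \<Sum>v\<in>set (fst p) \<times> set (fst p). g p)"
      unfolding JS using finL by (subst sum.Sigma) (auto simp: case_prod_beta)
    \<comment> \<open>The attachment vertices are chosen on \<open>q\<close>, which costs the square
      of its length instead of two factors n.\<close>
    also have "\<dots> \<le> (\<Sum>p\<in>?L \<times> ?L \<times> ?L. (real (length (fst p)))\<^sup>2 * g p)"
    proof (rule sum_mono)
      fix p :: "nat list \<times> nat list \<times> nat list"
      have "real (card (set (fst p)) * card (set (fst p))) \<le> real (length (fst p) * length (fst p))"
        by (intro of_nat_mono mult_mono card_length) auto
      then show "(\<Sum>v\<in>set (fst p) \<times> set (fst p). g p) \<le> (real (length (fst p)))\<^sup>2 * g p"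
        using c0 x0 by (simp add: card_cartesian_product power2_eq_square mult_right_mono g_def)
    qed
    also have "\<dots> = c * ((\<Sum>q\<in>?L. (real (length q))\<^sup>2 * x ^ length q) * ((\<Sum>r\<in>?L. x ^ length r) * (\<Sum>r\<in>?L. x ^ length r)))"
      by (simp only: sum_product, simp only: sum.cartesian_product' sum_distrib_left fst_conv snd_conv g_def,
        intro sum.cong refl, simp)
    also have "\<dots> \<le> c * (C * (1 / (1 - \<rho>) * (1 / (1 - \<rho>))))"
    proof (intro mult_left_mono mult_mono)
      show "(\<Sum>r\<in>?L. x ^ length r) \<le> 1 / (1 - \<rho>)" "(\<Sum>r\<in>?L. x ^ length r) \<le> 1 / (1 - \<rho>)"
        using sum_short_lists_power_le[OF _ x0 xr l(3)] by auto
      have "(\<Sum>q\<in>?L. (real (length q))\<^sup>2 * x ^ length q) = (\<Sum>k\<le>n. real (card A) ^ k * ((real k)\<^sup>2 * x ^ k))"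
        by (rule sum_short_lists) simp
      also have "\<dots> = (\<Sum>k\<le>n. (real k)\<^sup>2 * (real (card A) * x) ^ k)"
        by (intro sum.cong) (auto simp: power_mult_distrib)
      also have "\<dots> \<le> (\<Sum>k\<le>n. (real k)\<^sup>2 * \<rho> ^ k)"
        using xr x0 by (intro sum_mono mult_left_mono power_mono) auto
      also have "\<dots> \<le> C" by (rule C)
      finally show "(\<Sum>q\<in>?L. (real (length q))\<^sup>2 * x ^ length q) \<le> C" .
      show "0 \<le> C" using C[of 0] by simp
    qed (use l x0 c0 in \<open>auto intro!: sum_nonneg mult_nonneg_nonneg\<close>)
    finally show "measure M (\<Union>p\<in>J'. S p) \<le> z ^ 4 * exp (2 * l * y) * l * C / (1 - \<rho>)\<^sup>2"
      by (simp add: c_def power2_eq_square)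
    fix w q q' assume w: "w \<in> space M - (\<Union>p\<in>J'. S p)" and nn: "nonneg_weights {..<n} w"
      and q: "q \<noteq> []" "distinct q" "set q \<subseteq> A" and q': "q' \<noteq> []" "distinct q'" "set q' \<subseteq> A"
      and ends: "w {s, hd q} \<le> z" "w {last q, t} \<le> z" "w {s, hd q'} \<le> z" "w {last q', t} \<le> z"
        "hd q \<noteq> hd q'" "last q \<noteq> last q'" and cost: "path_cost w q \<le> y" "path_cost w q' \<le> y"
    show "path_edges q \<inter> path_edges q' = {}"
    proof (rule ccontr)
      assume "\<not> ?thesis"
      then obtain r r' v v' where R: "v \<in> set q" "v' \<in> set q" "r \<noteq> [] \<Longrightarrow> hd q' = hd r" "r = [] \<Longrightarrow> hd q' = v"
        "r' \<noteq> [] \<Longrightarrow> last q' = last r'" "r' = [] \<Longrightarrow> last q' = v'"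
        "path_edges (r @ [v]) \<subseteq> path_edges q'" "path_edges (v' # r') \<subseteq> path_edges q'"
        "distinct (r @ [v])" "distinct (v' # r')" "set r \<union> set r' \<subseteq> set q' - set q"
        "path_edges (r @ [v]) \<inter> path_edges (v' # r') = {}"
        using shared_edge_split[OF q'(2)] by metis
      define p where "p = ((q, r, r'), v, v')"
      have hl: "hd (r @ [v]) = hd q'" "last (v' # r') = last q'" using R by (auto simp: hd_append)
      have inA: "hd q \<in> A" "last q \<in> A" "hd q' \<in> A" "last q' \<in> A"
        using subsetD[OF q(3) hd_in_set[OF q(1)]] subsetD[OF q(3) last_in_set[OF q(1)]]
          subsetD[OF q'(3) hd_in_set[OF q'(1)]] subsetD[OF q'(3) last_in_set[OF q'(1)]] by auto
      have len: "length u \<le> n" if "distinct u" "set u \<subseteq> A" for u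
        using card_mono[of "{..<n}" "set u"] distinct_card[OF that(1)] that(2) by auto
      have Fp: "F p = {{s, hd q}, {last q, t}, {s, hd q'}, {last q', t}}" by (simp only: F_def p_def prod.case hl)
      have Gp: "G p = path_edges q \<union> (path_edges (r @ [v]) \<union> path_edges (v' # r'))" by (simp add: G_def p_def)
      have Gsub: "G p \<subseteq> path_edges q \<union> path_edges q'" using Gp R by auto
      have disj: "path_edges q \<inter> (path_edges (r @ [v]) \<union> path_edges (v' # r')) = {}"
      proof (rule ccontr)
        assume "\<not> ?thesis"
        then obtain e where e: "e \<in> path_edges q" "e \<in> path_edges (r @ [v]) \<or> e \<in> path_edges (v' # r')" by blast
        then have "e \<subseteq> {v} \<or> e \<subseteq> {v'}"
          using path_edges_subset[of e "r @ [v]"] path_edges_subset[of e "v' # r'"] path_edges_subset[of e q] R(11) by fastforce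
        moreover have "card e = 2" using e(1) path_edges_card2[OF q(2)] by blast
        ultimately show False using card_mono[of "{v}" e] card_mono[of "{v'}" e] by auto
      qed
      have cG: "card (G p) + 1 = length q + length r + length r'"
        unfolding Gp using disj R(12) card_path_edges[OF q(2)] card_path_edges[OF R(9)] card_path_edges[OF R(10)] q(1)
        by (simp add: card_Un_disjoint)
      have cF: "card (F p) = 4"
        unfolding Fp using ends(5,6) inA s_neq_t by (auto simp: card_insert_if doubleton_eq_iff)
      have "p \<in> J"
      proof -
        have "set r \<subseteq> A" "set r' \<subseteq> A" using R(11) q'(3) by blast+
        then show ?thesis
          using R(1,2,9,10) q len[of q] len[of r] len[of r'] by (simp add: J_def p_def short_lists_def)
      qed
      moreover have "F p \<subseteq> K_edges n" unfolding Fp using end_edges_in inA by auto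
      moreover have "G p \<subseteq> K_edges n" using Gsub A_edges_in q q' by blast
      moreover have "F p \<inter> G p = {}"
        unfolding Fp using Gsub A_edges_avoid[OF q(3)] A_edges_avoid[OF q'(3)] by fastforce
      ultimately have "p \<in> J'" using cF cG by (simp add: J'_def p_def)
      moreover have "w \<in> S p"
      proof -
        have nq: "0 \<le> w e" if "e \<in> path_edges q'" for e
          by (rule nonneg_path_edges[OF nn q'(2) _ that]) (use q' in auto)
        have "(\<Sum>e\<in>G p. w e) = path_cost w q + (\<Sum>e\<in>path_edges (r @ [v]) \<union> path_edges (v' # r'). w e)"
          unfolding Gp path_cost_def using disj by (intro sum.union_disjoint) auto
        also have "(\<Sum>e\<in>path_edges (r @ [v]) \<union> path_edges (v' # r'). w e) \<le> path_cost w q'"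
          unfolding path_cost_def using R nq by (intro sum_mono2) auto
        finally have "(\<Sum>e\<in>G p. w e) \<le> 2 * y" using cost by simp
        then show ?thesis using w ends by (auto simp: S_def Fp)
      qed
      ultimately show False using w by blast
    qed
  qed
qed

end

subsection \<open>Distances with exponential weights\<close>

context edge_law
begin

text \<open>Dependence on a set of coordinates is expressed by invariance under changing the others,
  so both functions stay on the full product space and no restriction maps appear in the
  applications.\<close>

lemma nn_integral_PiM_indep:
  assumes fin: "finite I1" "finite I2" "I1 \<inter> I2 = {}" and I: "I = I1 \<union> I2"
    and f: "f \<in> borel_measurable (PiM I (\<lambda>_. D))" and g: "g \<in> borel_measurable (PiM I (\<lambda>_. D))"
    and dep: "\<And>w w'. (\<And>e. e \<in> I1 \<Longrightarrow> w e = w' e) \<Longrightarrow> f w = f w'" "\<And>w w'. (\<And>e. e \<in> I2 \<Longrightarrow> w e = w' e) \<Longrightarrow> g w = g w'"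
  shows "(\<integral>\<^sup>+w. f w * g w \<partial>PiM I (\<lambda>_. D)) =
     (\<integral>\<^sup>+w. f w \<partial>PiM I (\<lambda>_. D)) * (\<integral>\<^sup>+w. g w \<partial>PiM I (\<lambda>_. D))"
proof -
  let ?P = "\<lambda>I. PiM I (\<lambda>_. D)"
  interpret PS: product_sigma_finite "\<lambda>_. D"
    by (intro product_sigma_finite.intro prob_space_imp_sigma_finite prob_space_D)
  interpret P1: prob_space "?P I1" by (rule prob_space_PiM) (rule prob_space_D)
  interpret P2: prob_space "?P I2" by (rule prob_space_PiM) (rule prob_space_D)
  have fE: "f (merge I1 I2 (x, y)) = f x" for x y by (rule dep(1)) (simp add: merge_def)
  have gE: "g (merge I1 I2 (x, y)) = g y" for x y by (rule dep(2)) (use fin(3) in \<open>auto simp: merge_def\<close>)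
  note fold = PS.product_nn_integral_fold[OF fin(3,1,2), folded I]
  obtain x0 where x0: "x0 \<in> space (?P I1)" using P1.not_empty by blast
  obtain y0 where y0: "y0 \<in> space (?P I2)" using P2.not_empty by blast
  have mf: "f \<in> borel_measurable (?P I1)"
  proof -
    have "(\<lambda>x. merge I1 I2 (x, y0)) \<in> measurable (?P I1) (?P I)"
      unfolding I using y0 by (intro measurable_compose[OF _ measurable_merge] measurable_Pair) auto
    from measurable_compose[OF this f] show ?thesis by (simp add: fE)
  qed
  have mg: "g \<in> borel_measurable (?P I2)"
  proof -
    have "(\<lambda>y. merge I1 I2 (x0, y)) \<in> measurable (?P I2) (?P I)"
      unfolding I using x0 by (intro measurable_compose[OF _ measurable_merge] measurable_Pair) auto
    from measurable_compose[OF this g] show ?thesis by (simp add: gE)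
  qed
  have "(\<integral>\<^sup>+w. f w * g w \<partial>?P I) = (\<integral>\<^sup>+x. \<integral>\<^sup>+y. f x * g y \<partial>?P I2 \<partial>?P I1)"
    by (subst fold) (use f g in \<open>auto simp: fE gE\<close>)
  also have "\<dots> = (\<integral>\<^sup>+x. f x \<partial>?P I1) * (\<integral>\<^sup>+y. g y \<partial>?P I2)"
    using mf mg by (simp add: nn_integral_cmult nn_integral_multc)
  also have "(\<integral>\<^sup>+x. f x \<partial>?P I1) = (\<integral>\<^sup>+w. f w \<partial>?P I)"
    by (subst fold[OF f]) (simp add: fE P2.emeasure_space_1)
  also have "(\<integral>\<^sup>+y. g y \<partial>?P I2) = (\<integral>\<^sup>+w. g w \<partial>?P I)"
    by (subst fold[OF g]) (simp add: gE P1.emeasure_space_1)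
  finally show ?thesis .
qed

end

section \<open>Memorylessness of exponential weights\<close>

interpretation exponential: edge_law exponential_law
  by standard simp

interpretation exponential_product: product_sigma_finite "\<lambda>_. exponential_law"
  by (intro product_sigma_finite.intro prob_space_imp_sigma_finite exponential.prob_space_D)

text \<open>Memorylessness: surviving \<tau> has probability exp (- \<tau>), and what then remains
  of the weight is again exponential.\<close>

lemma exponential_law_shift:
  assumes [measurable]: "g \<in> borel_measurable borel" and \<tau>: "0 \<le> \<tau>"
  shows "(\<integral>\<^sup>+x. (if \<tau> < x then g (x - \<tau>) else 0) \<partial>exponential_law) = ennreal (exp (- \<tau>)) * (\<integral>\<^sup>+x. g x \<partial>exponential_law)"
proof -
  have "(\<integral>\<^sup>+x. (if \<tau> < x then g (x - \<tau>) else 0) \<partial>exponential_law) =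
      (\<integral>\<^sup>+x. ennreal (exponential_density 1 x) * (if \<tau> < x then g (x - \<tau>) else 0) \<partial>lborel)"
    unfolding exponential_law_def by (subst nn_integral_density) auto
  also have "\<dots> = (\<integral>\<^sup>+x. ennreal (exponential_density 1 (\<tau> + 1 * x)) * (if \<tau> < \<tau> + 1 * x then g (\<tau> + 1 * x - \<tau>) else 0) \<partial>lborel)"
    by (subst nn_integral_real_affine[where c = 1 and t = \<tau>]) auto
  also have "\<dots> = (\<integral>\<^sup>+x. ennreal (exp (- \<tau>)) * (ennreal (exponential_density 1 x) * g x) \<partial>lborel)"
  proof (rule nn_integral_cong_AE)
    \<comment> \<open>At \<open>x = 0\<close> the strict test fails although the density is positive
      there, so the integrands agree only almost everywhere.\<close>
    have "AE x in lborel. (x::real) \<noteq> 0" by (rule AE_lborel_singleton)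
    then show "AE x in lborel. ennreal (exponential_density 1 (\<tau> + 1 * x)) * (if \<tau> < \<tau> + 1 * x then g (\<tau> + 1 * x - \<tau>) else 0)
        = ennreal (exp (- \<tau>)) * (ennreal (exponential_density 1 x) * g x)"
      by eventually_elim (use \<tau> in \<open>auto simp: exponential_density_def ennreal_mult[symmetric] mult.assoc[symmetric] exp_add[symmetric]\<close>)
  qed
  also have "\<dots> = ennreal (exp (- \<tau>)) * (\<integral>\<^sup>+x. g x \<partial>exponential_law)"
    unfolding exponential_law_def by (subst nn_integral_cmult) (auto simp: nn_integral_density)
  finally show ?thesis .
qed

lemma measurable_upd_minus:
  assumes "i \<in> I"
  shows "(\<lambda>w. w(i := w i - \<tau>)) \<in> measurable (PiM I (\<lambda>_. exponential_law)) (PiM I (\<lambda>_. exponential_law))"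
proof (rule measurable_PiM_single')
  show "(\<lambda>w. (w(i := w i - \<tau>)) j) \<in> measurable (PiM I (\<lambda>_. exponential_law)) exponential_law" if "j \<in> I" for j
  proof (cases "j = i")
    case True
    have "(\<lambda>w. w i - \<tau>) \<in> borel_measurable (PiM I (\<lambda>_. exponential_law))"
      using measurable_component_singleton[OF assms, of "\<lambda>_. exponential_law"]
      by (intro borel_measurable_diff) (auto simp: measurable_def)
    then show ?thesis using True by (simp add: measurable_cong_sets[OF refl exponential.sets_D])
  next
    case False
    then show ?thesis using measurable_component_singleton[OF that, of "\<lambda>_. exponential_law"] by simp
  qed
qed (use assms in \<open>auto simp: space_PiM PiE_def extensional_def\<close>)

lemma PiM_exponential_shift_one:
  assumes I: "finite I" "i \<in> I" and F: "F \<in> borel_measurable (PiM I (\<lambda>_. exponential_law))" and \<tau>: "0 \<le> \<tau>"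
  shows "(\<integral>\<^sup>+w. (if \<tau> < w i then F (w(i := w i - \<tau>)) else 0) \<partial>PiM I (\<lambda>_. exponential_law)) =
     ennreal (exp (- \<tau>)) * (\<integral>\<^sup>+w. F w \<partial>PiM I (\<lambda>_. exponential_law))"
    and "(\<lambda>w. if \<tau> < w i then F (w(i := w i - \<tau>)) else 0) \<in> borel_measurable (PiM I (\<lambda>_. exponential_law))"
proof -
  let ?P = "PiM I (\<lambda>_. exponential_law)"
  let ?F = "\<lambda>w. if \<tau> < w i then F (w(i := w i - \<tau>)) else 0"
  have [measurable]: "(\<lambda>w. w i) \<in> borel_measurable ?P"
    using measurable_component_singleton[OF I(2), of "\<lambda>_. exponential_law"] by (auto simp: measurable_def)
  have [measurable]: "(\<lambda>w. F (w(i := w i - \<tau>))) \<in> borel_measurable ?P"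
    using measurable_compose[OF measurable_upd_minus[OF I(2)] F] .
  show m: "?F \<in> borel_measurable ?P" by measurable
  define J where "J = I - {i}"
  have J: "finite J" "i \<notin> J" "insert i J = I" using I by (auto simp: J_def)
  have "(\<integral>\<^sup>+w. ?F w \<partial>?P) = (\<integral>\<^sup>+x. (\<integral>\<^sup>+y. ?F (x(i := y)) \<partial>exponential_law) \<partial>PiM J (\<lambda>_. exponential_law))"
    using exponential_product.product_nn_integral_insert[OF J(1,2), of ?F] m by (simp add: J(3))
  also have "\<dots> = (\<integral>\<^sup>+x. ennreal (exp (- \<tau>)) * (\<integral>\<^sup>+y. F (x(i := y)) \<partial>exponential_law) \<partial>PiM J (\<lambda>_. exponential_law))"
  proof (rule nn_integral_cong)
    fix x assume x: "x \<in> space (PiM J (\<lambda>_. exponential_law))"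
    have "(\<lambda>y. F (x(i := y))) \<in> borel_measurable exponential_law"
      using measurable_compose[OF measurable_component_update[OF x J(2)], of F borel] F by (simp add: J(3))
    then have "(\<lambda>y. F (x(i := y))) \<in> borel_measurable borel" by (simp add: measurable_cong_sets[OF exponential.sets_D refl])
    from exponential_law_shift[OF this \<tau>]
    show "(\<integral>\<^sup>+y. ?F (x(i := y)) \<partial>exponential_law) = ennreal (exp (- \<tau>)) * (\<integral>\<^sup>+y. F (x(i := y)) \<partial>exponential_law)"
      by (simp cong: if_cong)
  qed
  also have "\<dots> = ennreal (exp (- \<tau>)) * (\<integral>\<^sup>+x. (\<integral>\<^sup>+y. F (x(i := y)) \<partial>exponential_law) \<partial>PiM J (\<lambda>_. exponential_law))"
  proof (rule nn_integral_cmult)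
    have "(\<lambda>(x, y). F (x(i := y))) \<in> borel_measurable (PiM J (\<lambda>_. exponential_law) \<Otimes>\<^sub>M exponential_law)"
      using measurable_compose[OF measurable_add_dim[of i J "\<lambda>_. exponential_law"], of F borel] F
      by (simp add: J(3) case_prod_beta')
    then show "(\<lambda>x. \<integral>\<^sup>+y. F (x(i := y)) \<partial>exponential_law) \<in> borel_measurable (PiM J (\<lambda>_. exponential_law))"
      by (rule exponential_product.M.borel_measurable_nn_integral)
  qed
  also have "(\<integral>\<^sup>+x. (\<integral>\<^sup>+y. F (x(i := y)) \<partial>exponential_law) \<partial>PiM J (\<lambda>_. exponential_law)) = (\<integral>\<^sup>+w. F w \<partial>?P)"
    using exponential_product.product_nn_integral_insert[OF J(1,2), of F] F by (simp add: J(3))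
  finally show "(\<integral>\<^sup>+w. ?F w \<partial>?P) = ennreal (exp (- \<tau>)) * (\<integral>\<^sup>+w. F w \<partial>?P)" .
qed

definition shift :: "real \<Rightarrow> 'a set \<Rightarrow> ('a \<Rightarrow> real) \<Rightarrow> 'a \<Rightarrow> real" where
  "shift \<tau> E w = (\<lambda>e. if e \<in> E then w e - \<tau> else w e)"

lemma PiM_exponential_shift:
  assumes I: "finite I" "E \<subseteq> I" and F: "F \<in> borel_measurable (PiM I (\<lambda>_. exponential_law))" and \<tau>: "0 \<le> \<tau>"
  shows "(\<integral>\<^sup>+w. (if \<forall>e\<in>E. \<tau> < w e then F (shift \<tau> E w) else 0) \<partial>PiM I (\<lambda>_. exponential_law)) =
     ennreal (exp (- \<tau> * card E)) * (\<integral>\<^sup>+w. F w \<partial>PiM I (\<lambda>_. exponential_law)) \<and>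
     (\<lambda>w. if \<forall>e\<in>E. \<tau> < w e then F (shift \<tau> E w) else 0) \<in> borel_measurable (PiM I (\<lambda>_. exponential_law))"
proof -
  have "finite E" using I finite_subset by blast
  then show ?thesis using I(2) F
  proof (induction E arbitrary: F rule: finite_induct)
    case empty
    then show ?case by (simp add: shift_def)
  next
    case (insert i E)
    define F1 where "F1 w = (if \<tau> < w i then F (w(i := w i - \<tau>)) else 0)" for w
    have i: "i \<in> I" using insert by auto
    have eq: "(if \<forall>e\<in>insert i E. \<tau> < w e then F (shift \<tau> (insert i E) w) else 0) =
        (if \<forall>e\<in>E. \<tau> < w e then F1 (shift \<tau> E w) else 0)" for w
    proof -
      have "(shift \<tau> E w)(i := shift \<tau> E w i - \<tau>) = shift \<tau> (insert i E) w"
        using insert.hyps(2) by (auto simp: shift_def)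
      moreover have "shift \<tau> E w i = w i" using insert.hyps(2) by (simp add: shift_def)
      ultimately show ?thesis by (simp add: F1_def)
    qed
    note one = PiM_exponential_shift_one[OF I(1) i insert.prems(2) \<tau>, folded F1_def]
    have IH: "(\<integral>\<^sup>+w. (if \<forall>e\<in>E. \<tau> < w e then F1 (shift \<tau> E w) else 0) \<partial>PiM I (\<lambda>_. exponential_law)) =
        ennreal (exp (- \<tau> * card E)) * (\<integral>\<^sup>+w. F1 w \<partial>PiM I (\<lambda>_. exponential_law)) \<and>
       (\<lambda>w. if \<forall>e\<in>E. \<tau> < w e then F1 (shift \<tau> E w) else 0) \<in> borel_measurable (PiM I (\<lambda>_. exponential_law))"
      by (rule insert.IH) (use insert.prems one(2) in auto)
    have "exp (- \<tau> * card E) * exp (- \<tau>) = exp (- \<tau> * card (insert i E))"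
      using insert.hyps by (simp add: mult_exp_exp algebra_simps)
    then have "ennreal (exp (- \<tau> * card E)) * ennreal (exp (- \<tau>)) = ennreal (exp (- \<tau> * card (insert i E)))"
      by (simp add: ennreal_mult[symmetric])
    then show ?case unfolding eq using IH one(1) by (simp add: mult.assoc[symmetric])
  qed
qed

section \<open>Exploring the graph from a growing set\<close>

definition reach :: "nat set \<Rightarrow> (nat set \<Rightarrow> real) \<Rightarrow> nat set \<Rightarrow> nat \<Rightarrow> real \<Rightarrow> bool" where
  "reach V w U y T \<longleftrightarrow> (\<exists>q. q \<noteq> [] \<and> hd q \<in> U \<and> set (tl q) \<inter> U = {} \<and> last q = y \<and> distinct q \<and>
     set q \<subseteq> V \<and> path_cost w q \<le> T)"

text \<open>A path that never returns to \<open>U\<close> uses no edge inside \<open>U\<close>.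
  Hence \<open>reach\<close> ignores the edges among explored vertices, which is the source of the
  independence below.\<close>

lemma leaving_edge: "distinct q \<Longrightarrow> set (tl q) \<inter> U = {} \<Longrightarrow> e \<in> path_edges q \<Longrightarrow> \<not> e \<subseteq> U"
proof
  assume q: "distinct q" "set (tl q) \<inter> U = {}" "e \<in> path_edges q" "e \<subseteq> U"
  then have "e \<subseteq> {hd q}" using path_edges_subset[OF q(3)] by (cases q) auto
  moreover have "card e = 2" using path_edges_card2 q by blast
  ultimately show False using card_mono[of "{hd q}" e] by simp
qed

context
  fixes n :: nat and V :: "nat set" and y :: nat
  assumes V: "V \<subseteq> {..<n}" and y: "y \<in> V"
begin

abbreviation (input) "PE \<equiv> edge_weights exponential_law n"

definition far :: "nat set \<Rightarrow> real \<Rightarrow> (nat set \<Rightarrow> real) set" where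
  "far U T = {w \<in> space PE. \<not> reach V w U y T}"

text \<open>The event that \<open>S\<close> is exactly the set of vertices joined directly to
  \<open>U\<close> by an edge of weight at most \<tau>; these events partition the space as
  \<open>S\<close> varies.\<close>

definition joined :: "real \<Rightarrow> nat set \<Rightarrow> nat set \<Rightarrow> (nat set \<Rightarrow> real) set" where
  "joined \<tau> U S = {w \<in> space PE. (\<forall>v\<in>S. \<exists>u\<in>U. w {u, v} \<le> \<tau>) \<and> (\<forall>u\<in>U. \<forall>v\<in>V - U - S. \<tau> < w {u, v})}"

lemma finite_V: "finite V"
  using V finite_subset by blast

lemma pair_in: "u \<in> V \<Longrightarrow> v \<in> V \<Longrightarrow> u \<noteq> v \<Longrightarrow> {u, v} \<in> K_edges n"
  using V by (auto simp: K_edges_def)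

lemma coordinate_measurable: "e \<in> K_edges n \<Longrightarrow> (\<lambda>w. w e) \<in> borel_measurable PE"
  unfolding edge_weights_def
  using measurable_component_singleton[of e "K_edges n" "\<lambda>_. exponential_law"] by (auto simp: measurable_def)

lemma path_cost_measurable:
  assumes "distinct q" "set q \<subseteq> V"
  shows "(\<lambda>w. path_cost w q) \<in> borel_measurable PE"
proof -
  have "path_edges q \<subseteq> K_edges n" by (rule path_edges_in_K_edges) (use assms V in auto)
  then show ?thesis unfolding path_cost_def by (intro borel_measurable_sum coordinate_measurable) auto
qed

lemma far_sets: "far U T \<in> sets PE"
proof -
  let ?Q = "{q. distinct q \<and> set q \<subseteq> V \<and> q \<noteq> [] \<and> hd q \<in> U \<and> set (tl q) \<inter> U = {} \<and> last q = y}"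
  have "finite ?Q"
    by (rule finite_subset[OF _ finite_subset_distinct[OF finite_V]]) auto
  moreover have "{w \<in> space PE. path_cost w q \<le> T} \<in> sets PE" if "q \<in> ?Q" for q
  proof -
    have [measurable]: "(\<lambda>w. path_cost w q) \<in> borel_measurable PE" using path_cost_measurable that by auto
    show ?thesis by measurable
  qed
  moreover have "far U T = space PE - (\<Union>q\<in>?Q. {w \<in> space PE. path_cost w q \<le> T})"
    by (auto simp: far_def reach_def)
  ultimately show ?thesis by auto
qed

lemma joined_sets: "U \<subseteq> V \<Longrightarrow> S \<subseteq> V - U \<Longrightarrow> joined \<tau> U S \<in> sets PE"
proof -
  assume U: "U \<subseteq> V" and S: "S \<subseteq> V - U"
  have fin: "finite U" "finite S" "finite (V - U - S)" using U S finite_V finite_subset[of U V] finite_subset[of S V] by auto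
  have [measurable]: "(\<lambda>w. w {u, v}) \<in> borel_measurable PE" if "u \<in> U" "v \<in> S \<or> v \<in> V - U - S" for u v
    by (rule coordinate_measurable, rule pair_in) (use that U S in auto)
  show ?thesis unfolding joined_def using fin by measurable
qed

text \<open>One tick of the exploration: the vertices of \<open>S\<close> are added to
  \<open>U\<close>, the edges from \<open>U\<close> to all other vertices have survived \<tau> and
  only their residual weights count, and the remaining time is \<open>T\<close>.\<close>

lemma far_tick:
  assumes U: "U \<subseteq> V" "y \<notin> U" and T: "0 \<le> T" "0 \<le> \<tau>" and w: "w \<in> far U (T + \<tau>)"
  defines "S \<equiv> {v \<in> V - U. \<exists>u\<in>U. w {u, v} \<le> \<tau>}"
  shows "y \<notin> S" "w \<in> joined \<tau> U S" "shift \<tau> {{u, v} |u v. u \<in> U \<and> v \<in> V - U - S} w \<in> far (U \<union> S) T"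
proof -
  have sp: "w \<in> space PE" and nr: "\<not> reach V w U y (T + \<tau>)" using w by (auto simp: far_def)
  show "y \<notin> S"
  proof
    assume "y \<in> S"
    then obtain u where u: "u \<in> U" "w {u, y} \<le> \<tau>" by (auto simp: S_def)
    then have "u \<noteq> y" using U by auto
    then have "reach V w U y (T + \<tau>)"
      unfolding reach_def using u U y T by (intro exI[of _ "[u, y]"]) (auto simp: path_cost_def)
    then show False using nr by simp
  qed
  show "w \<in> joined \<tau> U S" using sp by (auto simp: joined_def S_def) (meson not_le)
  let ?E = "{{u, v} |u v. u \<in> U \<and> v \<in> V - U - S}"
  have EI: "?E \<subseteq> K_edges n" using U pair_in by auto
  have "\<not> reach V (shift \<tau> ?E w) (U \<union> S) y T"
  proof
    assume "reach V (shift \<tau> ?E w) (U \<union> S) y T"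
    then obtain q where q: "q \<noteq> []" "hd q \<in> U \<union> S" "set (tl q) \<inter> (U \<union> S) = {}" "last q = y" "distinct q"
       "set q \<subseteq> V" "path_cost (shift \<tau> ?E w) q \<le> T" unfolding reach_def by blast
    obtain v r where vr: "q = v # r" using q(1) by (cases q) auto
    have r: "r \<noteq> []" using q(2,4) U(2) \<open>y \<notin> S\<close> vr by auto
    have same: "path_cost (shift \<tau> ?E w) p = path_cost w p" if "set p \<inter> U = {}" for p
      unfolding path_cost_def
    proof (rule sum.cong[OF refl])
      fix e assume "e \<in> path_edges p"
      then have "e \<notin> ?E" using path_edges_subset that by fastforce
      then show "shift \<tau> ?E w e = w e" unfolding shift_def by (simp only: if_False)
    qed
    have ru: "set r \<inter> (U \<union> S) = {}" using q(3) vr by simp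
    show False
    \<comment> \<open>A path that starts in \<open>U\<close> crosses exactly one shifted edge; a
      path that starts in \<open>S\<close> is preceded by an edge from \<open>U\<close> of weight at
      most \<tau>. Either way its cost in the original weights grows by at most \<tau>.\<close>
    proof (cases "v \<in> U")
      case True
      have "hd r \<in> set r" "set r \<subseteq> V" using r q(6) vr by auto
      then have "hd r \<in> V - U - S" using ru by blast
      then have "{v, hd r} \<in> ?E" using True by blast
      then have "path_cost (shift \<tau> ?E w) q = w {v, hd r} - \<tau> + path_cost w r"
        using path_cost_Cons[of v r] q(5) vr r same[of r] ru by (auto simp: shift_def)
      moreover have "path_cost w q = w {v, hd r} + path_cost w r"
        using path_cost_Cons[of v r] q(5) vr r by simp
      ultimately have "reach V w U y (T + \<tau>)"
        unfolding reach_def using q True vr by (intro exI[of _ q]) auto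
      then show False using nr by simp
    next
      case False
      then have vS: "v \<in> S" using q(2) vr by auto
      then obtain u where u: "u \<in> U" "w {u, v} \<le> \<tau>" by (auto simp: S_def)
      have d: "distinct (u # q)" "set q \<inter> U = {}" using False ru u(1) q(5) vr by auto
      have "path_cost w (u # q) = w {u, v} + path_cost w q"
        using path_cost_Cons[of u q w] d q(1) vr by simp
      also have "\<dots> \<le> T + \<tau>" using u(2) q(7) same[OF d(2)] by simp
      finally have "reach V w U y (T + \<tau>)"
        unfolding reach_def using d u(1) U q by (intro exI[of _ "u # q"]) auto
      then show False using nr by simp
    qed
  qed
  moreover have "shift \<tau> ?E w \<in> space PE"
    using sp EI by (auto simp: edge_weights_def space_PiM PiE_def extensional_def shift_def)
  ultimately show "shift \<tau> ?E w \<in> far (U \<union> S) T" by (simp add: far_def)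
qed

text \<open>The markov property of the exploration. The first half of \<open>joined\<close> looks at
  edges inside \<open>U \<union> S\<close>, which \<open>far\<close> ignores; the second half only
  says that the edges of \<open>E\<close> survive \<tau>, and by memorylessness their residuals are
  fresh exponentials.\<close>

lemma joined_far_indep:
  assumes U: "U \<subseteq> V" and S: "S \<subseteq> V - U" and \<tau>: "0 \<le> \<tau>"
  defines "E \<equiv> {{u, v} |u v. u \<in> U \<and> v \<in> V - U - S}"
  shows "emeasure PE {w \<in> joined \<tau> U S. shift \<tau> E w \<in> far (U \<union> S) T} =
     emeasure PE (joined \<tau> U S) * emeasure PE (far (U \<union> S) T)"
    and "{w \<in> joined \<tau> U S. shift \<tau> E w \<in> far (U \<union> S) T} \<in> sets PE"
proof -
  \<comment> \<open>The coordinates are split into those that decide which vertices of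
    \<open>S\<close> are joined and those seen from \<open>U \<union> S\<close>, among them all of
    \<open>E\<close>.\<close>
  define I1 where "I1 = {e \<in> K_edges n. e \<subseteq> U \<union> S}"
  define I2 where "I2 = K_edges n - I1"
  have fin: "finite I1" "finite I2" "I1 \<inter> I2 = {}" and KI: "K_edges n = I1 \<union> I2" by (auto simp: I1_def I2_def)
  have EK: "E \<subseteq> K_edges n" using U pair_in by (auto simp: E_def)
  have EI: "E \<subseteq> I2"
  proof
    fix e assume e: "e \<in> E"
    then obtain u v where "e = {u, v}" "v \<notin> U \<union> S" by (auto simp: E_def)
    then show "e \<in> I2" using EK e by (auto simp: I1_def I2_def)
  qed
  have USI: "{u, v} \<in> I1" if "u \<in> U" "v \<in> S" for u v
    using that U S pair_in[of u v] by (auto simp: I1_def)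
  define f where "f w = (if \<forall>v\<in>S. \<exists>u\<in>U. w {u, v} \<le> \<tau> then 1 else 0 :: ennreal)" for w :: "nat set \<Rightarrow> real"
  have fin2: "finite U" "finite S" using U S finite_V finite_subset[of U V] finite_subset[of S V] by auto
  have [measurable]: "(\<lambda>w. w {u, v}) \<in> borel_measurable PE" if "u \<in> U" "v \<in> S" for u v
    by (rule coordinate_measurable, rule pair_in) (use that U S in auto)
  have f: "f \<in> borel_measurable PE" unfolding f_def using fin2 by measurable
  have fdep: "f w = f w'" if "\<And>e. e \<in> I1 \<Longrightarrow> w e = w' e" for w w'
    using that USI by (simp add: f_def)
  have gen: "(\<integral>\<^sup>+w. f w * (if \<forall>e\<in>E. \<tau> < w e then F (shift \<tau> E w) else 0) \<partial>PE) =
      (\<integral>\<^sup>+w. f w \<partial>PE) * (ennreal (exp (- \<tau> * card E)) * (\<integral>\<^sup>+w. F w \<partial>PE))"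
    "(\<lambda>w. if \<forall>e\<in>E. \<tau> < w e then F (shift \<tau> E w) else 0) \<in> borel_measurable PE"
    if F: "F \<in> borel_measurable PE" and dep: "\<And>w w'. (\<And>e. e \<in> I2 \<Longrightarrow> w e = w' e) \<Longrightarrow> F w = F w'" for F
  proof -
    note sh = PiM_exponential_shift[OF exponential.finite_K_edges EK F[unfolded edge_weights_def] \<tau>, folded edge_weights_def]
    show m: "(\<lambda>w. if \<forall>e\<in>E. \<tau> < w e then F (shift \<tau> E w) else 0) \<in> borel_measurable PE" using sh by blast
    have "(if \<forall>e\<in>E. \<tau> < w e then F (shift \<tau> E w) else 0) = (if \<forall>e\<in>E. \<tau> < w' e then F (shift \<tau> E w') else 0)"
      if "\<And>e. e \<in> I2 \<Longrightarrow> w e = w' e" for w w'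
    proof -
      have "F (shift \<tau> E w) = F (shift \<tau> E w')" by (rule dep) (use that in \<open>simp add: shift_def\<close>)
      then show ?thesis using that EI by (metis subsetD)
    qed
    from exponential.nn_integral_PiM_indep[OF fin KI _ _ fdep this, folded edge_weights_def, OF f m]
    show "(\<integral>\<^sup>+w. f w * (if \<forall>e\<in>E. \<tau> < w e then F (shift \<tau> E w) else 0) \<partial>PE) =
      (\<integral>\<^sup>+w. f w \<partial>PE) * (ennreal (exp (- \<tau> * card E)) * (\<integral>\<^sup>+w. F w \<partial>PE))" using sh by simp
  qed
  have jE: "indicator (joined \<tau> U S) w = f w * (if \<forall>e\<in>E. \<tau> < w e then 1 else 0)" if "w \<in> space PE" for w
    using that by (auto simp: joined_def f_def E_def split: split_indicator)
  have shsp: "shift \<tau> E w \<in> space PE" if "w \<in> space PE" for w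
    using that EK by (auto simp: edge_weights_def space_PiM PiE_def extensional_def shift_def)
  define F where "F w = (if reach V w (U \<union> S) y T then 0 else 1 :: ennreal)" for w
  have FE: "F w = indicator (far (U \<union> S) T) w" if "w \<in> space PE" for w
    using that by (auto simp: F_def far_def split: split_indicator)
  have Fm: "F \<in> borel_measurable PE"
    using measurable_cong[of PE F "indicator (far (U \<union> S) T)" borel] FE far_sets[of "U \<union> S" T] by simp
  have Fdep: "F w = F w'" if w: "\<And>e. e \<in> I2 \<Longrightarrow> w e = w' e" for w w'
  proof -
    have "path_cost w q = path_cost w' q"
      if q: "distinct q" "set (tl q) \<inter> (U \<union> S) = {}" "set q \<subseteq> V" for q
      unfolding path_cost_def
    proof (rule sum.cong[OF refl])
      fix e assume e: "e \<in> path_edges q"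
      then have "e \<in> K_edges n" using path_edges_in_K_edges[OF q(1), of n] q(3) V by blast
      then show "w e = w' e" using leaving_edge[OF q(1,2) e] w by (auto simp: I1_def I2_def)
    qed
    then have "reach V w (U \<union> S) y T = reach V w' (U \<union> S) y T" unfolding reach_def by metis
    then show ?thesis by (simp add: F_def)
  qed
  have iE: "indicator {w \<in> joined \<tau> U S. shift \<tau> E w \<in> far (U \<union> S) T} w =
      f w * (if \<forall>e\<in>E. \<tau> < w e then F (shift \<tau> E w) else 0)" if "w \<in> space PE" for w
  proof -
    have "\<tau> < w e" if "w \<in> joined \<tau> U S" "e \<in> E" for e using that by (auto simp: joined_def E_def)
    then show ?thesis
      using jE[OF that] FE[OF shsp[OF that]] by (auto split: split_indicator_asm split_indicator)
  qed
  have m: "(\<lambda>w. f w * (if \<forall>e\<in>E. \<tau> < w e then F (shift \<tau> E w) else 0)) \<in> borel_measurable PE"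
    using f gen(2)[OF Fm Fdep] by measurable
  have "{w \<in> space PE. f w * (if \<forall>e\<in>E. \<tau> < w e then F (shift \<tau> E w) else 0) = 1} \<in> sets PE"
    using m by measurable
  also have "{w \<in> space PE. f w * (if \<forall>e\<in>E. \<tau> < w e then F (shift \<tau> E w) else 0) = 1} =
      {w \<in> joined \<tau> U S. shift \<tau> E w \<in> far (U \<union> S) T}"
  proof -
    have "{w \<in> joined \<tau> U S. shift \<tau> E w \<in> far (U \<union> S) T} \<subseteq> space PE" by (auto simp: joined_def)
    moreover have "f w * (if \<forall>e\<in>E. \<tau> < w e then F (shift \<tau> E w) else 0) = 1 \<longleftrightarrow>
        w \<in> {w \<in> joined \<tau> U S. shift \<tau> E w \<in> far (U \<union> S) T}" if "w \<in> space PE" for w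
      unfolding iE[OF that, symmetric] by (rule indicator_eq_1_iff)
    ultimately show ?thesis by blast
  qed
  finally show sets: "{w \<in> joined \<tau> U S. shift \<tau> E w \<in> far (U \<union> S) T} \<in> sets PE" .
  have "emeasure PE {w \<in> joined \<tau> U S. shift \<tau> E w \<in> far (U \<union> S) T} =
      (\<integral>\<^sup>+w. f w * (if \<forall>e\<in>E. \<tau> < w e then F (shift \<tau> E w) else 0) \<partial>PE)"
    unfolding nn_integral_indicator[OF sets, symmetric] by (intro nn_integral_cong iE)
  also have "\<dots> = (\<integral>\<^sup>+w. f w \<partial>PE) * (ennreal (exp (- \<tau> * card E)) * (\<integral>\<^sup>+w. F w \<partial>PE))"
    by (rule gen(1)[OF Fm Fdep])
  also have "(\<integral>\<^sup>+w. F w \<partial>PE) = emeasure PE (far (U \<union> S) T)"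
    unfolding nn_integral_indicator[OF far_sets, symmetric] by (intro nn_integral_cong FE)
  \<comment> \<open>A factor 1, written as the integral of 1, lets the general factorisation be
    applied backwards to recognise the probability of \<open>joined\<close>.\<close>
  also have "(\<integral>\<^sup>+w. f w \<partial>PE) * (ennreal (exp (- \<tau> * card E)) * emeasure PE (far (U \<union> S) T)) =
      ((\<integral>\<^sup>+w. f w \<partial>PE) * (ennreal (exp (- \<tau> * card E)) * (\<integral>\<^sup>+w. 1 \<partial>PE))) * emeasure PE (far (U \<union> S) T)"
    using prob_space.emeasure_space_1[OF exponential.prob_space_edge_weights] by (simp add: mult.assoc)
  also have "(\<integral>\<^sup>+w. f w \<partial>PE) * (ennreal (exp (- \<tau> * card E)) * (\<integral>\<^sup>+w. 1 \<partial>PE)) =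
      (\<integral>\<^sup>+w. f w * (if \<forall>e\<in>E. \<tau> < w e then 1 else 0) \<partial>PE)"
    by (rule gen(1)[symmetric]) auto
  also have "\<dots> = emeasure PE (joined \<tau> U S)"
    unfolding nn_integral_indicator[OF joined_sets[OF U S], symmetric]
    by (intro nn_integral_cong jE[symmetric])
  finally show "emeasure PE {w \<in> joined \<tau> U S. shift \<tau> E w \<in> far (U \<union> S) T} =
     emeasure PE (joined \<tau> U S) * emeasure PE (far (U \<union> S) T)" .
qed

lemma measure_all_large:
  assumes "E \<subseteq> K_edges n" "0 \<le> \<tau>"
  shows "measure PE {w \<in> space PE. \<forall>e\<in>E. \<tau> < w e} = exp (- \<tau> * card E)"
    "{w \<in> space PE. \<forall>e\<in>E. \<tau> < w e} \<in> sets PE"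
proof -
  interpret prob_space PE by (rule exponential.prob_space_edge_weights)
  have fin: "finite E" using assms finite_subset exponential.finite_K_edges by blast
  have [measurable]: "(\<lambda>w. w e) \<in> borel_measurable PE" if "e \<in> E" for e
    by (rule coordinate_measurable) (use that assms in auto)
  show s: "{w \<in> space PE. \<forall>e\<in>E. \<tau> < w e} \<in> sets PE" using fin by measurable
  have "emeasure PE {w \<in> space PE. \<forall>e\<in>E. \<tau> < w e} = (\<integral>\<^sup>+w. (if \<forall>e\<in>E. \<tau> < w e then 1 else 0) \<partial>PE)"
  proof -
    have "emeasure PE {w \<in> space PE. \<forall>e\<in>E. \<tau> < w e} = (\<integral>\<^sup>+w. indicator {w \<in> space PE. \<forall>e\<in>E. \<tau> < w e} w \<partial>PE)"
      using s by simp
    also have "\<dots> = (\<integral>\<^sup>+w. (if \<forall>e\<in>E. \<tau> < w e then 1 else 0) \<partial>PE)"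
      by (intro nn_integral_cong) (auto split: split_indicator)
    finally show ?thesis .
  qed
  also have "\<dots> = ennreal (exp (- \<tau> * card E))"
    using PiM_exponential_shift[OF exponential.finite_K_edges assms(1) _ assms(2), of "\<lambda>_. 1", folded edge_weights_def]
      emeasure_space_1 by simp
  finally show "measure PE {w \<in> space PE. \<forall>e\<in>E. \<tau> < w e} = exp (- \<tau> * card E)"
    by (simp add: emeasure_eq_measure)
qed

text \<open>In one tick \<open>y\<close> stays unjoined with probability at most exp (- \<tau> *
  card U). Given that, no other vertex joins with the second exponential factor, where the old bound
  \<open>b0\<close> persists; in all other cases the explored set has grown and the better bound
  \<open>b\<close> applies.\<close>

lemma measure_far_tick:
  assumes U: "U \<subseteq> V" "y \<notin> U" and T: "0 \<le> T" "0 \<le> \<tau>"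
    and b: "\<And>S. S \<subseteq> V - U - {y} \<Longrightarrow> S \<noteq> {} \<Longrightarrow> measure PE (far (U \<union> S) T) \<le> b" and b0: "measure PE (far U T) \<le> b0" "b \<le> b0" "0 \<le> b"
  shows "measure PE (far U (T + \<tau>)) \<le>
    exp (- \<tau> * card U) * (b + (b0 - b) * exp (- \<tau> * (card U * (card V - card U - 1))))"
proof -
  interpret prob_space PE by (rule exponential.prob_space_edge_weights)
  let ?S = "Pow (V - U - {y})"
  let ?E = "\<lambda>S. {{u, v} |u v. u \<in> U \<and> v \<in> V - U - S}"
  let ?B = "\<lambda>S. {w \<in> joined \<tau> U S. shift \<tau> (?E S) w \<in> far (U \<union> S) T}"
  have fin: "finite ?S" "finite U" using finite_V U finite_subset by auto
  have Bs: "?B S \<in> sets PE" "measure PE (?B S) = measure PE (joined \<tau> U S) * measure PE (far (U \<union> S) T)" if "S \<in> ?S" for S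
  proof -
    have S: "S \<subseteq> V - U" using that by auto
    show "?B S \<in> sets PE" by (rule joined_far_indep(2)[OF U(1) S T(2)])
    show "measure PE (?B S) = measure PE (joined \<tau> U S) * measure PE (far (U \<union> S) T)"
      unfolding measure_def joined_far_indep(1)[OF U(1) S T(2)] by (rule enn2real_mult)
  qed
  have js: "joined \<tau> U S \<in> sets PE" if "S \<in> ?S" for S using joined_sets[OF U(1), of S] that by auto
  have "measure PE (far U (T + \<tau>)) \<le> measure PE (\<Union>S\<in>?S. ?B S)"
  proof (rule finite_measure_mono)
    show "far U (T + \<tau>) \<subseteq> (\<Union>S\<in>?S. ?B S)"
    proof
      fix w assume w: "w \<in> far U (T + \<tau>)"
      note ft = far_tick[OF U T w]
      have "{v \<in> V - U. \<exists>u\<in>U. w {u, v} \<le> \<tau>} \<in> ?S" using ft(1) by auto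
      then show "w \<in> (\<Union>S\<in>?S. ?B S)" using ft(2,3) by blast
    qed
    show "(\<Union>S\<in>?S. ?B S) \<in> sets PE" using fin Bs(1) by auto
  qed
  also have "\<dots> \<le> (\<Sum>S\<in>?S. measure PE (?B S))"
    using fin Bs(1) by (intro finite_measure_subadditive_finite) auto
  also have "\<dots> = (\<Sum>S\<in>?S. measure PE (joined \<tau> U S) * measure PE (far (U \<union> S) T))"
    using Bs(2) by (intro sum.cong) auto
  also have "\<dots> \<le> (\<Sum>S\<in>?S. measure PE (joined \<tau> U S) * (b + (if S = {} then b0 - b else 0)))"
  proof (intro sum_mono mult_left_mono)
    fix S assume "S \<in> ?S"
    then show "measure PE (far (U \<union> S) T) \<le> b + (if S = {} then b0 - b else 0)"
      using b[of S] b0 by auto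
  qed auto
  also have "\<dots> = (\<Sum>S\<in>?S. measure PE (joined \<tau> U S)) * b + (\<Sum>S\<in>?S. if S = {} then measure PE (joined \<tau> U S) * (b0 - b) else 0)"
    unfolding sum_distrib_right sum.distrib[symmetric] by (intro sum.cong refl) (simp add: algebra_simps)
  also have "(\<Sum>S\<in>?S. if S = {} then measure PE (joined \<tau> U S) * (b0 - b) else 0) = measure PE (joined \<tau> U {}) * (b0 - b)"
    using fin by (subst sum.delta) auto
  finally have main: "measure PE (far U (T + \<tau>)) \<le>
      (\<Sum>S\<in>?S. measure PE (joined \<tau> U S)) * b + measure PE (joined \<tau> U {}) * (b0 - b)" .
  \<comment> \<open>The events are disjoint because the weights determine \<open>S\<close>, and
    since \<open>S\<close> omits \<open>y\<close>, each of them forces all edges from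
    \<open>U\<close> to \<open>y\<close> to survive.\<close>
  have "(\<Sum>S\<in>?S. measure PE (joined \<tau> U S)) = measure PE (\<Union>S\<in>?S. joined \<tau> U S)"
  proof (rule finite_measure_finite_Union[symmetric])
    show "disjoint_family_on (joined \<tau> U) ?S"
      unfolding disjoint_family_on_def
    proof (intro ballI impI)
      fix S S' assume "S \<in> ?S" "S' \<in> ?S" and ne: "S \<noteq> S'"
      have "S = {v \<in> V - U. \<exists>u\<in>U. w {u, v} \<le> \<tau>}" if w: "w \<in> joined \<tau> U S" and S: "S \<in> ?S" for w S
      proof (intro equalityI subsetI)
        show "v \<in> {v \<in> V - U. \<exists>u\<in>U. w {u, v} \<le> \<tau>}" if "v \<in> S" for v
          using w S that unfolding joined_def by blast
        show "v \<in> S" if "v \<in> {v \<in> V - U. \<exists>u\<in>U. w {u, v} \<le> \<tau>}" for v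
        proof (rule ccontr)
          assume "v \<notin> S"
          with that w obtain u where "w {u, v} \<le> \<tau>" "\<tau> < w {u, v}" unfolding joined_def by blast
          then show False by simp
        qed
      qed
      from this[of _ S] this[of _ S'] show "joined \<tau> U S \<inter> joined \<tau> U S' = {}"
        using \<open>S \<in> ?S\<close> \<open>S' \<in> ?S\<close> ne by (metis (no_types, lifting) disjoint_iff)
    qed
  qed (use fin js in auto)
  also have "\<dots> \<le> measure PE {w \<in> space PE. \<forall>e\<in>(\<lambda>u. {u, y}) ` U. \<tau> < w e}"
  proof (rule finite_measure_mono)
    show "(\<Union>S\<in>?S. joined \<tau> U S) \<subseteq> {w \<in> space PE. \<forall>e\<in>(\<lambda>u. {u, y}) ` U. \<tau> < w e}"
    proof
      fix w assume "w \<in> (\<Union>S\<in>?S. joined \<tau> U S)"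
      then obtain S where S: "S \<subseteq> V - U - {y}" "w \<in> joined \<tau> U S" by blast
      then have "y \<in> V - U - S" using y U by blast
      then show "w \<in> {w \<in> space PE. \<forall>e\<in>(\<lambda>u. {u, y}) ` U. \<tau> < w e}" using S(2) by (auto simp: joined_def)
    qed
    show "{w \<in> space PE. \<forall>e\<in>(\<lambda>u. {u, y}) ` U. \<tau> < w e} \<in> sets PE"
      by (rule measure_all_large(2)) (use U y T pair_in in auto)
  qed
  also have "\<dots> = exp (- \<tau> * card ((\<lambda>u. {u, y}) ` U))"
    by (rule measure_all_large(1)) (use U y T pair_in in auto)
  also have "card ((\<lambda>u. {u, y}) ` U) = card U"
    by (rule card_image) (auto simp: inj_on_def doubleton_eq_iff)
  finally have "(\<Sum>S\<in>?S. measure PE (joined \<tau> U S)) * b \<le> exp (- \<tau> * card U) * b"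
    using b0(3) by (intro mult_right_mono)
  moreover have "measure PE (joined \<tau> U {}) = exp (- \<tau> * (card U * (card V - card U)))"
  proof -
    let ?F = "(\<lambda>(u, v). {u, v}) ` (U \<times> (V - U))"
    have "joined \<tau> U {} = {w \<in> space PE. \<forall>e\<in>?F. \<tau> < w e}" by (auto simp: joined_def)
    also have "measure PE \<dots> = exp (- \<tau> * card ?F)"
      by (rule measure_all_large(1)) (use U T pair_in in auto)
    also have "card ?F = card U * (card V - card U)"
      using U fin finite_V by (subst card_image) (auto simp: inj_on_def doubleton_eq_iff card_cartesian_product card_Diff_subset)
    finally show ?thesis .
  qed
  moreover have "exp (- \<tau> * (card U * (card V - card U))) = exp (- \<tau> * card U) * exp (- \<tau> * (card U * (card V - card U - 1)))"
  proof -
    have "card U < card V" using U y finite_V by (metis psubsetI psubset_card_mono)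
    then have "card V - card U = (card V - card U - 1) + 1" by simp
    then have "card U * (card V - card U) = card U + card U * (card V - card U - 1)"
      by (metis add.commute add_mult_distrib2 mult.right_neutral)
    then show ?thesis by (simp add: mult_exp_exp algebra_simps)
  qed
  ultimately show ?thesis using main by (simp add: algebra_simps)
qed

end

text \<open>The factor i / (i + \<alpha>) is the Laplace transform at \<alpha> of an exponential
  waiting time of rate i. The product equals Gamma(j) * Gamma(1 + \<alpha>) / Gamma(j + \<alpha>),
  of order j^(-\<alpha>), and serves as Lyapunov function of the size of the explored set.\<close>

definition phi :: "real \<Rightarrow> nat \<Rightarrow> real" where
  "phi \<alpha> j = (\<Prod>i\<in>{1..<j}. real i / (real i + \<alpha>))"

lemma phi_pos: "0 < \<alpha> \<Longrightarrow> 0 < phi \<alpha> j"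
  unfolding phi_def by (intro prod_pos) auto

lemma phi_Suc: "1 \<le> j \<Longrightarrow> phi \<alpha> (Suc j) = phi \<alpha> j * (real j / (real j + \<alpha>))"
  by (simp add: phi_def prod.atLeastLessThan_Suc)

lemma phi_decreasing: "0 < \<alpha> \<Longrightarrow> 1 \<le> i \<Longrightarrow> i \<le> j \<Longrightarrow> phi \<alpha> j \<le> phi \<alpha> i"
proof (induction j)
  case (Suc j)
  show ?case
  proof (cases "i = Suc j")
    case False
    then have "phi \<alpha> (Suc j) = phi \<alpha> j * (real j / (real j + \<alpha>))" using Suc by (intro phi_Suc) auto
    also have "\<dots> \<le> phi \<alpha> j * 1"
      using phi_pos[OF Suc.prems(1), of j] Suc.prems by (intro mult_left_mono) auto
    finally show ?thesis using Suc False by auto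
  qed simp
qed simp

lemma sum_inverse_le_ln: "1 \<le> m \<Longrightarrow> (\<Sum>i\<in>{1..m}. 1 / real i) \<le> 1 + ln (real m)"
proof (induction m rule: dec_induct)
  case (step m)
  have "ln (real m / real (Suc m)) \<le> real m / real (Suc m) - 1"
    using step by (intro ln_le_minus_one) auto
  then have "1 / real (Suc m) \<le> ln (real (Suc m)) - ln (real m)"
    using step by (simp add: ln_div field_simps)
  then show ?case using step by simp
qed simp

text \<open>Each inverse factor 1 + \<alpha> / i is at most exp (\<alpha> / i), and the harmonic sum
  gives the logarithm.\<close>

lemma inverse_phi_le:
  assumes "0 < \<alpha>" "1 \<le> N"
  shows "1 / phi \<alpha> N \<le> exp (\<alpha> * (1 + ln (real N)))"
proof -
  have "1 / phi \<alpha> N = (\<Prod>i\<in>{1..<N}. 1 + \<alpha> / real i)"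
  proof -
    have "1 / phi \<alpha> N = (\<Prod>i\<in>{1..<N}. 1 / (real i / (real i + \<alpha>)))" by (simp add: phi_def prod_dividef)
    also have "\<dots> = (\<Prod>i\<in>{1..<N}. 1 + \<alpha> / real i)" by (intro prod.cong) (auto simp: field_simps)
    finally show ?thesis .
  qed
  also have "\<dots> \<le> (\<Prod>i\<in>{1..<N}. exp (\<alpha> * (1 / real i)))"
    using assms exp_ge_add_one_self by (intro prod_mono) auto
  also have "\<dots> = exp (\<alpha> * (\<Sum>i\<in>{1..<N}. 1 / real i))" by (simp add: exp_sum sum_distrib_left)
  also have "\<dots> \<le> exp (\<alpha> * (1 + ln (real N)))"
  proof -
    have "(\<Sum>i\<in>{1..<N}. 1 / real i) \<le> (\<Sum>i\<in>{1..N}. 1 / real i)" by (intro sum_mono2) auto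
    also have "\<dots> \<le> 1 + ln (real N)" by (rule sum_inverse_le_ln) fact
    finally show ?thesis using assms by simp
  qed
  finally show ?thesis .
qed

text \<open>Here j is the size of the explored set and m the number of unexplored vertices other
  than the target. To first order the tick lowers the exponent at rate j + \<alpha> * j * m / (j +
  \<alpha>). As j is at least 1, this is at least \<alpha> / (1 + \<alpha>) * (j + m), and j + m
  stays constant during the exploration. The factor 1 - \<eta> pays for ticks of positive
  length.\<close>

lemma lyapunov_step:
  fixes \<alpha> \<eta> \<tau> j m :: real
  assumes "0 < \<alpha>" "0 < \<eta>" "\<eta> < 1" "0 \<le> \<tau>" "1 \<le> j" "0 \<le> m" "\<tau> * (j * m) \<le> \<eta>"
  shows "exp (- \<tau> * j) * (j / (j + \<alpha>) + \<alpha> / (j + \<alpha>) * exp (- \<tau> * (j * m))) \<le>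
    exp (- (\<alpha> / (1 + \<alpha>) * (1 - \<eta>) * (j + m)) * \<tau>)"
proof -
  define z where "z = \<tau> * (j * m)"
  have z: "0 \<le> z" "z \<le> \<eta>" using assms by (auto simp: z_def)
  \<comment> \<open>From (1 + z) * (1 - z + z^2) = 1 + z^3 follows exp (- z) \<le> 1 - z + z^2, and
    z^2 is at most \<eta> * z.\<close>
  have "exp (- z) \<le> 1 - z * (1 - \<eta>)"
  proof -
    have "1 \<le> (1 + z) * (1 - z + z\<^sup>2)"
    proof -
      have "(1 + z) * (1 - z + z\<^sup>2) = 1 + z ^ 3" by (simp add: power2_eq_square power3_eq_cube algebra_simps)
      then show ?thesis using z by simp
    qed
    moreover have "1 + z \<le> exp z" by simp
    moreover have p: "0 \<le> 1 - z + z\<^sup>2" using z assms by simp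
    ultimately have "1 \<le> exp z * (1 - z + z\<^sup>2)" using mult_right_mono[of "1 + z" "exp z" "1 - z + z\<^sup>2"] by linarith
    then have "exp (- z) \<le> 1 - z + z\<^sup>2" by (simp add: exp_minus field_simps)
    also have "\<dots> \<le> 1 - z * (1 - \<eta>)" using mult_left_mono[OF z(2,1)] by (simp add: power2_eq_square algebra_simps)
    finally show ?thesis .
  qed
  then have "j / (j + \<alpha>) + \<alpha> / (j + \<alpha>) * exp (- z) \<le> j / (j + \<alpha>) + \<alpha> / (j + \<alpha>) * (1 - z * (1 - \<eta>))"
    using assms by (intro add_left_mono mult_left_mono) auto
  also have "\<dots> = 1 - \<alpha> / (j + \<alpha>) * z * (1 - \<eta>)"
  proof -
    have "j / (j + \<alpha>) + \<alpha> / (j + \<alpha>) = 1" using assms by (simp add: add_divide_distrib[symmetric])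
    moreover have "\<alpha> / (j + \<alpha>) * (1 - z * (1 - \<eta>)) = \<alpha> / (j + \<alpha>) - \<alpha> / (j + \<alpha>) * z * (1 - \<eta>)"
      by (simp only: right_diff_distrib mult_1_right mult.assoc)
    ultimately show ?thesis by linarith
  qed
  also have "\<dots> \<le> exp (- (\<alpha> / (j + \<alpha>) * z * (1 - \<eta>)))"
    using exp_ge_add_one_self[of "- (\<alpha> / (j + \<alpha>) * z * (1 - \<eta>))"] by simp
  finally have "exp (- \<tau> * j) * (j / (j + \<alpha>) + \<alpha> / (j + \<alpha>) * exp (- z)) \<le>
      exp (- \<tau> * j) * exp (- (\<alpha> / (j + \<alpha>) * z * (1 - \<eta>)))" by (intro mult_left_mono) auto
  also have "\<dots> = exp (- (\<tau> * (j + \<alpha> * j * m * (1 - \<eta>) / (j + \<alpha>))))"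
    by (simp add: mult_exp_exp z_def algebra_simps)
  also have "\<dots> \<le> exp (- (\<alpha> / (1 + \<alpha>) * (1 - \<eta>) * (j + m)) * \<tau>)"
  proof -
    define c where "c = \<alpha> / (1 + \<alpha>) * (1 - \<eta>)"
    have "c \<le> 1 * 1" unfolding c_def using assms by (intro mult_mono) auto
    then have 1: "c * j \<le> j" using assms by simp
    have "1 / (1 + \<alpha>) \<le> j / (j + \<alpha>)" using assms by (simp add: field_simps)
    then have "(\<alpha> * m * (1 - \<eta>)) * (1 / (1 + \<alpha>)) \<le> (\<alpha> * m * (1 - \<eta>)) * (j / (j + \<alpha>))"
      using assms by (intro mult_left_mono) auto
    then have 2: "c * m \<le> \<alpha> * j * m * (1 - \<eta>) / (j + \<alpha>)" by (simp add: c_def mult_ac)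
    have "c * (j + m) \<le> j + \<alpha> * j * m * (1 - \<eta>) / (j + \<alpha>)"
      unfolding distrib_left using 1 2 by linarith
    then have "c * (j + m) * \<tau> \<le> (j + \<alpha> * j * m * (1 - \<eta>) / (j + \<alpha>)) * \<tau>"
      using assms by (intro mult_right_mono)
    then show ?thesis unfolding c_def by (simp add: mult.commute)
  qed
  finally show ?thesis by (simp add: z_def)
qed

text \<open>Induction on the number of ticks. Initially the bound is at least 1 because
  \<open>phi\<close> decreases; in the induction step enlarging the explored set by one vertex
  multiplies the bound by j / (j + \<alpha>), the ratio of consecutive values of
  \<open>phi\<close>.\<close>

lemma measure_far_le:
  assumes V: "V \<subseteq> {..<n}" "y \<in> V" and par: "0 < \<alpha>" "0 < \<eta>" "\<eta> < 1" "0 \<le> \<tau>" "\<tau> * (real (card V))\<^sup>2 \<le> \<eta>"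
    and U: "U \<subseteq> V" "y \<notin> U" "U \<noteq> {}"
  shows "measure (edge_weights exponential_law n) (far n V y U (real i * \<tau>)) \<le>
     phi \<alpha> (card U) / phi \<alpha> (card V) * exp (- (\<alpha> / (1 + \<alpha>) * (1 - \<eta>) * (real (card V) - 1)) * (real i * \<tau>))"
  using U
proof (induction i arbitrary: U)
  case 0
  interpret prob_space "edge_weights exponential_law n" by (rule exponential.prob_space_edge_weights)
  have fin: "finite V" using V finite_subset by blast
  have "1 \<le> card U" using 0 finite_subset[OF 0(1) fin] by (simp add: Suc_le_eq card_gt_0_iff)
  moreover have "card U \<le> card V" using 0 fin by (intro card_mono)
  ultimately have "1 \<le> phi \<alpha> (card U) / phi \<alpha> (card V)"
    using phi_decreasing[OF par(1)] phi_pos[OF par(1)] by (simp add: le_divide_eq_1_pos)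
  then have "prob (far n V y U 0) \<le> phi \<alpha> (card U) / phi \<alpha> (card V)"
    using prob_le_1 order_trans by blast
  then show ?case by simp
next
  case (Suc i)
  have fV: "finite V" using finite_subset[OF V(1)] by simp
  have fin: "finite V" "finite U" using fV finite_subset[OF Suc.prems(1) fV] by auto
  define j where "j = card U"
  define N where "N = card V"
  define \<beta> where "\<beta> = \<alpha> / (1 + \<alpha>) * (1 - \<eta>) * (real N - 1)"
  define E where "E = exp (- \<beta> * (real i * \<tau>))"
  have j1: "1 \<le> j" using Suc.prems fin by (simp add: j_def Suc_le_eq card_gt_0_iff)
  have "U \<subset> V" using Suc.prems V by auto
  then have jN: "j < N" unfolding j_def N_def using fin by (intro psubset_card_mono)
  have pN: "0 < phi \<alpha> N" by (rule phi_pos) fact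
  define b0 where "b0 = phi \<alpha> j / phi \<alpha> N * E"
  define b where "b = phi \<alpha> (Suc j) / phi \<alpha> N * E"
  have E0: "0 \<le> E" by (simp add: E_def)
  have bb: "b = b0 * (real j / (real j + \<alpha>))" unfolding b_def b0_def phi_Suc[OF j1] by (simp add: mult_ac)
  have b0: "0 \<le> b0" using phi_pos[OF par(1), of j] pN E0 by (simp add: b0_def)
  have b: "0 \<le> b" "b \<le> b0"
  proof -
    have "real j / (real j + \<alpha>) \<le> 1" "0 \<le> real j / (real j + \<alpha>)" using par by auto
    then show "0 \<le> b" "b \<le> b0" unfolding bb using b0 mult_left_mono[of "real j / (real j + \<alpha>)" 1 b0]
        mult_nonneg_nonneg[OF b0, of "real j / (real j + \<alpha>)"] by (simp_all only: mult_1_right)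
  qed
  have "measure (edge_weights exponential_law n) (far n V y U (real i * \<tau> + \<tau>)) \<le>
      exp (- \<tau> * card U) * (b + (b0 - b) * exp (- \<tau> * (card U * (card V - card U - 1))))"
  proof (rule measure_far_tick[OF V Suc.prems(1,2) _ par(4)])
    fix S assume S: "S \<subseteq> V - U - {y}" "S \<noteq> {}"
    have le: "measure (edge_weights exponential_law n) (far n V y (U \<union> S) (real i * \<tau>)) \<le> phi \<alpha> (card (U \<union> S)) / phi \<alpha> N * E"
      unfolding E_def \<beta>_def N_def by (rule Suc.IH) (use S Suc.prems in auto)
    have finS: "finite S" using S(1) fin(1) finite_subset by blast
    then have "card (U \<union> S) = card U + card S" using S fin by (intro card_Un_disjoint) auto
    moreover have "0 < card S" using S finS by (simp add: card_gt_0_iff)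
    ultimately have "phi \<alpha> (card (U \<union> S)) \<le> phi \<alpha> (Suc j)" using par by (intro phi_decreasing) (auto simp: j_def)
    then have "phi \<alpha> (card (U \<union> S)) / phi \<alpha> N * E \<le> b"
      unfolding b_def using pN E0 by (intro mult_right_mono divide_right_mono) auto
    with le show "measure (edge_weights exponential_law n) (far n V y (U \<union> S) (real i * \<tau>)) \<le> b" by linarith
  next
    show "measure (edge_weights exponential_law n) (far n V y U (real i * \<tau>)) \<le> b0"
      unfolding b0_def E_def \<beta>_def N_def j_def by (rule Suc.IH) (use Suc.prems in auto)
  qed (use par b in auto)
  also have "\<dots> = b0 * (exp (- \<tau> * real j) * (real j / (real j + \<alpha>) + \<alpha> / (real j + \<alpha>) * exp (- \<tau> * (real j * real (N - j - 1)))))"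
  proof -
    have "b0 - b = b0 * (\<alpha> / (real j + \<alpha>))"
      unfolding bb using par j1 by (simp add: field_simps)
    moreover have "e1 * (b0 * r + b0 * u * e2) = b0 * (e1 * (r + u * e2))" for e1 r u e2 :: real
      by (simp add: algebra_simps)
    ultimately show ?thesis unfolding j_def[symmetric] N_def[symmetric] of_nat_mult using bb by metis
  qed
  also have "\<dots> \<le> b0 * exp (- (\<alpha> / (1 + \<alpha>) * (1 - \<eta>) * (real j + real (N - j - 1))) * \<tau>)"
  proof (intro mult_left_mono lyapunov_step par b0)
    have "real j * real (N - j - 1) \<le> real N * real N" using jN by (intro mult_mono) auto
    then have "\<tau> * (real j * real (N - j - 1)) \<le> \<tau> * (real (card V))\<^sup>2"
      using par by (intro mult_left_mono) (auto simp: N_def power2_eq_square)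
    then show "\<tau> * (real j * real (N - j - 1)) \<le> \<eta>" using par by linarith
  qed (use j1 in auto)
  \<comment> \<open>The exponent no longer involves the size of the explored set, so the same rate
    \<beta> serves at every tick.\<close>
  also have "real j + real (N - j - 1) = real N - 1" using jN by (simp add: of_nat_diff)
  also have "b0 * exp (- (\<alpha> / (1 + \<alpha>) * (1 - \<eta>) * (real N - 1)) * \<tau>) =
      phi \<alpha> j / phi \<alpha> N * exp (- \<beta> * (real (Suc i) * \<tau>))"
    unfolding b0_def E_def \<beta>_def[symmetric] by (simp add: mult_exp_exp algebra_simps)
  finally show ?case unfolding j_def N_def \<beta>_def by (simp add: algebra_simps)
qed

text \<open>The time is cut into so many ticks that their length times the squared number of
  vertices is at most \<eta>. The bound is about N^\<alpha> * exp (- \<alpha> * N * Y) for small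
  \<alpha> and \<eta>, which becomes small as soon as \<open>Y\<close> exceeds (1 + \<epsilon>) * ln
  N / N.\<close>

lemma measure_far_single_le:
  assumes V: "V \<subseteq> {..<n}" "x \<in> V" "y \<in> V" "x \<noteq> y" and par: "0 < \<alpha>" "0 < \<eta>" "\<eta> < 1" and Y: "0 \<le> Y"
  shows "measure (edge_weights exponential_law n) (far n V y {x} Y) \<le>
     exp (\<alpha> * (1 + ln (real (card V))) - \<alpha> / (1 + \<alpha>) * (1 - \<eta>) * (real (card V) - 1) * Y)"
proof -
  obtain i :: nat where i: "Y * (real (card V))\<^sup>2 / \<eta> < real i" using reals_Archimedean2 by blast
  have "0 \<le> Y * (real (card V))\<^sup>2 / \<eta>" using Y par by simp
  then have i0: "0 < real i" using i by linarith
  define \<tau> where "\<tau> = Y / real i"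
  have \<tau>: "0 \<le> \<tau>" "real i * \<tau> = Y" using Y i0 by (auto simp: \<tau>_def)
  have "\<tau> * (real (card V))\<^sup>2 \<le> \<eta>" using i i0 par by (simp add: \<tau>_def field_simps)
  from measure_far_le[OF V(1,3) par \<tau>(1) this, of "{x}" i]
  have "measure (edge_weights exponential_law n) (far n V y {x} Y) \<le>
     1 / phi \<alpha> (card V) * exp (- (\<alpha> / (1 + \<alpha>) * (1 - \<eta>) * (real (card V) - 1)) * Y)"
    using V \<tau> by (simp add: phi_def)
  also have "\<dots> \<le> exp (\<alpha> * (1 + ln (real (card V)))) * exp (- (\<alpha> / (1 + \<alpha>) * (1 - \<eta>) * (real (card V) - 1)) * Y)"
  proof (intro mult_right_mono inverse_phi_le par)
    show "1 \<le> card V" using V finite_subset[of V "{..<n}"] card_gt_0_iff[of V] by fastforce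
  qed simp
  finally show ?thesis by (simp add: mult_exp_exp algebra_simps)
qed

section \<open>Coupling the uniform law with the exponential law\<close>

lemma exponential_law_atMost: "0 \<le> a \<Longrightarrow> measure exponential_law {..a} = 1 - exp (- a)"
proof -
  assume a: "0 \<le> a"
  interpret prob_space exponential_law by (rule exponential.prob_space_D)
  have "distributed exponential_law lborel (\<lambda>x. x) (exponential_density 1)"
    unfolding distributed_def
    by (auto simp: exponential_law_def distr_id2)
  from exponential_distributedD_le[OF this a] show ?thesis by (simp add: atMost_def)
qed

lemma uniform_law_eq_distr: "uniform_law = distr exponential_law borel (\<lambda>x. 1 - exp (- x))"
proof (rule cdf_unique)
  interpret u: edge_law uniform_law by standard simp
  have m [measurable]: "(\<lambda>x::real. 1 - exp (- x)) \<in> borel_measurable exponential_law" by simp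
  interpret E: prob_space exponential_law by (rule exponential.prob_space_D)
  show "real_distribution uniform_law"
    unfolding real_distribution_def real_distribution_axioms_def by (simp add: u.prob_space_D)
  show "real_distribution (distr exponential_law borel (\<lambda>x. 1 - exp (- x)))"
    unfolding real_distribution_def real_distribution_axioms_def by (simp add: E.prob_space_distr)
  show "cdf uniform_law = cdf (distr exponential_law borel (\<lambda>x. 1 - exp (- x)))"
  proof
    fix x :: real
    have d: "cdf (distr exponential_law borel (\<lambda>x. 1 - exp (- x))) x = measure exponential_law {y. 1 - exp (- y) \<le> x}"
      unfolding cdf_def by (subst measure_distr) (auto simp: vimage_def)
    have u: "cdf uniform_law x = measure lborel ({0<..<1} \<inter> {..x})"
      unfolding cdf_def uniform_law_def by (subst measure_uniform_measure) auto
    consider "x < 0" | "0 \<le> x" "x < 1" | "1 \<le> x" by linarith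
    then show "cdf uniform_law x = cdf (distr exponential_law borel (\<lambda>x. 1 - exp (- x))) x"
    proof cases
      case 1
      have "measure exponential_law {y. 1 - exp (- y) \<le> x} = 0"
      proof -
        have "AE y in exponential_law. \<not> 1 - exp (- y) \<le> x"
          using exponential.AE_D_nonneg by eventually_elim (smt (verit) 1 exp_le_one_iff)
        then show ?thesis using E.prob_eq_0[of "{y. 1 - exp (- y) \<le> x}"] by (simp add: measurable_cong_sets)
      qed
      moreover have "{0<..<1} \<inter> {..x} = {}" using 1 by auto
      ultimately show ?thesis unfolding d u by simp
    next
      case 2
      have "{y. 1 - exp (- y) \<le> x} = {..- ln (1 - x)}"
      proof -
        have "1 - exp (- y) \<le> x \<longleftrightarrow> y \<le> - ln (1 - x)" for y
          using 2 ln_le_cancel_iff[of "1 - x" "exp (- y)"] by auto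
        then show ?thesis by auto
      qed
      then have "measure exponential_law {y. 1 - exp (- y) \<le> x} = x"
        using exponential_law_atMost[of "- ln (1 - x)"] 2 by simp
      moreover have "{0<..<1} \<inter> {..x} = {0<..x}" using 2 by auto
      ultimately show ?thesis unfolding d u using 2 by simp
    next
      case 3
      have "1 - exp (- y) \<le> x" for y using 3 exp_gt_zero[of "- y"] by linarith
      then have "{y. 1 - exp (- y) \<le> x} = UNIV" by auto
      moreover have "{0<..<1} \<inter> {..x} = {0<..<1}" using 3 by auto
      ultimately show ?thesis unfolding d u using E.prob_space by simp
    qed
  qed
qed

context edge_law
begin

text \<open>Inverse transform sampling: 1 - exp (- x) maps an exponential variable to a uniform one
  and never exceeds x.\<close>

lemma coupling:
  obtains g :: "real \<Rightarrow> real" where "g \<in> borel_measurable borel" "D = distr exponential_law borel g"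
    "\<And>x. 0 \<le> x \<Longrightarrow> g x \<le> x"
proof (cases "D = uniform_law")
  case True
  show ?thesis
  proof (rule that[of "\<lambda>x. 1 - exp (- x)"])
    show "1 - exp (- x) \<le> x" for x :: real using exp_ge_add_one_self[of "- x"] by simp
  qed (use True uniform_law_eq_distr in auto)
next
  case False
  show ?thesis
    by (rule that[of "\<lambda>x. x"]) (use False law in \<open>auto simp: distr_id2\<close>)
qed

lemma far_law_sets:
  assumes V: "V \<subseteq> {..<n}"
  shows "{w \<in> space (edge_weights D n). \<not> reach V w U y T} \<in> sets (edge_weights D n)"
proof -
  let ?Q = "{q. distinct q \<and> set q \<subseteq> V \<and> q \<noteq> [] \<and> hd q \<in> U \<and> set (tl q) \<inter> U = {} \<and> last q = y}"
  have "finite V" using V finite_subset by blast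
  then have "finite ?Q"
    by (intro finite_subset[OF _ finite_subset_distinct[of V]]) auto
  moreover have "{w \<in> space (edge_weights D n). path_cost w q \<le> T} \<in> sets (edge_weights D n)" if "q \<in> ?Q" for q
  proof -
    have sub: "path_edges q \<subseteq> K_edges n" by (rule path_edges_in_K_edges) (use that V in auto)
    have "{w \<in> space (edge_weights D n). (\<forall>e\<in>{}. w e \<le> (0::real)) \<and> (\<Sum>e\<in>path_edges q. w e) \<le> T} \<in> sets (edge_weights D n)"
      unfolding edge_weights_def by (rule measure_light_le(2)[where l = 1]) (use sub in auto)
    then show ?thesis by (simp add: path_cost_def)
  qed
  moreover have "{w \<in> space (edge_weights D n). \<not> reach V w U y T} =
      space (edge_weights D n) - (\<Union>q\<in>?Q. {w \<in> space (edge_weights D n). path_cost w q \<le> T})"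
    by (auto simp: reach_def)
  ultimately show ?thesis by auto
qed

text \<open>The coordinatewise coupling only lowers weights, and lower weights can only shorten
  distances; so the exponential estimate carries over to either law.\<close>

lemma measure_far_law_le:
  assumes V: "V \<subseteq> {..<n}" "y \<in> V"
  shows "measure (edge_weights D n) {w \<in> space (edge_weights D n). \<not> reach V w U y T} \<le>
     measure (edge_weights exponential_law n) (far n V y U T)"
proof -
  obtain g :: "real \<Rightarrow> real" where g [measurable]: "g \<in> borel_measurable borel" and D: "D = distr exponential_law borel g"
    and le: "\<And>x. 0 \<le> x \<Longrightarrow> g x \<le> x" by (metis coupling)
  let ?E = "edge_weights exponential_law n"
  interpret E: prob_space ?E by (rule exponential.prob_space_edge_weights)
  let ?F = "{w \<in> space (edge_weights D n). \<not> reach V w U y T}"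
  have gm: "g \<in> measurable exponential_law D"
    using g by (simp only: measurable_cong_sets[OF exponential.sets_D sets_D])
  have DD: "distr exponential_law D g = D"
    by (subst D, subst D, rule distr_cong) (auto simp: D)
  have eq: "edge_weights D n = distr ?E (edge_weights D n) (compose (K_edges n) g)"
    unfolding edge_weights_def
    by (subst distr_PiM_finite_prob_space') (use gm DD in \<open>auto intro: exponential.prob_space_D prob_space_D\<close>)
  have cm: "compose (K_edges n) g \<in> measurable ?E (edge_weights D n)"
    unfolding edge_weights_def compose_def
    by (intro measurable_restrict measurable_compose[OF _ gm] measurable_component_singleton)
  have "measure (edge_weights D n) ?F = measure ?E (compose (K_edges n) g -` ?F \<inter> space ?E)"
    by (subst eq, rule measure_distr[OF cm far_law_sets[OF V(1)]])
  also have "\<dots> \<le> measure ?E (far n V y U T)"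
  proof (rule E.finite_measure_mono_AE)
    have "AE w in ?E. \<forall>e\<in>K_edges n. 0 \<le> w e"
      unfolding edge_weights_def
      by (intro AE_ball_countable[THEN iffD2] ballI AE_PiM_component exponential.AE_D_nonneg)
        (auto intro: countable_finite exponential.prob_space_D)
    then show "AE w in ?E. w \<in> compose (K_edges n) g -` ?F \<inter> space ?E \<longrightarrow> w \<in> far n V y U T"
    proof eventually_elim
      fix w :: "nat set \<Rightarrow> real" assume nn: "\<forall>e\<in>K_edges n. 0 \<le> w e"
      have "path_cost (compose (K_edges n) g w) q \<le> path_cost w q" if "distinct q" "set q \<subseteq> V" for q
        unfolding path_cost_def
      proof (rule sum_mono)
        fix e assume "e \<in> path_edges q"
        then have "e \<in> K_edges n" using path_edges_in_K_edges[OF that(1), of n] that(2) V by blast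
        then show "compose (K_edges n) g w e \<le> w e" using nn le by (auto simp: compose_def)
      qed
      then have le: "path_cost w q \<le> T \<Longrightarrow> path_cost (compose (K_edges n) g w) q \<le> T"
        if "distinct q" "set q \<subseteq> V" for q using that order_trans by blast
      have "reach V w U y T \<Longrightarrow> reach V (compose (K_edges n) g w) U y T"
        unfolding reach_def by (elim exE, rule exI) (use le in blast)
      then show "w \<in> compose (K_edges n) g -` ?F \<inter> space ?E \<longrightarrow> w \<in> far n V y U T"
        by (auto simp: far_def[OF V])
    qed
  qed (rule far_sets[OF V])
  finally show ?thesis .
qed

end

context instance_law
begin

text \<open>The two end edges contain \<open>s\<close> or \<open>t\<close> and the connection runs
  inside \<open>A\<close>, so cheap ends and a missing connection are independent. The factor z^2 of
  the ends offsets the n^2 pairs, and the bound for a single pair need only be a small negative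
  power of n.\<close>

lemma measure_unconnected_le:
  fixes z Y p :: real
  assumes z: "0 \<le> z" and Y: "0 \<le> Y" and par: "0 < \<alpha>" "0 < \<eta>" "\<eta> < 1"
  obtains B where "B \<in> sets M"
    "measure M B \<le> (real n)\<^sup>2 * (z\<^sup>2 * exp (\<alpha> * (1 + ln (real (n - 2))) - \<alpha> / (1 + \<alpha>) * (1 - \<eta>) * (real (n - 2) - 1) * Y))"
    "\<And>w a b. w \<in> space M - B \<Longrightarrow> a \<in> A \<Longrightarrow> b \<in> A \<Longrightarrow> w {s, a} \<le> z \<Longrightarrow> w {b, t} \<le> z \<Longrightarrow> conn A {} w a b Y"
proof -
  interpret prob_space M by (rule prob_space_edge_weights)
  let ?p = "exp (\<alpha> * (1 + ln (real (n - 2))) - \<alpha> / (1 + \<alpha>) * (1 - \<eta>) * (real (n - 2) - 1) * Y)"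
  define F where "F a b = {w \<in> space M. w {s, a} \<le> z \<and> w {b, t} \<le> z \<and> \<not> reach A w {a} b Y}" for a b
  let ?J = "{(a, b). a \<in> A \<and> b \<in> A \<and> a \<noteq> b}"
  have fin: "finite ?J" by (rule finite_subset[of _ "A \<times> A"]) auto
  have cA: "card A = n - 2" using s_less t_less s_neq_t by simp
  have F: "F a b \<in> sets M \<and> measure M (F a b) \<le> z\<^sup>2 * ?p" if ab: "a \<in> A" "b \<in> A" "a \<noteq> b" for a b
  proof -
    let ?I1 = "{{s, a}, {b, t}}"
    have I1: "?I1 \<subseteq> K_edges n" "card ?I1 = 2"
      using end_edges_in[OF ab(1)] end_edges_in[OF ab(2)] ab s_neq_t by (auto simp: card_insert_if doubleton_eq_iff)
    define E1 where "E1 = {w \<in> space M. (\<forall>e\<in>?I1. w e \<le> z) \<and> (\<Sum>e\<in>{}. w e) \<le> 0}"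
    define E2 where "E2 = {w \<in> space M. \<not> reach A w {a} b Y}"
    have E1: "E1 \<in> sets M" "measure M E1 \<le> z\<^sup>2"
      using measure_light_le[OF finite_K_edges I1(1) _ _ z, of "{}" 1 0] I1(2)
      unfolding E1_def edge_weights_def by auto
    have E2: "E2 \<in> sets M" unfolding E2_def by (rule far_law_sets) auto
    have "measure M E2 \<le> measure (edge_weights exponential_law n) (far n A b {a} Y)"
      unfolding E2_def by (rule measure_far_law_le) (use ab in auto)
    also have "\<dots> \<le> ?p"
      using measure_far_single_le[of A n a b \<alpha> \<eta> Y] ab par Y by (simp add: cA)
    finally have p2: "measure M E2 \<le> ?p" .
    have FE: "F a b = E1 \<inter> E2" by (auto simp: F_def E1_def E2_def)
    have dep: "reach A w {a} b Y = reach A w' {a} b Y" if w: "\<And>e. e \<in> K_edges n - ?I1 \<Longrightarrow> w e = w' e" for w w' :: "nat set \<Rightarrow> real"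
    proof -
      have "path_cost w q = path_cost w' q" if "distinct q" "set q \<subseteq> A" for q
        unfolding path_cost_def
      proof (rule sum.cong[OF refl])
        fix e assume e: "e \<in> path_edges q"
        show "w e = w' e" using A_edges_avoid[OF that(2) e] A_edges_in[OF that] e by (intro w) auto
      qed
      then show ?thesis unfolding reach_def by metis
    qed
    define f g :: "(nat set \<Rightarrow> real) \<Rightarrow> ennreal" where "f w = (if \<forall>e\<in>?I1. w e \<le> z then 1 else 0)"
      and "g w = (if reach A w {a} b Y then 0 else 1)" for w
    have fE: "f w = indicator E1 w" and gE: "g w = indicator E2 w" if "w \<in> space M" for w
      using that by (auto simp: f_def g_def E1_def E2_def split: split_indicator)
    have fm: "f \<in> borel_measurable M" using measurable_cong[of M f "indicator E1" borel] fE E1 by simp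
    have gm: "g \<in> borel_measurable M" using measurable_cong[of M g "indicator E2" borel] gE E2 by simp
    have "emeasure M (F a b) = (\<integral>\<^sup>+w. f w * g w \<partial>M)"
    proof -
      have "emeasure M (F a b) = (\<integral>\<^sup>+w. indicator (F a b) w \<partial>M)" using E1 E2 FE by simp
      also have "\<dots> = (\<integral>\<^sup>+w. f w * g w \<partial>M)"
        by (intro nn_integral_cong) (auto simp: fE gE FE split: split_indicator)
      finally show ?thesis .
    qed
    also have "\<dots> = (\<integral>\<^sup>+w. f w \<partial>M) * (\<integral>\<^sup>+w. g w \<partial>M)"
      unfolding edge_weights_def
    proof (rule nn_integral_PiM_indep[where ?I1.0 = ?I1 and ?I2.0 = "K_edges n - ?I1"])
      show "f w = f w'" if "\<And>e. e \<in> ?I1 \<Longrightarrow> w e = w' e" for w w' using that by (simp add: f_def)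
      show "g w = g w'" if "\<And>e. e \<in> K_edges n - ?I1 \<Longrightarrow> w e = w' e" for w w' using dep[OF that] by (simp add: g_def)
    qed (use I1 fm gm in \<open>auto simp: edge_weights_def\<close>)
    also have "(\<integral>\<^sup>+w. f w \<partial>M) = emeasure M E1"
      unfolding nn_integral_indicator[OF E1(1), symmetric] by (intro nn_integral_cong fE)
    also have "(\<integral>\<^sup>+w. g w \<partial>M) = emeasure M E2"
      unfolding nn_integral_indicator[OF E2, symmetric] by (intro nn_integral_cong gE)
    finally have "measure M (F a b) = measure M E1 * measure M E2"
      unfolding measure_def by (simp add: enn2real_mult)
    also have "\<dots> \<le> z\<^sup>2 * ?p" by (intro mult_mono E1 p2) auto
    finally show ?thesis using E1 E2 FE by auto
  qed
  have FJ: "F (fst p) (snd p) \<in> sets M" "measure M (F (fst p) (snd p)) \<le> z\<^sup>2 * ?p" if "p \<in> ?J" for p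
    using that F[of "fst p" "snd p"] by (simp_all add: case_prod_beta)
  show ?thesis
  proof (rule that[of "\<Union>p\<in>?J. F (fst p) (snd p)"])
    show "(\<Union>p\<in>?J. F (fst p) (snd p)) \<in> sets M" using fin FJ(1) by (intro sets.finite_UN)
    have "measure M (\<Union>p\<in>?J. F (fst p) (snd p)) \<le> (\<Sum>p\<in>?J. measure M (F (fst p) (snd p)))"
      using fin FJ(1) by (intro finite_measure_subadditive_finite) auto
    also have "\<dots> \<le> (\<Sum>p\<in>?J. z\<^sup>2 * ?p)" by (intro sum_mono FJ(2))
    also have "\<dots> = real (card ?J) * (z\<^sup>2 * ?p)" by simp
    also have "\<dots> \<le> (real n)\<^sup>2 * (z\<^sup>2 * ?p)"
    proof (rule mult_right_mono)
      have "card ?J \<le> card ({..<n} \<times> {..<n})" by (rule card_mono) auto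
      then have "card ?J \<le> n\<^sup>2" by (simp add: card_cartesian_product power2_eq_square)
      then have "real (card ?J) \<le> real (n\<^sup>2)" by (simp only: of_nat_le_iff)
      then show "real (card ?J) \<le> (real n)\<^sup>2" by simp
    qed auto
    finally show "measure M (\<Union>p\<in>?J. F (fst p) (snd p)) \<le> (real n)\<^sup>2 * (z\<^sup>2 * ?p)" .
    fix w a b assume w: "w \<in> space M - (\<Union>p\<in>?J. F (fst p) (snd p))" and ab: "a \<in> A" "b \<in> A" "w {s, a} \<le> z" "w {b, t} \<le> z"
    show "conn A {} w a b Y"
    proof (cases "a = b")
      case True
      then show ?thesis using ab Y by (simp add: conn_refl)
    next
      case False
      then have "reach A w {a} b Y" using w ab by (auto simp: F_def)
      then show ?thesis unfolding reach_def conn_def by auto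
    qed
  qed
qed

end

subsection \<open>Expected order statistics\<close>

definition binom_density :: "nat \<Rightarrow> nat \<Rightarrow> real \<Rightarrow> real" where
  "binom_density N j p = real (N choose j) * p ^ j * (1 - p) ^ (N - j)"

lemma kth_smallest_measurable:
  assumes "1 \<le> k" "k \<le> m"
  shows "(\<lambda>x. kth_smallest m x k) \<in> borel_measurable (PiM {..<m} (\<lambda>_. borel))"
proof (rule borel_measurableI_le)
  fix c :: real
  have "{x \<in> space (PiM {..<m} (\<lambda>_. borel)). kth_smallest m x k \<le> c} =
      {x \<in> space (PiM {..<m} (\<lambda>_. borel)). real k \<le> (\<Sum>i<m. indicator {..c} (x i))}"
  proof -
    have "real (card {i. i < m \<and> x i \<le> c}) = (\<Sum>i<m. indicator {..c} (x i))" for x :: "nat \<Rightarrow> real"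
      by (simp add: indicator_def sum.If_cases Int_def lessThan_def)
    then show ?thesis using kth_smallest_le_iff[OF assms] by (metis (mono_tags, lifting) of_nat_le_iff)
  qed
  also have "\<dots> \<in> sets (PiM {..<m} (\<lambda>_. borel))" by measurable
  finally show "{x \<in> space (PiM {..<m} (\<lambda>_. borel)). kth_smallest m x k \<le> c} \<in> sets (PiM {..<m} (\<lambda>_. borel))" .
qed

context edge_law
begin

lemma measure_count_eq:
  "measure (PiM {..<N} (\<lambda>_. D)) {x \<in> space (PiM {..<N} (\<lambda>_. D)). card {i. i < N \<and> x i \<le> c} = j} =
     binom_density N j (measure D {..c})"
  "{x \<in> space (PiM {..<N} (\<lambda>_. D)). card {i. i < N \<and> x i \<le> c} = j} \<in> sets (PiM {..<N} (\<lambda>_. D))"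
proof -
  let ?P = "PiM {..<N} (\<lambda>_. D)"
  interpret D: prob_space D by (rule prob_space_D)
  interpret PS: product_sigma_finite "\<lambda>_::nat. D"
    by (intro product_sigma_finite.intro prob_space_imp_sigma_finite prob_space_D)
  interpret P: prob_space ?P by (rule prob_space_PiM) (rule prob_space_D)
  let ?p = "measure D {..c}"
  define box where "box S = (\<Pi>\<^sub>E i\<in>{..<N}. if i \<in> S then {..c} else {c<..})" for S
  let ?F = "{S. S \<subseteq> {..<N} \<and> card S = j}"
  have eq: "{x \<in> space ?P. card {i. i < N \<and> x i \<le> c} = j} = (\<Union>S\<in>?F. box S)"
  proof (intro equalityI subsetI)
    fix x assume x: "x \<in> {x \<in> space ?P. card {i. i < N \<and> x i \<le> c} = j}"
    then have "x \<in> box {i. i < N \<and> x i \<le> c}" by (auto simp: box_def space_PiM PiE_def extensional_def Pi_def not_le)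
    then show "x \<in> (\<Union>S\<in>?F. box S)" using x by (intro UN_I[of "{i. i < N \<and> x i \<le> c}"]) auto
  next
    fix x assume "x \<in> (\<Union>S\<in>?F. box S)"
    then obtain S where S: "S \<subseteq> {..<N}" "card S = j" "x \<in> box S" by auto
    have "x i \<le> c \<longleftrightarrow> i \<in> S" if "i < N" for i
      using PiE_mem[OF S(3)[unfolded box_def], of i] that by (auto split: if_splits)
    then have "{i. i < N \<and> x i \<le> c} = S" using S(1) by auto
    then show "x \<in> {x \<in> space ?P. card {i. i < N \<and> x i \<le> c} = j}"
      using S by (auto simp: box_def space_PiM PiE_iff)
  qed
  have box: "box S \<in> sets ?P" for S unfolding box_def by (rule sets_PiM_I_finite) auto
  have gt: "measure D {c<..} = 1 - ?p"
  proof -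
    have "{c<..} = space D - {..c}" by auto
    then show ?thesis using D.prob_compl[of "{..c}"] by simp
  qed
  have mb: "measure ?P (box S) = ?p ^ j * (1 - ?p) ^ (N - j)" if S: "S \<in> ?F" for S
  proof -
    have "emeasure ?P (box S) = (\<Prod>i<N. emeasure D (if i \<in> S then {..c} else {c<..}))"
      unfolding box_def by (rule PS.emeasure_PiM) auto
    also have "\<dots> = (\<Prod>i<N. ennreal (if i \<in> S then ?p else if i \<in> {..<N} - S then 1 - ?p else 1))"
      by (intro prod.cong) (auto simp: D.emeasure_eq_measure gt)
    also have "\<dots> = ennreal (\<Prod>i<N. if i \<in> S then ?p else if i \<in> {..<N} - S then 1 - ?p else 1)"
      by (rule prod_ennreal) auto
    also have "(\<Prod>i<N. if i \<in> S then ?p else if i \<in> {..<N} - S then 1 - ?p else 1) =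
        ?p ^ card S * (1 - ?p) ^ card ({..<N} - S)"
      by (rule prod_if_power) (use S in auto)
    also have "card ({..<N} - S) = N - j"
      using S by (subst card_Diff_subset) (auto intro: finite_subset)
    finally show ?thesis using S by (simp add: P.emeasure_eq_measure)
  qed
  have fin: "finite ?F" by simp
  show "{x \<in> space ?P. card {i. i < N \<and> x i \<le> c} = j} \<in> sets ?P" unfolding eq using fin box by auto
  have "measure ?P (\<Union>S\<in>?F. box S) = (\<Sum>S\<in>?F. measure ?P (box S))"
  proof (rule P.finite_measure_finite_Union[OF fin])
    have uniq: "S = {i. i < N \<and> x i \<le> c}" if S: "S \<in> ?F" "x \<in> box S" for S x
    proof -
      have "x i \<le> c \<longleftrightarrow> i \<in> S" if "i < N" for i
        using PiE_mem[OF S(2)[unfolded box_def], of i] that by (auto split: if_splits)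
      then show ?thesis using S(1) by auto
    qed
    show "disjoint_family_on box ?F"
      unfolding disjoint_family_on_def
    proof (intro ballI impI)
      fix S S' assume "S \<in> ?F" "S' \<in> ?F" "S \<noteq> S'"
      then show "box S \<inter> box S' = {}" using uniq[of S] uniq[of S'] by (metis disjoint_iff)
    qed
  qed (use box in auto)
  also have "\<dots> = (\<Sum>S\<in>?F. ?p ^ j * (1 - ?p) ^ (N - j))" by (intro sum.cong mb refl)
  also have "\<dots> = binom_density N j ?p" by (simp add: n_subsets binom_density_def)
  finally show "measure ?P {x \<in> space ?P. card {i. i < N \<and> x i \<le> c} = j} = binom_density N j ?p" unfolding eq .
qed

text \<open>The expectation is the integral of the tail, and the k-th smallest value exceeds u
  exactly when fewer than k of the variables are at most u, a binomial event.\<close>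

lemma nn_integral_kth_smallest:
  assumes "1 \<le> k" "k \<le> N"
  shows "(\<integral>\<^sup>+x. ennreal (kth_smallest N x k) \<partial>PiM {..<N} (\<lambda>_. D)) =
     (\<Sum>j<k. \<integral>\<^sup>+u. ennreal (binom_density N j (measure D {..u})) * indicator {0..} u \<partial>lborel)"
proof -
  let ?P = "PiM {..<N} (\<lambda>_. D)"
  interpret P: prob_space ?P by (rule prob_space_PiM) (rule prob_space_D)
  interpret PL: pair_sigma_finite ?P "lborel :: real measure" ..
  have sD: "sets ?P = sets (PiM {..<N} (\<lambda>_. borel))" by (intro sets_PiM_cong) auto
  have m [measurable]: "(\<lambda>x. kth_smallest N x k) \<in> borel_measurable ?P"
    using kth_smallest_measurable[OF assms] by (simp add: measurable_cong_sets[OF sD refl])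
  have "(\<integral>\<^sup>+x. ennreal (kth_smallest N x k) \<partial>?P) =
      (\<integral>\<^sup>+x. (\<integral>\<^sup>+u. (if 0 \<le> u \<and> u < kth_smallest N x k then 1 else 0) \<partial>lborel) \<partial>?P)"
  proof (rule nn_integral_cong)
    fix x
    have "(\<integral>\<^sup>+u. (if 0 \<le> u \<and> u < kth_smallest N x k then 1 else 0) \<partial>lborel) =
        (\<integral>\<^sup>+u. indicator {0..<kth_smallest N x k} u \<partial>lborel)"
      by (intro nn_integral_cong) (auto split: split_indicator)
    also have "\<dots> = ennreal (kth_smallest N x k)"
      by (cases "0 \<le> kth_smallest N x k") (auto simp: ennreal_neg)
    finally show "ennreal (kth_smallest N x k) = (\<integral>\<^sup>+u. (if 0 \<le> u \<and> u < kth_smallest N x k then 1 else 0) \<partial>lborel)" ..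
  qed
  also have "\<dots> = (\<integral>\<^sup>+u. (\<integral>\<^sup>+x. (if 0 \<le> u \<and> u < kth_smallest N x k then 1 else 0) \<partial>?P) \<partial>lborel)"
    by (rule PL.Fubini'[symmetric]) measurable
  also have "\<dots> = (\<integral>\<^sup>+u. (\<Sum>j<k. ennreal (binom_density N j (measure D {..u})) * indicator {0..} u) \<partial>lborel)"
  proof (rule nn_integral_cong)
    fix u :: real
    let ?C = "\<lambda>j. {x \<in> space ?P. card {i. i < N \<and> x i \<le> u} = j}"
    have "(\<integral>\<^sup>+x. (if 0 \<le> u \<and> u < kth_smallest N x k then 1 else 0) \<partial>?P) =
        (\<integral>\<^sup>+x. indicator {0..} u * indicator (\<Union>j\<in>{..<k}. ?C j) x \<partial>?P)"
    proof (rule nn_integral_cong)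
      fix x assume x: "x \<in> space ?P"
      have "u < kth_smallest N x k \<longleftrightarrow> card {i. i < N \<and> x i \<le> u} < k"
        using kth_smallest_le_iff[OF assms, of x u] by linarith
      then show "(if 0 \<le> u \<and> u < kth_smallest N x k then 1 else 0) = (indicator {0..} u * indicator (\<Union>j\<in>{..<k}. ?C j) x :: ennreal)"
        using x by (auto split: split_indicator)
    qed
    also have "\<dots> = indicator {0..} u * emeasure ?P (\<Union>j\<in>{..<k}. ?C j)"
      using measure_count_eq(2) by (subst nn_integral_cmult_indicator) auto
    also have "emeasure ?P (\<Union>j\<in>{..<k}. ?C j) = (\<Sum>j<k. emeasure ?P (?C j))"
      using measure_count_eq(2) by (intro sum_emeasure[symmetric]) (auto simp: disjoint_family_on_def)
    also have "\<dots> = (\<Sum>j<k. ennreal (binom_density N j (measure D {..u})))"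
      by (simp add: P.emeasure_eq_measure measure_count_eq(1))
    finally show "(\<integral>\<^sup>+x. (if 0 \<le> u \<and> u < kth_smallest N x k then 1 else 0) \<partial>?P) =
       (\<Sum>j<k. ennreal (binom_density N j (measure D {..u})) * indicator {0..} u)"
      by (simp add: sum_distrib_left mult.commute)
  qed
  also have "\<dots> = (\<Sum>j<k. \<integral>\<^sup>+u. ennreal (binom_density N j (measure D {..u})) * indicator {0..} u \<partial>lborel)"
  proof (rule nn_integral_sum)
    fix j
    have "mono (\<lambda>u. measure D {..u})"
    proof
      interpret D: prob_space D by (rule prob_space_D)
      show "measure D {..x} \<le> measure D {..y}" if "x \<le> y" for x y
        using that by (intro D.finite_measure_mono) auto
    qed
    then have [measurable]: "(\<lambda>u. measure D {..u}) \<in> borel_measurable borel" by (rule borel_measurable_mono)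
    show "(\<lambda>u. ennreal (binom_density N j (measure D {..u})) * indicator {0..} u) \<in> borel_measurable lborel"
      unfolding binom_density_def by measurable
  qed
  finally show ?thesis .
qed

end

text \<open>The derivatives of the binomial terms telescope. The partial sums thus supply explicit
  antiderivatives for the integrals of single terms.\<close>

lemma binom_density_sum_deriv:
  assumes f: "(f has_real_derivative f') (at x)" and "j < N"
  shows "((\<lambda>x. \<Sum>i\<le>j. binom_density N i (f x)) has_real_derivative
      - real (N - j) * (real (N choose j) * f x ^ j * (1 - f x) ^ (N - j - 1)) * f') (at x)"
  using assms(2)
proof (induction j)
  case 0
  then show ?case
    unfolding binom_density_def by (auto intro!: derivative_eq_intros f)
next
  case (Suc j)
  \<comment> \<open>The absorption identity that cancels the contributions of neighbouring
    terms.\<close>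
  have r: "real (Suc j) * real (N choose Suc j) = real (N - j) * real (N choose j)"
    by (simp only: of_nat_mult[symmetric] binomial_absorption binomial_absorb_comp)
  have "((\<lambda>x. binom_density N (Suc j) (f x)) has_real_derivative
      (real (N choose Suc j) * (real (Suc j) * f x ^ j * f') * (1 - f x) ^ (N - Suc j) +
       real (N choose Suc j) * f x ^ Suc j * (real (N - Suc j) * (1 - f x) ^ (N - Suc j - 1) * (- f')))) (at x)"
  proof -
    have a: "((\<lambda>x. f x ^ Suc j) has_real_derivative (real (Suc j) * f x ^ j * f')) (at x)"
      using DERIV_power[OF f, of "Suc j"] by (simp add: mult_ac)
    have b: "((\<lambda>x. (1 - f x) ^ (N - Suc j)) has_real_derivative (real (N - Suc j) * (1 - f x) ^ (N - Suc j - 1) * (- f'))) (at x)"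
      using DERIV_power[OF DERIV_diff[OF DERIV_const f], of 1 "N - Suc j"] by (simp add: mult_ac)
    show ?thesis
      unfolding binom_density_def
      by (rule DERIV_cong[OF DERIV_mult[OF DERIV_cmult[OF a, of "real (N choose Suc j)"] b]]) (simp only: mult_ac)
  qed
  from DERIV_add[OF Suc.IH this] Suc.prems
  have "((\<lambda>x. \<Sum>i\<le>Suc j. binom_density N i (f x)) has_real_derivative
      - real (N - j) * (real (N choose j) * f x ^ j * (1 - f x) ^ (N - j - 1)) * f' +
      (real (N choose Suc j) * (real (Suc j) * f x ^ j * f') * (1 - f x) ^ (N - Suc j) +
       real (N choose Suc j) * f x ^ Suc j * (real (N - Suc j) * (1 - f x) ^ (N - Suc j - 1) * (- f')))) (at x)"
    by simp
  also have "- real (N - j) * (real (N choose j) * f x ^ j * (1 - f x) ^ (N - j - 1)) * f' +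
      (real (N choose Suc j) * (real (Suc j) * f x ^ j * f') * (1 - f x) ^ (N - Suc j) +
       real (N choose Suc j) * f x ^ Suc j * (real (N - Suc j) * (1 - f x) ^ (N - Suc j - 1) * (- f'))) =
      (real (Suc j) * real (N choose Suc j) - real (N - j) * real (N choose j)) * (f x ^ j * (1 - f x) ^ (N - Suc j) * f')
      - real (N - Suc j) * (real (N choose Suc j) * f x ^ Suc j * (1 - f x) ^ (N - Suc j - 1)) * f'"
    by (simp add: algebra_simps)
  also have "\<dots> = - real (N - Suc j) * (real (N choose Suc j) * f x ^ Suc j * (1 - f x) ^ (N - Suc j - 1)) * f'"
    unfolding r by simp
  finally show ?case .
qed

text \<open>For the exponential law the derivative of the distribution function is 1 minus that
  function. This supplies the missing factor, so the partial sum divided by -(N - j) is an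
  antiderivative of the binomial term itself.\<close>

lemma nn_integral_binom_exponential:
  assumes j: "j < N"
  shows "(\<integral>\<^sup>+u. ennreal (binom_density N j (measure exponential_law {..u})) * indicator {0..} u \<partial>lborel) = ennreal (1 / real (N - j))"
proof -
  let ?f = "\<lambda>u::real. 1 - exp (- u)"
  let ?G = "\<lambda>u. - (\<Sum>i\<le>j. binom_density N i (?f u)) / real (N - j)"
  have "(\<integral>\<^sup>+u. ennreal (binom_density N j (measure exponential_law {..u})) * indicator {0..} u \<partial>lborel) =
      (\<integral>\<^sup>+u. ennreal (binom_density N j (?f u)) * indicator {0..} u \<partial>lborel)"
    by (intro nn_integral_cong) (auto simp: exponential_law_atMost split: split_indicator)
  also have "\<dots> = ennreal (0 - ?G 0)"
  proof (rule nn_integral_FTC_atLeast)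
    show "(\<lambda>u. binom_density N j (?f u)) \<in> borel_measurable borel" unfolding binom_density_def by measurable
    show "0 \<le> binom_density N j (?f u)" if "0 \<le> u" for u using that by (simp add: binom_density_def)
    show "(?G has_real_derivative binom_density N j (?f u)) (at u)" for u
    proof -
      have f: "(?f has_real_derivative exp (- u)) (at u)" by (auto intro!: derivative_eq_intros)
      have e: "1 - ?f u = exp (- u)" by simp
      have "N - j = Suc (N - j - 1)" using j by simp
      then have p: "exp (- u) ^ (N - j) = exp (- u) ^ (N - j - 1) * exp (- u)" by (metis power_Suc2)
      have r: "- (- r * (a * b * c) * d) / r = a * b * (c * d)" if "r \<noteq> 0" for r a b c d :: real
        using that by simp
      have "real (N - j) \<noteq> 0" using j by simp
      from DERIV_cdivide[OF DERIV_minus[OF binom_density_sum_deriv[OF f j]], of "real (N - j)",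
          unfolded e r[OF this]]
      show ?thesis unfolding binom_density_def[of N j] e p .
    qed
    have "((\<lambda>u. \<Sum>i\<le>j. binom_density N i (?f u)) \<longlongrightarrow> (\<Sum>i\<le>j. 0)) at_top"
    proof (rule tendsto_sum)
      fix i assume "i \<in> {..j}"
      then have "0 < N - i" using j by simp
      have e: "((\<lambda>u::real. exp (- u)) \<longlongrightarrow> 0) at_top" by real_asymp
      have "((\<lambda>u. real (N choose i) * ?f u ^ i * exp (- u) ^ (N - i)) \<longlongrightarrow> real (N choose i) * (1 - 0) ^ i * 0 ^ (N - i)) at_top"
        by (intro tendsto_intros e)
      then show "((\<lambda>u. binom_density N i (?f u)) \<longlongrightarrow> 0) at_top"
        using \<open>0 < N - i\<close> by (simp add: binom_density_def power_0_left)
    qed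
    then have "((\<lambda>u. \<Sum>i\<le>j. binom_density N i (?f u)) \<longlongrightarrow> 0) at_top" by simp
    from tendsto_divide[OF tendsto_minus[OF this] tendsto_const, of "real (N - j)"] j
    show "(?G \<longlongrightarrow> 0) at_top" by simp
  qed
  also have "(\<Sum>i\<le>j. binom_density N i (?f 0)) = (\<Sum>i\<le>j. if i = 0 then 1 else 0)"
    by (intro sum.cong) (auto simp: binom_density_def)
  finally show ?thesis by simp
qed

text \<open>With derivative 1 one factor 1 - p would be missing; the partial sum is therefore taken
  for N + 1 trials, which changes the constant to 1 / (N + 1).\<close>

lemma nn_integral_binom_uniform:
  assumes j: "j < N"
  shows "(\<integral>\<^sup>+u. ennreal (binom_density N j (measure uniform_law {..u})) * indicator {0..} u \<partial>lborel) = ennreal (1 / real (Suc N))"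
proof -
  let ?G = "\<lambda>u. - (\<Sum>i\<le>j. binom_density (Suc N) i u) / real (Suc N)"
  have FTC: "(\<integral>\<^sup>+u. ennreal (binom_density N j u) * indicator {0..1} u \<partial>lborel) = ennreal (1 / real (Suc N))"
  proof -
    have "(\<integral>\<^sup>+u. ennreal (binom_density N j u) * indicator {0..1} u \<partial>lborel) = ennreal (?G 1 - ?G 0)"
    proof (rule nn_integral_FTC_Icc)
      show "(\<lambda>u. binom_density N j u) \<in> borel_measurable borel" unfolding binom_density_def by measurable
      show "0 \<le> binom_density N j u" if "u \<in> {0..1}" for u using that by (simp add: binom_density_def)
      show "(?G has_real_derivative binom_density N j u) (at u)" for u
      proof -
        have jN: "j < Suc N" using j by simp
        from DERIV_cdivide[OF DERIV_minus[OF binom_density_sum_deriv[OF DERIV_ident jN]], of "real (Suc N)" u]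
        have "(?G has_real_derivative - (- real (Suc N - j) * (real (Suc N choose j) * u ^ j * (1 - u) ^ (Suc N - j - 1)) * 1) / real (Suc N)) (at u)" .
        moreover have "real (Suc N - j) * real (Suc N choose j) = real (Suc N) * real (N choose j)"
          by (simp only: of_nat_mult[symmetric] binomial_absorb_comp diff_Suc_1)
        moreover have "- (- a * (b * c * d) * 1) / e = (a * b) * (c * d) / e" for a b c d e :: real by simp
        ultimately have "(?G has_real_derivative real (Suc N) * real (N choose j) * (u ^ j * (1 - u) ^ (Suc N - j - 1)) / real (Suc N)) (at u)"
          by metis
        then show ?thesis
          by (simp add: binom_density_def mult.assoc)
      qed
    qed auto
    also have "(\<Sum>i\<le>j. binom_density (Suc N) i 0) = (\<Sum>i\<le>j. if i = 0 then 1 else 0)"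
      by (intro sum.cong) (auto simp: binom_density_def)
    also have "(\<Sum>i\<le>j. binom_density (Suc N) i 1) = (\<Sum>i\<le>j. 0)"
      using j by (intro sum.cong) (auto simp: binom_density_def)
    finally show ?thesis by simp
  qed
  have u: "measure uniform_law {..u} = (if u \<le> 1 then u else 1)" if "0 \<le> u" for u
  proof -
    have "measure uniform_law {..u} = measure lborel ({0<..<1} \<inter> {..u})"
      unfolding uniform_law_def by (subst measure_uniform_measure) auto
    also have "\<dots> = (if u \<le> 1 then u else 1)"
    proof (cases "u < 1")
      case True
      then have "{0<..<1} \<inter> {..u} = {0<..u}" by auto
      then show ?thesis using True that by simp
    next
      case False
      then have "{0<..<1} \<inter> {..u} = {0<..<1}" by auto
      then show ?thesis using False by simp
    qed
    finally show ?thesis .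
  qed
  \<comment> \<open>Beyond 1 the distribution function is 1, and the binomial term vanishes there
    because \<open>j < N\<close>.\<close>
  have "(\<integral>\<^sup>+u. ennreal (binom_density N j (measure uniform_law {..u})) * indicator {0..} u \<partial>lborel) =
      (\<integral>\<^sup>+u. ennreal (binom_density N j u) * indicator {0..1} u \<partial>lborel)"
    using j by (intro nn_integral_cong) (auto simp: u binom_density_def split: split_indicator)
  then show "(\<integral>\<^sup>+u. ennreal (binom_density N j (measure uniform_law {..u})) * indicator {0..} u \<partial>lborel) = ennreal (1 / real (Suc N))"
    unfolding FTC .
qed

context edge_law
begin

text \<open>The expected spacing between the j-th and the (j + 1)-st smallest of N variables, with 0
  as the value for \<open>j = 0\<close>.\<close>

definition mean_order_stat :: "nat \<Rightarrow> nat \<Rightarrow> real" where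
  "mean_order_stat N j = (if D = uniform_law then 1 / real (Suc N) else 1 / real (N - j))"

lemma kth_smallest_law_measurable:
  assumes "1 \<le> k" "k \<le> m"
  shows "(\<lambda>x. kth_smallest m x k) \<in> borel_measurable (PiM {..<m} (\<lambda>_. D))"
proof -
  have "sets (PiM {..<m} (\<lambda>_. D)) = sets (PiM {..<m} (\<lambda>_. borel))" by (intro sets_PiM_cong) auto
  from measurable_cong_sets[OF this refl, of borel] show ?thesis using kth_smallest_measurable[OF assms] by blast
qed

lemma AE_PiM_nonneg:
  assumes "finite I"
  shows "AE w in PiM I (\<lambda>_. D). \<forall>e\<in>I. 0 \<le> w e"
  using assms
  by (intro AE_ball_countable[THEN iffD2] ballI AE_PiM_component AE_D_nonneg)
    (auto intro: countable_finite prob_space_D)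

lemma expected_order_stat_eq:
  assumes k: "1 \<le> k" "k \<le> n - 1"
  shows "expected_order_stat D n k = (\<Sum>j<k. mean_order_stat (n - 1) j)"
proof -
  let ?P = "PiM {..<n - 1} (\<lambda>_. D)"
  have c: "(\<integral>\<^sup>+u. ennreal (binom_density (n - 1) j (measure D {..u})) * indicator {0..} u \<partial>lborel) =
      ennreal (mean_order_stat (n - 1) j)" if "j < k" for j
    using that k law nn_integral_binom_exponential[of j "n - 1"] nn_integral_binom_uniform[of j "n - 1"]
    by (auto simp: mean_order_stat_def)
  have nn: "(\<integral>\<^sup>+x. ennreal (kth_smallest (n - 1) x k) \<partial>?P) = ennreal (\<Sum>j<k. mean_order_stat (n - 1) j)"
  proof -
    have "(\<integral>\<^sup>+x. ennreal (kth_smallest (n - 1) x k) \<partial>?P) = (\<Sum>j<k. ennreal (mean_order_stat (n - 1) j))"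
      unfolding nn_integral_kth_smallest[OF k] by (intro sum.cong refl c) auto
    then show ?thesis by (simp add: mean_order_stat_def)
  qed
  have "AE x in ?P. 0 \<le> kth_smallest (n - 1) x k"
    using AE_PiM_nonneg[OF finite_lessThan]
  proof eventually_elim
    case (elim x)
    show ?case
    proof (rule ccontr)
      assume "\<not> ?thesis"
      then have neg: "kth_smallest (n - 1) x k < 0" by simp
      have "{i. i < n - 1 \<and> x i \<le> kth_smallest (n - 1) x k} = {}"
      proof (rule equals0I)
        fix i assume "i \<in> {i. i < n - 1 \<and> x i \<le> kth_smallest (n - 1) x k}"
        then have "0 \<le> x i" "x i \<le> kth_smallest (n - 1) x k" using elim by auto
        then show False using neg by linarith
      qed
      then have "card {i. i < n - 1 \<and> x i \<le> kth_smallest (n - 1) x k} = 0" by (simp only: card.empty)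
      moreover have "k \<le> card {i. i < n - 1 \<and> x i \<le> kth_smallest (n - 1) x k}"
        using kth_smallest_le_iff[OF k, of x "kth_smallest (n - 1) x k"] by blast
      ultimately show False using k by linarith
    qed
  qed
  then have "expected_order_stat D n k = enn2real (\<integral>\<^sup>+x. ennreal (kth_smallest (n - 1) x k) \<partial>?P)"
    unfolding expected_order_stat_def
    by (rule integral_eq_nn_integral[OF kth_smallest_law_measurable[OF k]])
  then show ?thesis unfolding nn by (simp add: sum_nonneg mean_order_stat_def)
qed

lemma integrable_square_D: "integrable D (\<lambda>x. x)" "integrable D (\<lambda>x. x\<^sup>2)" "(\<integral>x. x\<^sup>2 \<partial>D) \<le> 2"
proof -
  interpret prob_space D by (rule prob_space_D)
  have lt: "(\<integral>\<^sup>+x. ennreal (x\<^sup>2) \<partial>D) < \<infinity>" using nn_integral_D_square by (simp add: le_less_trans)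
  show i2: "integrable D (\<lambda>x. x\<^sup>2)"
    by (rule integrableI_nonneg) (use lt in auto)
  show "integrable D (\<lambda>x. x)"
  proof (rule Bochner_Integration.integrable_bound[of _ "\<lambda>x. 1 + x\<^sup>2"])
    show "integrable D (\<lambda>x. 1 + x\<^sup>2)" using i2 by simp
    have "\<bar>x\<bar> \<le> 1 + x\<^sup>2" for x :: real
      using sum_squares_bound[of "\<bar>x\<bar>" 1] by simp
    then show "AE x in D. norm x \<le> norm (1 + x\<^sup>2)" by auto
  qed simp
  have "ennreal (\<integral>x. x\<^sup>2 \<partial>D) = (\<integral>\<^sup>+x. ennreal (x\<^sup>2) \<partial>D)"
    using i2 by (intro nn_integral_eq_integral[symmetric]) auto
  also have "\<dots> \<le> ennreal 2" using nn_integral_D_square by simp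
  finally show "(\<integral>x. x\<^sup>2 \<partial>D) \<le> 2" using ennreal_le_iff[of 2 "\<integral>x. x\<^sup>2 \<partial>D"] by simp
qed

end

context instance_law
begin

text \<open>The edges at a vertex are an injective reindexing of n - 1 coordinates, so their joint
  law is the product law itself.\<close>

lemma order_stat_law:
  assumes v: "v < n" and k: "1 \<le> k" "k \<le> n - 1"
  shows "(\<lambda>w. order_stat n v w k) \<in> borel_measurable M"
    "(\<integral>w. order_stat n v w k \<partial>M) = expected_order_stat D n k"
proof -
  let ?f = "\<lambda>i. {v, nb v i}"
  let ?r = "\<lambda>w. \<lambda>i\<in>{..<n - 1}. w (?f i)"
  let ?P = "PiM {..<n - 1} (\<lambda>_. D)"
  have nb: "nb v i < n \<and> nb v i \<noteq> v" if "i < n - 1" for i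
    using bij_betwE[OF bij_betw_nb[OF v]] that by auto
  have inj: "inj_on ?f {..<n - 1}"
    using bij_betw_imp_inj_on[OF bij_betw_nb[OF v]] nb by (auto simp: inj_on_def doubleton_eq_iff)
  have into: "?f \<in> {..<n - 1} \<rightarrow> K_edges n" using nb v by (fastforce simp: K_edges_def card_insert_if)
  have d: "distr M ?P ?r = ?P"
    unfolding edge_weights_def
    using distr_PiM_reindex[OF _ inj into, of "\<lambda>_. D"] prob_space_D by auto
  have r: "?r \<in> measurable M ?P"
    unfolding edge_weights_def using into
    by (intro measurable_restrict measurable_component_singleton) auto
  have km: "(\<lambda>x. kth_smallest (n - 1) x k) \<in> borel_measurable ?P" by (rule kth_smallest_law_measurable[OF k])
  have eq: "order_stat n v w k = kth_smallest (n - 1) (?r w) k" for w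
    unfolding order_stat_def kth_smallest_def by (intro arg_cong2[where f = nth] arg_cong[where f = sort] map_cong) auto
  show "(\<lambda>w. order_stat n v w k) \<in> borel_measurable M"
    unfolding eq by (rule measurable_compose[OF r km])
  have "(\<integral>w. order_stat n v w k \<partial>M) = (\<integral>x. kth_smallest (n - 1) x k \<partial>distr M ?P ?r)"
    unfolding eq by (rule integral_distr[symmetric, OF r km])
  then show "(\<integral>w. order_stat n v w k \<partial>M) = expected_order_stat D n k"
    unfolding d expected_order_stat_def .
qed

section \<open>Crude bounds by the total weight\<close>

definition total :: "(nat set \<Rightarrow> real) \<Rightarrow> real" where
  "total w = (\<Sum>e\<in>K_edges n. w e)"

lemma nonneg_weights_iff: "nonneg_weights {..<n} w \<longleftrightarrow> (\<forall>e\<in>K_edges n. 0 \<le> w e)"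
  by (auto simp: nonneg_weights_def K_edges_def)

lemma AE_nonneg: "AE w in M. nonneg_weights {..<n} w"
  using AE_PiM_nonneg[OF finite_K_edges, of n] unfolding edge_weights_def nonneg_weights_iff .

lemma weight_le_total:
  assumes "nonneg_weights {..<n} w" "E \<subseteq> K_edges n"
  shows "(\<Sum>e\<in>E. w e) \<le> total w" "0 \<le> (\<Sum>e\<in>E. w e)"
  using assms unfolding total_def nonneg_weights_iff by (auto intro!: sum_mono2 sum_nonneg)

lemma order_stat_le_total:
  assumes "nonneg_weights {..<n} w" "v < n" "1 \<le> k" "k \<le> n - 1"
  shows "order_stat n v w k \<le> total w" "0 \<le> order_stat n v w k"
proof -
  have e: "{v, u} \<in> K_edges n" if "u < n" "u \<noteq> v" for u using that assms(2) by (auto simp: K_edges_def)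
  have "{u \<in> {..<n} - {v}. w {v, u} \<le> total w} = {..<n} - {v}"
    using weight_le_total(1)[OF assms(1), of "{_}"] e by auto
  then show "order_stat n v w k \<le> total w" using order_stat_le_iff[OF assms(3,4,2)] assms by simp
  show "0 \<le> order_stat n v w k"
    by (rule order_stat_nonneg) (use assms e in \<open>auto simp: nonneg_weights_iff\<close>)
qed

lemma coord_integrable:
  assumes "e \<in> K_edges n"
  shows "integrable M (\<lambda>w. w e)" "integrable M (\<lambda>w. (w e)\<^sup>2)" "(\<integral>w. (w e)\<^sup>2 \<partial>M) \<le> 2"
proof -
  have m: "(\<lambda>w. w e) \<in> measurable M D" unfolding edge_weights_def using assms by simp
  have d: "distr M D (\<lambda>w. w e) = D"
    unfolding edge_weights_def
    by (rule distr_PiM_component) (use assms prob_space_D in auto)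
  show "integrable M (\<lambda>w. w e)" "integrable M (\<lambda>w. (w e)\<^sup>2)"
    using integrable_distr[OF m, of "\<lambda>x. x"] integrable_distr[OF m, of "\<lambda>x. x\<^sup>2"] integrable_square_D by (simp_all add: d)
  have "(\<integral>w. (w e)\<^sup>2 \<partial>M) = (\<integral>x. x\<^sup>2 \<partial>distr M D (\<lambda>w. w e))"
    by (rule integral_distr[OF m, symmetric]) simp
  then show "(\<integral>w. (w e)\<^sup>2 \<partial>M) \<le> 2" unfolding d using integrable_square_D(3) by simp
qed

lemma integrable_total: "integrable M total"
  unfolding total_def[abs_def] by (intro Bochner_Integration.integrable_sum coord_integrable)

text \<open>Per edge, w * 1_B is at most (\<delta> * w^2 + 1_B / \<delta>) / 2, and second moments
  are at most 2. Taking \<delta> near the square root of the probability of \<open>B\<close>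
  recovers the order of the Cauchy-Schwarz bound.\<close>

lemma total_bad_le:
  assumes B: "B \<in> sets M" and \<delta>: "0 < \<delta>"
  shows "integrable M (\<lambda>w. total w * indicator B w)"
    "(\<integral>w. total w * indicator B w \<partial>M) \<le> (real n)\<^sup>2 * (\<delta> + measure M B / \<delta>)"
proof -
  interpret prob_space M by (rule prob_space_edge_weights)
  show i: "integrable M (\<lambda>w. total w * indicator B w)"
    by (rule integrable_real_mult_indicator[OF B integrable_total])
  let ?g = "\<lambda>w. \<Sum>e\<in>K_edges n. (\<delta> * (w e)\<^sup>2 + indicator B w / \<delta>) / 2"
  have ig: "integrable M (\<lambda>w. (\<delta> * (w e)\<^sup>2 + indicator B w / \<delta>) / 2)" if "e \<in> K_edges n" for e
    using coord_integrable[OF that] B by (intro integrable_divide Bochner_Integration.integrable_add integrable_mult_right) (auto simp: emeasure_eq_measure)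
  have "(\<integral>w. total w * indicator B w \<partial>M) \<le> (\<integral>w. ?g w \<partial>M)"
  proof (rule integral_mono[OF i])
    show "integrable M ?g" using ig by (intro Bochner_Integration.integrable_sum)
    fix w
    show "total w * indicator B w \<le> ?g w"
      unfolding total_def sum_distrib_right
    proof (rule sum_mono)
      fix e
      have "2 * (\<delta> * w e) \<le> (\<delta> * w e)\<^sup>2 + 1" using sum_squares_bound[of "\<delta> * w e" 1] by simp
      then have "\<delta> * (2 * w e) \<le> \<delta> * (\<delta> * (w e)\<^sup>2 + 1 / \<delta>)"
        using \<delta> by (simp add: power2_eq_square algebra_simps)
      then have "2 * w e \<le> \<delta> * (w e)\<^sup>2 + 1 / \<delta>" using \<delta> by (simp only: mult_le_cancel_left_pos)
      then show "w e * indicator B w \<le> (\<delta> * (w e)\<^sup>2 + indicator B w / \<delta>) / 2"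
        using \<delta> by (auto split: split_indicator)
    qed
  qed
  also have "(\<integral>w. ?g w \<partial>M) = (\<Sum>e\<in>K_edges n. (\<integral>w. (\<delta> * (w e)\<^sup>2 + indicator B w / \<delta>) / 2 \<partial>M))"
    by (rule Bochner_Integration.integral_sum) (rule ig)
  also have "\<dots> \<le> (\<Sum>e\<in>K_edges n. \<delta> + measure M B / \<delta>)"
  proof (rule sum_mono)
    fix e assume e: "e \<in> K_edges n"
    have "(\<integral>w. (\<delta> * (w e)\<^sup>2 + indicator B w / \<delta>) / 2 \<partial>M) = (\<delta> * (\<integral>w. (w e)\<^sup>2 \<partial>M) + measure M B / \<delta>) / 2"
      using coord_integrable[OF e] B by (simp add: emeasure_eq_measure)
    also have "\<dots> \<le> \<delta> + measure M B / \<delta>"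
    proof -
      have "\<delta> * (\<integral>w. (w e)\<^sup>2 \<partial>M) \<le> \<delta> * 2" using coord_integrable(3)[OF e] \<delta> by (intro mult_left_mono) auto
      moreover define q where "q = measure M B / \<delta>"
      moreover have "0 \<le> q" using \<delta> by (simp add: q_def)
      ultimately show ?thesis unfolding q_def[symmetric] by simp
    qed
    finally show "(\<integral>w. (\<delta> * (w e)\<^sup>2 + indicator B w / \<delta>) / 2 \<partial>M) \<le> \<delta> + measure M B / \<delta>" .
  qed
  also have "\<dots> = real (card (K_edges n)) * (\<delta> + measure M B / \<delta>)" by simp
  also have "\<dots> \<le> (real n)\<^sup>2 * (\<delta> + measure M B / \<delta>)"
  proof (rule mult_right_mono)
    have "K_edges n \<subseteq> (\<lambda>(u, v). {u, v}) ` ({..<n} \<times> {..<n})"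
      by (force simp: K_edges_def card_2_iff image_iff)
    then have "card (K_edges n) \<le> card ({..<n} \<times> {..<n})"
      by (meson card_image_le card_mono finite_SigmaI finite_imageI finite_lessThan le_trans)
    then have "real (card (K_edges n)) \<le> real (n * n)" by (simp only: card_cartesian_product card_lessThan of_nat_le_iff)
    then show "real (card (K_edges n)) \<le> (real n)\<^sup>2" by (simp add: power2_eq_square)
  qed (use \<delta> in simp)
  finally show "(\<integral>w. total w * indicator B w \<partial>M) \<le> (real n)\<^sup>2 * (\<delta> + measure M B / \<delta>)" .
qed

subsection \<open>Measurability of the process\<close>

lemma path_cost_measurable_M:
  assumes "p \<in> st_paths n s t"
  shows "(\<lambda>w. path_cost w p) \<in> borel_measurable M"
proof -
  have sub: "path_edges p \<subseteq> K_edges n" by (rule path_edges_in_K_edges) (use assms in \<open>auto simp: st_paths_def\<close>)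
  have "(\<lambda>w. w e) \<in> borel_measurable M" if "e \<in> K_edges n" for e
    using borel_measurable_integrable[OF coord_integrable(1)[OF that]] .
  then show ?thesis unfolding path_cost_def using sub by (intro borel_measurable_sum) auto
qed

lemma measurable_finite_set_valued:
  assumes fin: "finite S" and sub: "\<And>w. F w \<subseteq> S" and pt: "\<And>p. p \<in> S \<Longrightarrow> {w \<in> space N. p \<in> F w} \<in> sets N"
  shows "F \<in> measurable N (count_space UNIV)"
proof (rule measurableI)
  fix \<A>
  have *: "{w \<in> space N. F w = T} \<in> sets N" if "T \<subseteq> S" for T
  proof -
    have "{w \<in> space N. F w = T} =
        space N \<inter> (\<Inter>p\<in>S. if p \<in> T then {w \<in> space N. p \<in> F w} else space N - {w \<in> space N. p \<in> F w})"
    proof -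
      have e: "F w = T \<longleftrightarrow> (\<forall>p\<in>S. p \<in> F w \<longleftrightarrow> p \<in> T)" for w using that sub[of w] by blast
      show ?thesis unfolding e by (auto split: if_splits)
    qed
    also have "\<dots> \<in> sets N"
    proof (cases "S = {}")
      case False
      then show ?thesis using fin pt by (intro sets.Int sets.finite_INT) auto
    qed simp
    finally show ?thesis .
  qed
  have "F -` \<A> \<inter> space N = (\<Union>T\<in>\<A> \<inter> Pow S. {w \<in> space N. F w = T})" using sub by auto
  also have "\<dots> \<in> sets N" using fin * by (intro sets.finite_UN) auto
  finally show "F -` \<A> \<inter> space N \<in> sets N" .
qed simp

text \<open>The chosen path depends on the weights only through the set of minimisers. That set
  takes finitely many values, so measurability holds whatever choice breaks the ties.\<close>

lemma succ_path_measurable: "(\<lambda>w. succ_path n s t w k) \<in> measurable M (count_space UNIV)"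
proof (induction k rule: less_induct)
  case (less k)
  define C where "C w = {p \<in> st_paths n s t. \<forall>j\<in>{1..<k}. \<exists>q. succ_path n s t w j = Some q \<and>
                 path_edges p \<inter> path_edges q = {}}" for w
  define m where "m w = {p \<in> C w. \<forall>q\<in>C w. path_cost w p \<le> path_cost w q}" for w
  have Csub: "C w \<subseteq> st_paths n s t" for w by (auto simp: C_def)
  have Cm: "{w \<in> space M. p \<in> C w} \<in> sets M" if p: "p \<in> st_paths n s t" for p
  proof -
    have "{w \<in> space M. p \<in> C w} = space M \<inter> (\<Inter>j\<in>{1..<k}. (\<lambda>w. succ_path n s t w j) -` {Some q |q. path_edges p \<inter> path_edges q = {}} \<inter> space M)"
      using p by (auto simp: C_def)
    also have "\<dots> \<in> sets M"
    proof (cases "{1..<k} = {}")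
      case False
      have h: "(\<lambda>w. succ_path n s t w j) -` Q \<inter> space M \<in> sets M" if "j \<in> {1..<k}" for j Q
        by (rule measurable_sets[OF less.IH]) (use that in auto)
      then show ?thesis using False by (intro sets.Int[OF sets.top] sets.finite_INT h) simp_all
    qed simp
    finally show ?thesis .
  qed
  have "m \<in> measurable M (count_space UNIV)"
  proof (rule measurable_finite_set_valued[OF finite_st_paths])
    show "m w \<subseteq> st_paths n s t" for w using Csub by (auto simp: m_def)
    fix p assume p: "p \<in> st_paths n s t"
    have "{w \<in> space M. p \<in> m w} = {w \<in> space M. p \<in> C w} \<inter>
        (\<Inter>q\<in>st_paths n s t. (space M - {w \<in> space M. q \<in> C w}) \<union> {w \<in> space M. path_cost w p \<le> path_cost w q})"
      using Csub p by (auto simp: m_def)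
    also have "\<dots> \<in> sets M"
    proof (intro sets.Int sets.finite_INT finite_st_paths sets.Un sets.Diff Cm p sets.top)
      fix q assume q: "q \<in> st_paths n s t"
      show "{w \<in> space M. path_cost w p \<le> path_cost w q} \<in> sets M"
        using path_cost_measurable_M[OF p] path_cost_measurable_M[OF q] by measurable
    qed (use p in auto)
    finally show "{w \<in> space M. p \<in> m w} \<in> sets M" .
  qed
  moreover have "succ_path n s t w k = (if m w = {} then None else Some (SOME p. p \<in> m w))" for w
  proof -
    have "m w = {} \<longleftrightarrow> C w = {}"
      using arg_min_in_finite[OF finite_subset[OF Csub finite_st_paths], of w "path_cost w"] by (auto simp: m_def)
    \<comment> \<open>Unfolding \<open>arg_min\<close> exhibits the choice as a function of the set
      of minimisers alone.\<close>
    moreover have "arg_min (path_cost w) (\<lambda>p. p \<in> C w) = (SOME p. p \<in> m w)"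
      unfolding arg_min_def m_def is_arg_min_linorder by (intro arg_cong[where f = Eps]) auto
    moreover have "succ_path n s t w k = (let C = C w in if C = {} then None else Some (arg_min (path_cost w) (\<lambda>p. p \<in> C)))"
      unfolding C_def by (rule succ_path.simps)
    ultimately show ?thesis by (simp add: Let_def)

  qed
  ultimately show ?case
    using measurable_compose[of m M "count_space UNIV" "\<lambda>S. if S = {} then None else Some (SOME p. p \<in> S)" "count_space UNIV"] by simp
qed

lemma exists_sets: "{w \<in> space M. succ_path_exists n s t w k} \<in> sets M"
proof -
  have "{w \<in> space M. succ_path_exists n s t w k} = (\<lambda>w. succ_path n s t w k) -` (- {None}) \<inter> space M"
    by (auto simp: succ_path_exists_def)
  then show ?thesis using measurable_sets[OF succ_path_measurable, of "- {None}"] by simp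
qed

text \<open>Setting the cost to 0 where the path does not exist gives an integrable function whose
  integral is the numerator of the conditional expectation.\<close>

definition cost_on :: "nat \<Rightarrow> (nat set \<Rightarrow> real) \<Rightarrow> real" where
  "cost_on k w = indicator {w \<in> space M. succ_path_exists n s t w k} w * succ_cost n s t w k"

lemma cost_on_measurable: "cost_on k \<in> borel_measurable M"
proof -
  let ?S = "\<lambda>p. (\<lambda>w. succ_path n s t w k) -` {Some p} \<inter> space M"
  have eq: "cost_on k w = (\<Sum>p\<in>st_paths n s t. indicator (?S p) w * path_cost w p)" if "w \<in> space M" for w
  proof (cases "succ_path n s t w k")
    case None
    then show ?thesis by (simp add: cost_on_def succ_path_exists_def)
  next
    case (Some q)
    have "q \<in> st_paths n s t" using succ_path_minimal(1)[of n s t w k] Some by (simp add: succ_path_exists_def)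
    moreover have "(\<Sum>p\<in>st_paths n s t. indicator (?S p) w * path_cost w p) = (\<Sum>p\<in>st_paths n s t. if p = q then path_cost w p else 0)"
      using Some that by (intro sum.cong) auto
    ultimately show ?thesis
      using Some that finite_st_paths by (simp add: cost_on_def succ_path_exists_def succ_cost_def)
  qed
  have "(\<lambda>w. \<Sum>p\<in>st_paths n s t. indicator (?S p) w * path_cost w p) \<in> borel_measurable M"
    using path_cost_measurable_M measurable_sets[OF succ_path_measurable]
    by (intro borel_measurable_sum borel_measurable_times borel_measurable_indicator) auto
  then show ?thesis by (subst measurable_cong[OF eq]) auto
qed

lemma cost_on_le_total:
  assumes "nonneg_weights {..<n} w"
  shows "0 \<le> cost_on k w" "cost_on k w \<le> total w"
proof -
  have "0 \<le> cost_on k w \<and> cost_on k w \<le> total w"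
  proof (cases "succ_path_exists n s t w k")
    case True
    then have p: "the (succ_path n s t w k) \<in> st_paths n s t" by (rule succ_path_minimal(1))
    have sub: "path_edges (the (succ_path n s t w k)) \<subseteq> K_edges n"
      by (rule path_edges_in_K_edges) (use p in \<open>auto simp: st_paths_def\<close>)
    show ?thesis
      using weight_le_total[OF assms sub] weight_le_total[OF assms, of "{}"]
      by (auto simp: cost_on_def succ_cost_def path_cost_def split: split_indicator)
  next
    case False
    then show ?thesis using weight_le_total(1)[OF assms, of "{}"] by (simp add: cost_on_def)
  qed
  then show "0 \<le> cost_on k w" "cost_on k w \<le> total w" by auto
qed

lemma integrable_cost_on: "integrable M (cost_on k)"
proof (rule Bochner_Integration.integrable_bound[OF integrable_total cost_on_measurable])
  show "AE w in M. norm (cost_on k w) \<le> norm (total w)"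
    using AE_nonneg
  proof eventually_elim
    case (elim w)
    then show ?case using cost_on_le_total[OF elim, of k] by simp
  qed
qed

lemma integrable_order_stat:
  assumes "v < n" "1 \<le> k" "k \<le> n - 1"
  shows "integrable M (\<lambda>w. order_stat n v w k)"
proof (rule Bochner_Integration.integrable_bound[OF integrable_total order_stat_law(1)[OF assms]])
  show "AE w in M. norm (order_stat n v w k) \<le> norm (total w)"
    using AE_nonneg
  proof eventually_elim
    case (elim w)
    then show ?case using order_stat_le_total[OF elim assms] by simp
  qed
qed

lemma cond_expectation_eq:
  "cond_expectation M (\<lambda>w. succ_cost n s t w k) (\<lambda>w. succ_path_exists n s t w k) =
     (\<integral>w. cost_on k w \<partial>M) / measure M {w \<in> space M. succ_path_exists n s t w k}"
  unfolding cond_expectation_def set_lebesgue_integral_def cost_on_def by simp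

abbreviation "ends_stat j w \<equiv> order_stat n s w j + order_stat n t w j"

text \<open>Outside \<open>B\<^sub>1\<close> the cost is controlled by the order statistics, and outside the much less likely
  event \<open>B\<^sub>2\<close> it is at least bounded by \<open>c\<close>.\<close>

lemma expectation_sandwich:
  fixes u l c :: real
  assumes k: "1 \<le> k" "k \<le> n - 1" and j: "1 \<le> j" "j \<le> n - 1" and B: "B\<^sub>1 \<in> sets M" "B\<^sub>2 \<in> sets M"
    and good: "\<And>w. w \<in> space M - B\<^sub>1 \<Longrightarrow> nonneg_weights {..<n} w \<Longrightarrow> succ_path_exists n s t w k \<and>
       succ_cost n s t w k \<le> ends_stat k w + u \<and> ends_stat j w + l \<le> succ_cost n s t w k"
    and fair: "\<And>w. w \<in> space M - B\<^sub>2 \<Longrightarrow> w \<in> B\<^sub>1 \<Longrightarrow> nonneg_weights {..<n} w \<Longrightarrow>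
       (succ_path_exists n s t w k \<longrightarrow> succ_cost n s t w k \<le> c) \<and> ends_stat j w \<le> c"
    and c: "0 \<le> c" "0 \<le> u" and \<delta>: "0 < \<delta>"
  shows "(\<integral>w. cost_on k w \<partial>M) \<le> 2 * expected_order_stat D n k + u + c * measure M B\<^sub>1 +
      (real n)\<^sup>2 * (\<delta> + measure M B\<^sub>2 / \<delta>)" (is ?upper)
    and "2 * expected_order_stat D n j + l - (c + l) * measure M B\<^sub>1 - 2 * ((real n)\<^sup>2 * (\<delta> + measure M B\<^sub>2 / \<delta>)) \<le>
      (\<integral>w. cost_on k w \<partial>M)" (is ?lower)
    and "1 - measure M B\<^sub>1 \<le> measure M {w \<in> space M. succ_path_exists n s t w k}"
proof -
  interpret prob_space M by (rule prob_space_edge_weights)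
  note tb = total_bad_le[OF B(2) \<delta>]
  have iB: "integrable M (\<lambda>w. indicator B\<^sub>1 w :: real)" using B by (simp add: emeasure_eq_measure)
  have iT: "integrable M (ends_stat i)" "(\<integral>w. ends_stat i w \<partial>M) = 2 * expected_order_stat D n i"
    if "1 \<le> i" "i \<le> n - 1" for i
    using integrable_order_stat[OF s_less that] integrable_order_stat[OF t_less that]
      order_stat_law(2)[OF s_less that] order_stat_law(2)[OF t_less that] by auto
  have up: "AE w in M. cost_on k w \<le> ends_stat k w + u + c * indicator B\<^sub>1 w + total w * indicator B\<^sub>2 w"
    using AE_nonneg AE_space
  proof eventually_elim
    case (elim w)
    note nn = order_stat_le_total[OF elim(1) s_less k] order_stat_le_total[OF elim(1) t_less k] cost_on_le_total[OF elim(1), of k]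
    consider "w \<notin> B\<^sub>1" | "w \<in> B\<^sub>1" "w \<notin> B\<^sub>2" | "w \<in> B\<^sub>1" "w \<in> B\<^sub>2" by blast
    then show ?case
    proof cases
      case 1
      have "0 \<le> total w" using nn by linarith
      then have "0 \<le> total w * indicator B\<^sub>2 w" by simp
      then show ?thesis using good[of w] 1 elim by (auto simp: cost_on_def)
    next
      case 2
      have "cost_on k w \<le> c" using fair[of w] 2 elim c by (auto simp: cost_on_def split: split_indicator)
      then show ?thesis using 2 nn c by simp
    next
      case 3
      then show ?thesis using nn c by simp
    qed
  qed
  have "(\<integral>w. cost_on k w \<partial>M) \<le> (\<integral>w. ends_stat k w + u + c * indicator B\<^sub>1 w + total w * indicator B\<^sub>2 w \<partial>M)"
    by (rule integral_mono_AE[OF integrable_cost_on _ up])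
      (intro Bochner_Integration.integrable_add integrable_mult_right integrable_const iT k iB tb)
  also have "\<dots> = 2 * expected_order_stat D n k + u + c * measure M B\<^sub>1 + (\<integral>w. total w * indicator B\<^sub>2 w \<partial>M)"
    using iT[OF k] iB tb(1) B by (simp add: prob_space)
  also have "\<dots> \<le> 2 * expected_order_stat D n k + u + c * measure M B\<^sub>1 + (real n)\<^sup>2 * (\<delta> + measure M B\<^sub>2 / \<delta>)"
    using tb(2) by simp
  finally show ?upper .
  have low: "AE w in M. ends_stat j w + l - (c + l) * indicator B\<^sub>1 w - 2 * (total w * indicator B\<^sub>2 w) \<le> cost_on k w"
    using AE_nonneg AE_space
  proof eventually_elim
    case (elim w)
    note nn = order_stat_le_total[OF elim(1) s_less j] order_stat_le_total[OF elim(1) t_less j] cost_on_le_total[OF elim(1), of k]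
    consider "w \<notin> B\<^sub>1" | "w \<in> B\<^sub>1" "w \<notin> B\<^sub>2" | "w \<in> B\<^sub>1" "w \<in> B\<^sub>2" by blast
    then show ?case
    proof cases
      case 1
      have "0 \<le> total w" using nn by linarith
      then have "0 \<le> total w * indicator B\<^sub>2 w" by simp
      then show ?thesis using good[of w] 1 elim by (auto simp: cost_on_def)
    next
      case 2
      then show ?thesis using fair[of w] elim nn c by simp
    next
      case 3
      then show ?thesis using nn c by simp
    qed
  qed
  have "2 * expected_order_stat D n j + l - (c + l) * measure M B\<^sub>1 - 2 * ((real n)\<^sup>2 * (\<delta> + measure M B\<^sub>2 / \<delta>)) \<le>
      2 * expected_order_stat D n j + l - (c + l) * measure M B\<^sub>1 - 2 * (\<integral>w. total w * indicator B\<^sub>2 w \<partial>M)"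
    using tb(2) by simp
  also have "\<dots> = (\<integral>w. ends_stat j w + l - (c + l) * indicator B\<^sub>1 w - 2 * (total w * indicator B\<^sub>2 w) \<partial>M)"
    using iT[OF j] iB tb(1) B by (simp add: prob_space)
  also have "\<dots> \<le> (\<integral>w. cost_on k w \<partial>M)"
    by (rule integral_mono_AE[OF _ integrable_cost_on low])
      (intro Bochner_Integration.integrable_diff Bochner_Integration.integrable_add integrable_mult_right integrable_const iT j iB tb)
  finally show ?lower .
  have "1 - measure M B\<^sub>1 = measure M (space M - B\<^sub>1)" using prob_compl[OF B(1)] by simp
  also have "\<dots> \<le> measure M {w \<in> space M. succ_path_exists n s t w k}"
  proof (rule finite_measure_mono_AE[OF _ exists_sets])
    show "AE w in M. w \<in> space M - B\<^sub>1 \<longrightarrow> w \<in> {w \<in> space M. succ_path_exists n s t w k}"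
      using AE_nonneg by eventually_elim (use good in auto)
  qed
  finally show "1 - measure M B\<^sub>1 \<le> measure M {w \<in> space M. succ_path_exists n s t w k}" .
qed

end

subsection \<open>Good events\<close>

text \<open>The window at a vertex must be large enough for the load \<open>m\<close> there, but
  only finitely many windows can be controlled; hence a dyadic multiple of \<sigma>, chosen minimal.
  The bound with m / 8 feeds the self-improving load estimate, the one with \<open>sqrt L\<close>
  gives the final error \<open>\<zeta>\<close>.\<close>

lemma grid_scale:
  fixes L m \<sigma> :: real and n k :: nat
  assumes L: "1000000 \<le> L" and k: "L ^ 7 \<le> real k" "k \<le> n" and \<sigma>: "\<sigma> = real k / (real n * L)"
    and m: "0 \<le> m" "m \<le> 16 * \<sigma> * real k"
  obtains i where "i \<le> n" "2 ^ i * \<sigma> \<le> 1/2" "m \<le> real n * (2 ^ i * \<sigma>)\<^sup>2 / 100"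
    "2 ^ i * \<sigma> \<le> 2 * \<sigma> + m / 8" "2 ^ i * \<sigma> \<le> \<sigma> + 80 * (real k / (real n * sqrt L))" "\<sigma> \<le> 2 ^ i * \<sigma>"
proof -
  have L1: "1 \<le> L" using L by simp
  have "L ^ 2 \<le> L ^ 7" using L1 by (intro power_increasing) auto
  then have kL2: "L * L \<le> real k" using k by (simp add: power2_eq_square)
  then have kL: "800 * L \<le> real k" using L mult_right_mono[of 800 L L] by linarith
  have k0: "0 < real k" and n0: "0 < real n" using kL L1 k(2) by (auto intro: less_le_trans[of 0 k])
  have \<sigma>0: "0 < \<sigma>" unfolding \<sigma> using k0 n0 L1 by simp
  have kn: "real k / real n \<le> 1" using k n0 by simp
  have \<sigma>1: "\<sigma> \<le> 1 / L" unfolding \<sigma> using divide_right_mono[OF kn, of L] L1 by simp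
  have invL: "1 / L \<le> 1 / 1000000" using L by (intro divide_left_mono) auto
  have \<sigma>n: "800 / real n \<le> \<sigma>" unfolding \<sigma> using kL n0 L1 by (simp add: field_simps)
  define P where "P i \<longleftrightarrow> m \<le> real n * (2 ^ i * \<sigma>)\<^sup>2 / 100" for i
  have "\<exists>i. P i"
  proof -
    obtain i where i: "m * 100 / (real n * \<sigma>\<^sup>2) < (2::real) ^ i" using real_arch_pow[of 2] by auto
    have "(2::real) ^ i \<le> (2 ^ i)\<^sup>2" by (simp add: power2_eq_square)
    with i have "m * 100 / (real n * \<sigma>\<^sup>2) < (2 ^ i)\<^sup>2" by linarith
    then have "m * 100 < (2 ^ i)\<^sup>2 * (real n * \<sigma>\<^sup>2)" using n0 \<sigma>0 by (simp add: pos_divide_less_eq)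
    then have "P i" unfolding P_def power_mult_distrib by (simp add: mult_ac)
    then show ?thesis ..
  qed
  then have Pi: "P (LEAST i. P i)" by (rule LeastI_ex)
  define i where "i = (LEAST i. P i)"
  define \<theta> where "\<theta> = 2 ^ i * \<sigma>"
  have sq: "1000 \<le> sqrt L" using L by (intro real_le_rsqrt) simp
  have \<theta>0: "0 < \<theta>" using \<sigma>0 by (simp add: \<theta>_def)
  have main: "\<theta> \<le> 2 * \<sigma> + m / 8 \<and> \<theta> \<le> \<sigma> + 80 * (real k / (real n * sqrt L))"
  proof (cases i)
    case 0
    then show ?thesis using \<sigma>0 m k0 n0 L1 by (simp add: \<theta>_def)
  next
    case (Suc l)
    then have "\<not> P l" unfolding i_def by (metis lessI not_less_Least)
    then have "real n * (2 ^ l * \<sigma>)\<^sup>2 / 100 < m" by (simp add: P_def)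
    moreover have "\<theta> = 2 * (2 ^ l * \<sigma>)" using Suc by (simp add: \<theta>_def)
    then have "\<theta>\<^sup>2 = 4 * (2 ^ l * \<sigma>)\<^sup>2" by (simp add: power_mult_distrib)
    ultimately have lt: "real n * \<theta>\<^sup>2 < 400 * m" by simp
    \<comment> \<open>Minimality gives n * \<theta>^2 < 400 * m. This linearises it: the first
      summand is below m / 8, and the second is at most \<sigma>.\<close>
    have amgm: "\<theta> \<le> real n * \<theta>\<^sup>2 / 3200 + 800 / real n"
    proof -
      have "0 \<le> (real n * \<theta> - 1600)\<^sup>2" by simp
      then have "3200 * (real n * \<theta>) \<le> real n * (real n * \<theta>\<^sup>2) + 2560000"
        by (simp add: power2_eq_square algebra_simps)
      then have "real n * \<theta> \<le> real n * (real n * \<theta>\<^sup>2 / 3200 + 800 / real n)"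
        using n0 by (simp add: distrib_left)
      then show ?thesis using n0 by (simp only: mult_le_cancel_left_pos)
    qed
    have 1: "\<theta> \<le> 2 * \<sigma> + m / 8" using amgm lt \<sigma>n \<sigma>0 by linarith
    \<comment> \<open>Now the total allowance 16 * \<sigma> * k is inserted for \<open>m\<close>;
      \<sigma> * k is n times the square of k / (n * sqrt L).\<close>
    have "real n * \<theta>\<^sup>2 < 6400 * (\<sigma> * real k)" using lt m by linarith
    also have "\<sigma> * real k = real n * (real k / (real n * sqrt L))\<^sup>2"
      unfolding \<sigma> using n0 L1 by (simp add: power_divide power_mult_distrib power2_eq_square)
    also have "6400 * (real n * (real k / (real n * sqrt L))\<^sup>2) = real n * (80 * (real k / (real n * sqrt L)))\<^sup>2"
    proof -
      have "(80 * a)\<^sup>2 = 6400 * a\<^sup>2" for a :: real by (simp add: power2_eq_square)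
      then show ?thesis by (simp only: mult.left_commute)
    qed
    finally have "real n * \<theta>\<^sup>2 < real n * (80 * (real k / (real n * sqrt L)))\<^sup>2" .
    then have "\<theta>\<^sup>2 < (80 * (real k / (real n * sqrt L)))\<^sup>2" using n0 by (simp only: mult_less_cancel_left_pos)
    moreover have "0 \<le> 80 * (real k / (real n * sqrt L))" using L1 by simp
    ultimately have "\<theta> < 80 * (real k / (real n * sqrt L))" by (rule power2_less_imp_less)
    then show ?thesis using 1 \<sigma>0 by linarith
  qed
  have "real k / (real n * sqrt L) \<le> 1 / sqrt L"
    using divide_right_mono[OF kn, of "sqrt L"] L1 by simp
  also have "\<dots> \<le> 1 / 1000" using sq L1 by (intro divide_left_mono) auto
  finally have half: "\<theta> \<le> 1/2" using main \<sigma>1 invL by linarith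
  have "i \<le> n"
  proof -
    have "2 ^ i * real k = \<theta> * (real n * L)" unfolding \<theta>_def \<sigma> using n0 L1 by simp
    also have "\<dots> \<le> 1 * (real n * L)" using half n0 L1 by (intro mult_right_mono) auto
    finally have "2 ^ i * real k \<le> real n * L" by simp
    moreover have "2 ^ i * L \<le> 2 ^ i * real k" using kL L1 by (intro mult_left_mono) auto
    ultimately have "2 ^ i \<le> real n" using L1 by (smt (verit) mult_right_le_imp_le)
    then have "2 ^ i < (2::real) ^ n" using of_nat_less_two_power[of n] by (smt (verit))
    then show ?thesis by simp
  qed
  moreover have "m \<le> real n * \<theta>\<^sup>2 / 100" using Pi unfolding P_def \<theta>_def i_def .
  moreover have "\<sigma> \<le> \<theta>" using \<sigma>0 by (simp add: \<theta>_def)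
  ultimately show ?thesis using that[of i] main half unfolding \<theta>_def by blast
qed

context instance_law
begin

lemma weighted_instanceI: "nonneg_weights {..<n} w \<Longrightarrow> weighted_instance n s t w"
  using s_less t_less s_neq_t by unfold_locales

text \<open>Three kinds of windows must expand: the small one for doubling, the dyadic grid for the
  first steps at the ends, and ln^8 n / n, which bounds the order statistics of small index.\<close>

definition big_bad :: "nat \<Rightarrow> (nat set \<Rightarrow> real) set" where
  "big_bad k = {w \<in> space M. \<not> expander n w (real k / (real n * ln (real n)) / ln (real n))} \<union>
     {w \<in> space M. \<not> expander n w (ln (real n) ^ 8 / real n)} \<union>
     (\<Union>i\<in>{i. i \<le> n \<and> 2 ^ i * (real k / (real n * ln (real n))) \<le> 1/2}.
        {w \<in> space M. \<not> expander n w (2 ^ i * (real k / (real n * ln (real n))))})"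

text \<open>Every window \<theta> involved has n * \<theta> at least ln^5 n; the smallest is k / (n
  * ln^2 n), and this is where the exponent 7 in the bound on k enters.\<close>

lemma big_bad_measure:
  assumes L: "1000000 \<le> ln (real n)" "ln (real n) ^ 8 / real n \<le> 1/2" and k: "ln (real n) ^ 7 \<le> real k" "k \<le> n"
  shows "big_bad k \<in> sets M" "measure M (big_bad k) \<le> (real n + 3) * (9 * exp (- (ln (real n) ^ 5) / 200))"
proof -
  interpret prob_space M by (rule prob_space_edge_weights)
  define \<Lambda> where "\<Lambda> = ln (real n)"
  define \<sigma> where "\<sigma> = real k / (real n * \<Lambda>)"
  define e where "e = 9 * exp (- (\<Lambda> ^ 5) / 200)"
  have L1: "1000000 \<le> \<Lambda>" "1 \<le> \<Lambda>" using L by (auto simp: \<Lambda>_def)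
  have n2: "2 \<le> n"
  proof (rule ccontr)
    assume "\<not> 2 \<le> n"
    then have "n = 0 \<or> n = 1" by auto
    then show False using L by auto
  qed
  have n0: "0 < real n" using n2 by simp
  have nk: "\<Lambda> ^ 5 \<le> real k / \<Lambda>\<^sup>2"
    using k(1) L1 by (simp add: \<Lambda>_def[symmetric] le_divide_eq power_add[symmetric])
  have L5: "400 * \<Lambda> \<le> \<Lambda> ^ 5"
  proof -
    have "\<Lambda> ^ 1 \<le> \<Lambda> ^ 4" using L1 by (intro power_increasing) auto
    then have "400 \<le> \<Lambda> ^ 4" using L1 by simp
    then have "400 * \<Lambda> \<le> \<Lambda> ^ 4 * \<Lambda>" using L1 by (intro mult_right_mono) auto
    then show ?thesis by (simp add: power_Suc2[symmetric] del: power_Suc)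
  qed
  have one: "{w \<in> space M. \<not> expander n w \<theta>} \<in> sets M \<and> measure M {w \<in> space M. \<not> expander n w \<theta>} \<le> e"
    if \<theta>: "0 < \<theta>" "\<theta> \<le> 1/2" "\<Lambda> ^ 5 \<le> real n * \<theta>" for \<theta>
  proof -
    have c: "400 * ln (real n) \<le> real n * \<theta>" using L5 \<theta> unfolding \<Lambda>_def by linarith
    have "9 * exp (- real n * \<theta> / 200) \<le> e" unfolding e_def using \<theta>(3) by simp
    then show ?thesis using measure_not_expander_le[OF n2 \<theta>(1,2) c] by linarith
  qed
  have \<tau>: "0 < \<sigma> / \<Lambda>" "\<sigma> / \<Lambda> \<le> 1/2" "\<Lambda> ^ 5 \<le> real n * (\<sigma> / \<Lambda>)"
  proof -
    have "0 < \<Lambda> ^ 7" using L1 by simp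
    then have k0: "0 < real k" using k(1) unfolding \<Lambda>_def by linarith
    show "0 < \<sigma> / \<Lambda>" using k0 n0 L1 by (simp add: \<sigma>_def)
    have "real n * (\<sigma> / \<Lambda>) = real k / \<Lambda>\<^sup>2" using n0 by (simp add: \<sigma>_def power2_eq_square)
    then show "\<Lambda> ^ 5 \<le> real n * (\<sigma> / \<Lambda>)" using nk by simp
    have "1 * 2 \<le> \<Lambda> * \<Lambda>" using L1 by (intro mult_mono) auto
    moreover have "real k \<le> real n" using k by simp
    ultimately have "real k * 2 \<le> real n * (\<Lambda> * \<Lambda>)" by (metis mult.left_neutral mult_mono of_nat_0_le_iff zero_le_numeral mult_1 order_trans mult_left_mono)
    then show "\<sigma> / \<Lambda> \<le> 1/2" using n0 L1 by (simp add: \<sigma>_def field_simps)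
  qed
  have x: "0 < \<Lambda> ^ 8 / real n" "\<Lambda> ^ 8 / real n \<le> 1/2" "\<Lambda> ^ 5 \<le> real n * (\<Lambda> ^ 8 / real n)"
    using L(2) L1 n0 power_increasing[of 5 8 \<Lambda>] unfolding \<Lambda>_def[symmetric] by auto
  let ?I = "{i. i \<le> n \<and> 2 ^ i * \<sigma> \<le> 1/2}"
  have fin: "finite ?I" by simp
  have g: "0 < 2 ^ i * \<sigma>" "2 ^ i * \<sigma> \<le> 1/2" "\<Lambda> ^ 5 \<le> real n * (2 ^ i * \<sigma>)" if "i \<in> ?I" for i
  proof -
    have s0: "0 < \<sigma>" using \<tau>(1) L1 by (simp add: zero_less_divide_iff)
    then show "0 < 2 ^ i * \<sigma>" by simp
    show "2 ^ i * \<sigma> \<le> 1/2" using that by simp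
    have "\<sigma> / \<Lambda> \<le> \<sigma>" using s0 L1 by (simp add: divide_le_eq mult_le_cancel_left1)
    also have "\<dots> \<le> 2 ^ i * \<sigma>" using s0 by simp
    finally have "real n * (\<sigma> / \<Lambda>) \<le> real n * (2 ^ i * \<sigma>)" by (intro mult_left_mono) auto
    then show "\<Lambda> ^ 5 \<le> real n * (2 ^ i * \<sigma>)" using \<tau>(3) by linarith
  qed
  have BE: "big_bad k = {w \<in> space M. \<not> expander n w (\<sigma> / \<Lambda>)} \<union> {w \<in> space M. \<not> expander n w (\<Lambda> ^ 8 / real n)} \<union>
     (\<Union>i\<in>?I. {w \<in> space M. \<not> expander n w (2 ^ i * \<sigma>)})" (is "_ = ?B1 \<union> ?B2 \<union> ?B3")
    unfolding big_bad_def \<sigma>_def \<Lambda>_def ..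
  have B3: "?B3 \<in> sets M" using fin one[OF g] by (intro sets.finite_UN) auto
  have m3: "measure M ?B3 \<le> (real n + 1) * e"
  proof -
    have "measure M ?B3 \<le> (\<Sum>i\<in>?I. measure M {w \<in> space M. \<not> expander n w (2 ^ i * \<sigma>)})"
      using fin one[OF g] by (intro finite_measure_subadditive_finite) auto
    also have "\<dots> \<le> (\<Sum>i\<in>?I. e)" using one[OF g] by (intro sum_mono) auto
    also have "\<dots> \<le> (real n + 1) * e"
    proof -
      have "card ?I \<le> card {..n}" by (rule card_mono) auto
      then have "real (card ?I) \<le> real n + 1" by simp
      then show ?thesis by (simp add: e_def)
    qed
    finally show ?thesis .
  qed
  show "big_bad k \<in> sets M" unfolding BE using one[OF \<tau>] one[OF x] B3 by auto
  have "measure M (big_bad k) \<le> measure M (?B1 \<union> ?B2) + measure M ?B3"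
    unfolding BE using one[OF \<tau>] one[OF x] B3 by (intro measure_Un_le) auto
  also have "measure M (?B1 \<union> ?B2) \<le> measure M ?B1 + measure M ?B2"
    using one[OF \<tau>] one[OF x] by (intro measure_Un_le) auto
  finally show "measure M (big_bad k) \<le> (real n + 3) * (9 * exp (- (ln (real n) ^ 5) / 200))"
    using one[OF \<tau>] one[OF x] m3 unfolding \<Lambda>_def[symmetric] e_def[symmetric] by (simp add: algebra_simps)
qed

text \<open>The three scales are \<sigma> = k / (n * ln n) for the ends, \<tau> = \<sigma> / ln n
  for the logarithmically many doublings, and the dyadic multiples of \<sigma>. All errors become
  small multiples of k / n, the order of the main term.\<close>

lemma large_good:
  assumes L: "1000000 \<le> ln (real n)" and k: "ln (real n) ^ 7 \<le> real k" "k \<le> n - 1"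
    and w: "w \<in> space M - big_bad k" "nonneg_weights {..<n} w"
  defines "\<zeta> \<equiv> real k / real n * (6 / ln (real n) + 160 / sqrt (ln (real n)))"
  shows "succ_path_exists n s t w k" "succ_cost n s t w k \<le> ends_stat k w + \<zeta>"
    "ends_stat (k - 1) w - 2 * \<zeta> \<le> succ_cost n s t w k"
    "\<And>j. 1 \<le> j \<Longrightarrow> j \<le> n - 1 \<Longrightarrow> real j \<le> ln (real n) ^ 8 / 50 \<Longrightarrow>
       order_stat n s w j \<le> ln (real n) ^ 8 / real n \<and> order_stat n t w j \<le> ln (real n) ^ 8 / real n"
proof -
  interpret W: weighted_instance n s t w by (rule weighted_instanceI[OF w(2)])
  define \<Lambda> where "\<Lambda> = ln (real n)"
  define \<sigma> where "\<sigma> = real k / (real n * \<Lambda>)"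
  define \<tau> where "\<tau> = \<sigma> / \<Lambda>"
  have L1: "1000000 \<le> \<Lambda>" "1 \<le> \<Lambda>" using L by (auto simp: \<Lambda>_def)
  have k7: "\<Lambda> ^ 7 \<le> real k" using k by (simp add: \<Lambda>_def)
  have kn: "k \<le> n" using k by simp
  have pw: "\<Lambda> ^ i * 1000000 ^ d \<le> \<Lambda> ^ (i + d)" for i d
  proof -
    have "1000000 ^ d \<le> \<Lambda> ^ d" using L1 by (intro power_mono) auto
    then have "\<Lambda> ^ i * 1000000 ^ d \<le> \<Lambda> ^ i * \<Lambda> ^ d" using L1 by (intro mult_left_mono) auto
    then show ?thesis by (simp add: power_add)
  qed
  have k5: "\<Lambda> ^ 5 * 1000000 \<le> real k" and k3: "\<Lambda> ^ 3 * 1000000 \<le> real k" and k2: "\<Lambda>\<^sup>2 * 1000000 \<le> real k"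
    and k10: "1000000 \<le> real k"
  proof -
    have "\<Lambda> ^ i * 1000000 \<le> real k" if "i < 7" for i
    proof -
      have "\<Lambda> ^ i * 1000000 \<le> \<Lambda> ^ (i + 1)" using pw[of i 1] by simp
      also have "\<dots> \<le> \<Lambda> ^ 7" using L1 that by (intro power_increasing) auto
      finally show ?thesis using k7 by linarith
    qed
    from this[of 5] this[of 3] this[of 2] this[of 0]
    show "\<Lambda> ^ 5 * 1000000 \<le> real k" "\<Lambda> ^ 3 * 1000000 \<le> real k" "\<Lambda>\<^sup>2 * 1000000 \<le> real k" "1000000 \<le> real k" by auto
  qed
  have k0: "0 < real k" using k10 by linarith
  have n0: "0 < real n" using k0 kn by linarith
  have n20: "20 \<le> n" using k10 kn by linarith
  have \<sigma>0: "0 < \<sigma>" and \<tau>0: "0 < \<tau>" using k0 n0 L1 by (auto simp: \<sigma>_def \<tau>_def)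
  have n\<sigma>: "real n * \<sigma> = real k / \<Lambda>" and n\<tau>: "real n * \<tau> = real k / \<Lambda>\<^sup>2"
    using n0 by (simp_all add: \<sigma>_def \<tau>_def power2_eq_square)
  have expt: "expander n w \<tau>" and expx: "expander n w (\<Lambda> ^ 8 / real n)"
    and expi: "\<And>i. i \<le> n \<Longrightarrow> 2 ^ i * \<sigma> \<le> 1/2 \<Longrightarrow> expander n w (2 ^ i * \<sigma>)"
    using w(1) unfolding big_bad_def \<tau>_def \<sigma>_def \<Lambda>_def by blast+
  \<comment> \<open>The size to be reached in the first step; with 500 the requirement 400 * u *
    \<Lambda> amounts to 4/5 of n * \<sigma> and leaves 1/5 for the additive constant.\<close>
  define u where "u = real k / (500 * \<Lambda>\<^sup>2)"
  have u0: "0 < u" using k0 L1 by (simp add: u_def)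
  have L2: "1 \<le> \<Lambda>\<^sup>2" using L1 by (simp add: one_le_power)
  have u4: "u + 2 \<le> 4 * real n / 5"
  proof -
    have "u \<le> real k / 500" unfolding u_def using L2 k0 by (intro divide_left_mono) auto
    also have "\<dots> \<le> real n / 500" using kn by simp
    finally show ?thesis using n20 by simp
  qed
  have u\<sigma>: "400 * (u + 2) * \<Lambda> \<le> real n * \<sigma>"
  proof -
    have "400 * (u + 2) * \<Lambda> = 4 / 5 * (real k / \<Lambda>) + 800 * \<Lambda>"
      using L1 by (simp add: u_def power2_eq_square field_simps)
    moreover have "800 * \<Lambda> \<le> 1 / 5 * (real k / \<Lambda>)"
      using k2 L1 by (simp add: le_divide_eq power2_eq_square)
    ultimately show ?thesis unfolding n\<sigma> by simp
  qed
  have n\<tau>L: "1600 * \<Lambda> \<le> real n * \<tau>"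
    unfolding n\<tau> using k3 L1 by (simp add: le_divide_eq power2_eq_square power3_eq_cube mult_ac)
  \<comment> \<open>The total load must fit the allowance of \<open>u\<close> vertices at window
    \<tau>. This needs k to be at least 800000 * \<Lambda>^5.\<close>
  have uM: "16 * \<sigma> * real k \<le> u * real n * \<tau>\<^sup>2 / 100"
  proof -
    have "u * real n * \<tau>\<^sup>2 = real k * (real k * real k) / (500 * \<Lambda> ^ 6 * real n)"
      using n0 L1 by (simp add: u_def \<tau>_def \<sigma>_def power2_eq_square field_simps eval_nat_numeral)
    moreover have "16 * \<sigma> * real k = 16 * (real k * real k) / (\<Lambda> * real n)"
      by (simp add: \<sigma>_def mult_ac)
    moreover have "16 * (real k * real k) / (\<Lambda> * real n) \<le> real k * (real k * real k) / (500 * \<Lambda> ^ 6 * real n) / 100"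
    proof -
      have "800000 * \<Lambda> ^ 5 \<le> real k" using k5 L1 by simp
      then have "(800000 * \<Lambda> ^ 5) * ((real k * real k) / (50000 * \<Lambda> ^ 6 * real n)) \<le> real k * ((real k * real k) / (50000 * \<Lambda> ^ 6 * real n))"
        using L1 n0 by (intro mult_right_mono) auto
      moreover have "(800000 * \<Lambda> ^ 5) * ((real k * real k) / (50000 * \<Lambda> ^ 6 * real n)) = 16 * (real k * real k) / (\<Lambda> * real n)"
        using L1 n0 by (simp add: field_simps eval_nat_numeral)
      ultimately show ?thesis by simp
    qed
    ultimately show ?thesis by simp
  qed
  \<comment> \<open>Since ln 2 is at least 2/3, this many doublings exceed n.\<close>
  define I where "I = nat \<lceil>3 / 2 * \<Lambda>\<rceil>"
  have I: "n \<le> 2 ^ I" "real I \<le> 3 / 2 * \<Lambda> + 1"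
  proof -
    have I1: "3 / 2 * \<Lambda> \<le> real I" unfolding I_def by linarith
    have "2 / 3 \<le> (ln 2 :: real)" by (rule ln2_ge_two_thirds)
    then have "(3 / 2 * \<Lambda>) * (2 / 3) \<le> real I * ln 2" using I1 L1 by (intro mult_mono) auto
    then have "ln (real n) \<le> ln (2 ^ I)" by (simp add: \<Lambda>_def ln_realpow)
    then have "real n \<le> 2 ^ I" using n0 by simp
    then have "real n \<le> real (2 ^ I)" by simp
    then show "n \<le> 2 ^ I" by (simp only: of_nat_le_iff)
    show "real I \<le> 3 / 2 * \<Lambda> + 1" unfolding I_def using L1 by linarith
  qed
  have I\<tau>: "2 * real I * \<tau> \<le> 4 * \<sigma>"
  proof -
    have "2 * real I * \<tau> \<le> 4 * \<Lambda> * \<tau>" using I(2) L1 \<tau>0 by (intro mult_right_mono) auto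
    also have "\<dots> = 4 * \<sigma>" using L1 by (simp add: \<tau>_def)
    finally show ?thesis .
  qed
  have conn: "\<exists>\<theta>\<^sub>x \<theta>\<^sub>y. conn W.A R w x y (\<theta>\<^sub>x + \<theta>\<^sub>y + 4 * \<sigma>) \<and> \<theta>\<^sub>x \<le> 2 * \<sigma> + W.load R {x} / 8 \<and> \<theta>\<^sub>y \<le> 2 * \<sigma> + W.load R {y} / 8
      \<and> \<theta>\<^sub>x \<le> \<sigma> + 80 * (real k / (real n * sqrt \<Lambda>)) \<and> \<theta>\<^sub>y \<le> \<sigma> + 80 * (real k / (real n * sqrt \<Lambda>))"
    if R: "finite R" "W.load R W.A \<le> 16 * \<sigma> * real k" and xy: "x \<in> W.A" "y \<in> W.A" for R x y
  proof -
    have lm: "0 \<le> W.load R {v}" "W.load R {v} \<le> 16 * \<sigma> * real k" if "v \<in> W.A" for v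
      using W.load_nonneg W.load_mono[OF R(1) order_refl, of "{v}" W.A] R(2) that by fastforce+
    obtain i where i: "i \<le> n" "2 ^ i * \<sigma> \<le> 1/2" "W.load R {x} \<le> real n * (2 ^ i * \<sigma>)\<^sup>2 / 100"
      "2 ^ i * \<sigma> \<le> 2 * \<sigma> + W.load R {x} / 8" "2 ^ i * \<sigma> \<le> \<sigma> + 80 * (real k / (real n * sqrt \<Lambda>))" "\<sigma> \<le> 2 ^ i * \<sigma>"
      using grid_scale[OF L1(1) k7 kn \<sigma>_def lm[OF xy(1)]] by blast
    obtain j where j: "j \<le> n" "2 ^ j * \<sigma> \<le> 1/2" "W.load R {y} \<le> real n * (2 ^ j * \<sigma>)\<^sup>2 / 100"
      "2 ^ j * \<sigma> \<le> 2 * \<sigma> + W.load R {y} / 8" "2 ^ j * \<sigma> \<le> \<sigma> + 80 * (real k / (real n * sqrt \<Lambda>))" "\<sigma> \<le> 2 ^ j * \<sigma>"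
      using grid_scale[OF L1(1) k7 kn \<sigma>_def lm[OF xy(2)]] by blast
    have "400 * (u + 2) * ln (real n) \<le> real n * (2 ^ i * \<sigma>)" "400 * (u + 2) * ln (real n) \<le> real n * (2 ^ j * \<sigma>)"
      using u\<sigma> mult_left_mono[OF i(6), of "real n"] mult_left_mono[OF j(6), of "real n"] unfolding \<Lambda>_def by linarith+
    then have "conn W.A R w x y (2 ^ i * \<sigma> + 2 ^ j * \<sigma> + 2 * real I * \<tau>)"
      using W.conn_expander[OF R(1) expt expi[OF i(1,2)] expi[OF j(1,2)] xy _ _ i(3) j(3) u0 u4 _ _ _ _ \<tau>0 n20 I(1)]
        \<sigma>0 order_trans[OF R(2) uM] n\<tau>L by (simp add: \<Lambda>_def)
    then have "conn W.A R w x y (2 ^ i * \<sigma> + 2 ^ j * \<sigma> + 4 * \<sigma>)"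
      by (rule conn_mono) (use I\<tau> in simp)
    then show ?thesis using i j by blast
  qed
  have local: "conn W.A R w x y (8 * \<sigma> + (W.load R {x} + W.load R {y}) / 8)"
    if a: "finite R" "W.load R W.A \<le> 16 * \<sigma> * real k" "x \<in> W.A" "y \<in> W.A" for R x y
  proof -
    obtain a b where "conn W.A R w x y (a + b + 4 * \<sigma>)" "a \<le> 2 * \<sigma> + W.load R {x} / 8" "b \<le> 2 * \<sigma> + W.load R {y} / 8"
      using conn[OF a] by blast
    then show ?thesis by (elim conn_mono) (simp add: add_divide_distrib)
  qed
  have glob: "conn W.A R w x y \<zeta>"
    if a: "finite R" "W.load R W.A \<le> 16 * \<sigma> * real k" "x \<in> W.A" "y \<in> W.A" for R x y
  proof -
    define q where "q = real k / (real n * sqrt \<Lambda>)"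
    obtain a b where ab: "conn W.A R w x y (a + b + 4 * \<sigma>)" "a \<le> \<sigma> + 80 * q" "b \<le> \<sigma> + 80 * q"
      using conn[OF a] unfolding q_def by blast
    have "\<zeta> = 6 * \<sigma> + 160 * q"
      by (simp add: \<zeta>_def \<sigma>_def \<Lambda>_def q_def distrib_left mult.commute)
    then show ?thesis using conn_mono[OF ab(1), of \<zeta>] ab(2,3) by linarith
  qed
  have \<zeta>0: "0 \<le> \<zeta>" using L by (simp add: \<zeta>_def)
  have k2: "2 \<le> k" using k10 by linarith
  have \<sigma>00: "0 \<le> \<sigma>" using \<sigma>0 by simp
  note sandwich = W.large_sandwich[OF k(2) \<sigma>00 local k2 \<zeta>0 glob]
  show "succ_path_exists n s t w k" "succ_cost n s t w k \<le> ends_stat k w + \<zeta>"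
    "ends_stat (k - 1) w - 2 * \<zeta> \<le> succ_cost n s t w k"
    using sandwich by auto
  show "order_stat n s w j \<le> ln (real n) ^ 8 / real n \<and> order_stat n t w j \<le> ln (real n) ^ 8 / real n"
    if j: "1 \<le> j" "j \<le> n - 1" "real j \<le> ln (real n) ^ 8 / 50" for j
  proof -
    have "order_stat n v w j \<le> \<Lambda> ^ 8 / real n" if v: "v < n" for v
    proof -
      let ?x = "\<Lambda> ^ 8 / real n"
      \<comment> \<open>Expansion of the single vertex \<open>v\<close> into all others shows that
        more than \<Lambda>^8 / 50 of its edges weigh at most \<open>?x\<close>.\<close>
      have "real (card {v}) * real n * ?x / 50 < real (card (win w ?x {v} ({..<n} - {v})))"
      proof (rule expx[unfolded expander_def, rule_format])
        have c: "card ({..<n} - {v}) = n - 1" using v by simp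
        show "n \<le> 5 * card ({..<n} - {v})" unfolding c using n20 by simp
        have "400 * \<Lambda> \<le> \<Lambda> ^ 8"
        proof -
          have "\<Lambda> ^ 1 * 1000000 ^ 1 \<le> \<Lambda> ^ (1 + 1)" by (rule pw)
          also have "\<dots> \<le> \<Lambda> ^ 8" using L1 by (intro power_increasing) auto
          finally show ?thesis using L1 by simp
        qed
        moreover have "n - card ({..<n} - {v}) = 1" unfolding c using n20 by simp
        ultimately show "400 * real (n - card ({..<n} - {v})) * ln (real n) \<le> real (card {v}) * real n * (\<Lambda> ^ 8 / real n)"
          using n0 by (simp add: \<Lambda>_def)
      qed (use v in auto)
      also have "card (win w ?x {v} ({..<n} - {v})) \<le> card {u \<in> {..<n} - {v}. w {v, u} \<le> ?x}"
      proof -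
        have "win w ?x {v} ({..<n} - {v}) \<subseteq> Pair v ` {u \<in> {..<n} - {v}. w {v, u} \<le> ?x}" by (auto simp: win_def)
        then have "card (win w ?x {v} ({..<n} - {v})) \<le> card (Pair v ` {u \<in> {..<n} - {v}. w {v, u} \<le> ?x})"
          by (intro card_mono) auto
        also have "\<dots> \<le> card {u \<in> {..<n} - {v}. w {v, u} \<le> ?x}" by (intro card_image_le) auto
        finally show ?thesis .
      qed
      finally have "\<Lambda> ^ 8 / 50 < real (card {u \<in> {..<n} - {v}. w {v, u} \<le> ?x})" using n0 by simp
      then have "j \<le> card {u \<in> {..<n} - {v}. w {v, u} \<le> ?x}" using j(3) unfolding \<Lambda>_def by linarith
      then show ?thesis using order_stat_le_iff[OF j(1,2) v] by blast
    qed
    then show ?thesis using s_less t_less by (simp add: \<Lambda>_def)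
  qed
qed

end

context instance_law
begin

text \<open>Four events are excluded: a light edge between \<open>s\<close> and \<open>t\<close>, an
  inner path below \<mu>, two light inner paths that touch, and a pair of ends without a connection
  of cost \<open>Y\<close>. Each has probability at most a power of the logarithm times
  n^(-c).\<close>

lemma small_good:
  fixes \<epsilon> C :: real
  assumes \<epsilon>: "0 < \<epsilon>" "\<epsilon> \<le> 1/10" and L: "1000000 \<le> ln (real n)" and n: "30 / \<epsilon> \<le> real n"
    and C: "\<And>N. (\<Sum>k\<le>N. (real k)\<^sup>2 * (4/5) ^ k) \<le> C"
  defines "x \<equiv> ln (real n) ^ 8 / real n" and "Y \<equiv> (1 + \<epsilon>) * ln (real n) / real n" and "\<mu> \<equiv> (1 - \<epsilon>) * ln (real n) / real n"
  obtains B where "B \<in> sets M"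
    "measure M B \<le> (30 + 36 / \<epsilon> + 2600 * C) * (ln (real n) ^ 32 * exp (- (\<epsilon>\<^sup>2 / 32) * ln (real n)))"
    "\<And>w k1 k. w \<in> space M - B \<Longrightarrow> nonneg_weights {..<n} w \<Longrightarrow> k1 \<le> n - 1 \<Longrightarrow>
       order_stat n s w k1 \<le> x \<Longrightarrow> order_stat n t w k1 \<le> x \<Longrightarrow> 1 \<le> k \<Longrightarrow> k \<le> k1 \<Longrightarrow>
       succ_path_exists n s t w k \<and> succ_cost n s t w k \<le> ends_stat k w + Y \<and>
       ends_stat k w + 3 * \<mu> - 2 * Y \<le> succ_cost n s t w k"
proof -
  interpret prob_space M by (rule prob_space_edge_weights)
  define \<Lambda> where "\<Lambda> = ln (real n)"
  \<comment> \<open>The cost of a path is at most 2 * x + Y, and \<open>Y\<close> is at most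
    \<open>x\<close>; so 3 * x bounds every end edge that can occur.\<close>
  define z where "z = 3 * x"
  \<comment> \<open>The weakest of the four exponents: connections with parameter \<alpha> =
    \<epsilon> / 4 gain a further factor \<epsilon> / 8.\<close>
  define c where "c = \<epsilon>\<^sup>2 / 32"
  define Q where "Q = \<Lambda> ^ 32 * exp (- c * \<Lambda>)"
  have n0: "0 < real n" using n \<epsilon> by (metis divide_pos_pos less_le_trans zero_less_numeral)
  have nE: "real n = exp \<Lambda>" using n0 by (simp add: \<Lambda>_def)
  have L1: "1000000 \<le> \<Lambda>" "1 \<le> \<Lambda>" using L by (auto simp: \<Lambda>_def)
  have x: "x = \<Lambda> ^ 8 / real n" "Y = (1 + \<epsilon>) * \<Lambda> / real n" "\<mu> = (1 - \<epsilon>) * \<Lambda> / real n"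
    by (simp_all add: x_def Y_def \<mu>_def \<Lambda>_def)
  have x0: "0 < x" "0 < z" using n0 L1 by (simp_all add: x z_def)
  have z2: "z\<^sup>2 = 9 * \<Lambda> ^ 16 / (real n)\<^sup>2" and z4: "z ^ 4 = 81 * \<Lambda> ^ 32 / real n ^ 4"
    by (simp_all add: z_def x power_mult_distrib power_divide power_mult[symmetric])
  have Y0: "0 \<le> Y" using n0 L1 \<epsilon> by (simp add: x)
  have e2: "\<epsilon>\<^sup>2 \<le> 1/100" using \<epsilon> power_mono[of \<epsilon> "1/10" 2] by (simp add: power2_eq_square)
  have c0: "0 < c" "c \<le> 1/4" "c \<le> \<epsilon>\<^sup>2" using \<epsilon> e2 by (auto simp: c_def)
  have QI: "\<Lambda> ^ i * exp (- d * \<Lambda>) \<le> Q" if "i \<le> 32" "c \<le> d" for i d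
    unfolding Q_def using L1 that by (intro mult_mono power_increasing) (auto intro: mult_right_mono)
  have Q0: "0 \<le> Q" using L1 by (simp add: Q_def)
  have C0: "0 \<le> C" using C[of 0] by simp
  define B1 where "B1 = {w \<in> space M. (\<forall>e\<in>{{s, t}}. w e \<le> z) \<and> (\<Sum>e\<in>{}. w e) \<le> 0}"
  have st: "{{s, t}} \<subseteq> K_edges n" using s_less t_less s_neq_t by (auto simp: K_edges_def)
  have B1s: "B1 \<in> sets M" unfolding B1_def edge_weights_def
    by (rule measure_light_le(2)[where l = 1]) (use st x0 in auto)
  have B1: "measure M B1 \<le> 3 * Q"
  proof -
    have "measure M B1 \<le> z ^ card {{s, t}} * (exp (1 * 0) * (1 / 1) ^ card ({} :: nat set set))"
      unfolding B1_def edge_weights_def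
      by (rule measure_light_le(1)) (use st x0 in auto)
    also have "\<dots> = 3 * (\<Lambda> ^ 8 * exp (- 1 * \<Lambda>))"
      unfolding z_def x nE by (simp add: exp_minus field_simps)
    also have "\<dots> \<le> 3 * Q" using QI[of 8 1] c0 by simp
    finally show ?thesis .
  qed
  \<comment> \<open>With l = (1 + \<epsilon>) * n the exponent l * \<mu> is (1 - \<epsilon>^2) * ln
    n, so against n^(-2) from the ends and the leftover factor \<open>l\<close> there remains
    n^(-\<epsilon>^2).\<close>
  obtain B3 where B3s: "B3 \<in> sets M" and B3m: "measure M B3 \<le> z\<^sup>2 * exp (((1 + \<epsilon>) * real n) * \<mu>) * ((1 + \<epsilon>) * real n) / (1 - 1 / (1 + \<epsilon>))"
    and B3: "\<And>w q. w \<in> space M - B3 \<Longrightarrow> q \<noteq> [] \<Longrightarrow> distinct q \<Longrightarrow> set q \<subseteq> A \<Longrightarrow> w {s, hd q} \<le> z \<Longrightarrow>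
       w {last q, t} \<le> z \<Longrightarrow> \<mu> < path_cost w q"
    by (rule measure_cheap_path_le[of z "(1 + \<epsilon>) * real n" "1 / (1 + \<epsilon>)" \<mu>]) (use x0 n0 \<epsilon> in auto)
  have "measure M B3 \<le> 36 / \<epsilon> * Q"
  proof -
    have e: "exp (((1 + \<epsilon>) * real n) * \<mu>) = real n * exp (- \<epsilon>\<^sup>2 * \<Lambda>)"
    proof -
      have "((1 + \<epsilon>) * real n) * \<mu> = (1 + \<epsilon>) * ((1 - \<epsilon>) * \<Lambda>)" using n0 by (simp add: x)
      also have "\<dots> = \<Lambda> + - \<epsilon>\<^sup>2 * \<Lambda>" by (simp add: power2_eq_square algebra_simps)
      finally show ?thesis unfolding nE by (simp only: exp_add)
    qed
    have d: "1 - 1 / (1 + \<epsilon>) = \<epsilon> / (1 + \<epsilon>)" using \<epsilon> by (simp add: field_simps)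
    have "z\<^sup>2 * exp (((1 + \<epsilon>) * real n) * \<mu>) * ((1 + \<epsilon>) * real n) / (1 - 1 / (1 + \<epsilon>)) =
        9 * (1 + \<epsilon>)\<^sup>2 / \<epsilon> * (\<Lambda> ^ 16 * exp (- \<epsilon>\<^sup>2 * \<Lambda>))"
    proof -
      have "9 * a / m\<^sup>2 * (m * b) * ((1 + \<epsilon>) * m) / (\<epsilon> / (1 + \<epsilon>)) = 9 * (1 + \<epsilon>)\<^sup>2 / \<epsilon> * (a * b)"
        if "0 < m" for a b m :: real
        using that \<epsilon> by (simp add: field_simps power2_eq_square)
      from this[OF n0] show ?thesis unfolding e d z2 .
    qed
    also have "\<dots> \<le> 9 * 4 / \<epsilon> * Q"
    proof (intro mult_mono divide_right_mono)
      show "(1 + \<epsilon>)\<^sup>2 \<le> 4" using \<epsilon> power_mono[of "1 + \<epsilon>" 2 2] by simp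
      show "\<Lambda> ^ 16 * exp (- \<epsilon>\<^sup>2 * \<Lambda>) \<le> Q" by (rule QI) (use c0 in auto)
    qed (use \<epsilon> L1 in auto)
    finally show ?thesis using B3m by simp
  qed
  \<comment> \<open>Four ends give n^(-4) and the leftover factor gives n. With l = 5/4 * n the
    exponential is at most n^(11/4) because \<epsilon> is at most 1/10, so n^(-1/4) remains.\<close>
  obtain B2 where B2s: "B2 \<in> sets M" and B2m: "measure M B2 \<le> z ^ 4 * exp (2 * (5/4 * real n) * Y) * (5/4 * real n) * C / (1 - 4/5)\<^sup>2"
    and B2: "\<And>w q q'. w \<in> space M - B2 \<Longrightarrow> nonneg_weights {..<n} w \<Longrightarrow>
       q \<noteq> [] \<Longrightarrow> distinct q \<Longrightarrow> set q \<subseteq> A \<Longrightarrow> q' \<noteq> [] \<Longrightarrow> distinct q' \<Longrightarrow> set q' \<subseteq> A \<Longrightarrow>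
       w {s, hd q} \<le> z \<Longrightarrow> w {last q, t} \<le> z \<Longrightarrow> w {s, hd q'} \<le> z \<Longrightarrow> w {last q', t} \<le> z \<Longrightarrow>
       hd q \<noteq> hd q' \<Longrightarrow> last q \<noteq> last q' \<Longrightarrow> path_cost w q \<le> Y \<Longrightarrow> path_cost w q' \<le> Y \<Longrightarrow>
       path_edges q \<inter> path_edges q' = {}"
    by (rule measure_touching_paths_le[of z "5/4 * real n" "4/5" C Y]) (use x0 n0 C in auto)
  have B2q: "measure M B2 \<le> 2532 * C * Q"
  proof -
    have "2 * (5/4 * real n) * Y = 5/2 * (1 + \<epsilon>) * \<Lambda>" using n0 by (simp add: x)
    also have "\<dots> \<le> 3 * \<Lambda> - 1/4 * \<Lambda>" using \<epsilon> L1 by (simp add: algebra_simps)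
    finally have "exp (2 * (5/4 * real n) * Y) \<le> exp (3 * \<Lambda> - 1/4 * \<Lambda>)" by simp
    also have "\<dots> = real n ^ 3 * exp (- (1/4) * \<Lambda>)"
      unfolding nE by (simp add: exp_of_nat_mult[symmetric] mult_exp_exp)
    finally have e: "exp (2 * (5/4 * real n) * Y) \<le> real n ^ 3 * exp (- (1/4) * \<Lambda>)" .
    have "z ^ 4 * exp (2 * (5/4 * real n) * Y) * (5/4 * real n) * C / (1 - 4/5)\<^sup>2 \<le>
        z ^ 4 * (real n ^ 3 * exp (- (1/4) * \<Lambda>)) * (5/4 * real n) * C / (1 - 4/5)\<^sup>2"
      using e x0 C0 by (intro divide_right_mono mult_right_mono mult_left_mono) auto
    also have "\<dots> = 2531.25 * C * (\<Lambda> ^ 32 * exp (- (1/4) * \<Lambda>))"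
    proof -
      have "81 * a / m ^ 4 * (m ^ 3 * b) * (5/4 * m) * C / (1 - 4/5)\<^sup>2 = 2531.25 * C * (a * b)"
        if "0 < m" for a b m :: real
        using that by (simp add: field_simps power2_eq_square eval_nat_numeral)
      from this[OF n0] show ?thesis unfolding z4 .
    qed
    also have "\<dots> \<le> 2532 * C * Q"
      using C0 c0 L1 by (intro mult_mono QI) auto
    finally show ?thesis using B2m by simp
  qed
  obtain B4 where B4s: "B4 \<in> sets M" and B4m: "measure M B4 \<le> (real n)\<^sup>2 * (z\<^sup>2 * exp (\<epsilon>/4 * (1 + ln (real (n - 2))) -
         (\<epsilon>/4) / (1 + \<epsilon>/4) * (1 - \<epsilon>/4) * (real (n - 2) - 1) * Y))"
    and B4: "\<And>w a b. w \<in> space M - B4 \<Longrightarrow> a \<in> A \<Longrightarrow> b \<in> A \<Longrightarrow> w {s, a} \<le> z \<Longrightarrow> w {b, t} \<le> z \<Longrightarrow> conn A {} w a b Y"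
    by (rule measure_unconnected_le[of z Y "\<epsilon>/4" "\<epsilon>/4"]) (use x0 Y0 \<epsilon> in auto)
  have B4q: "measure M B4 \<le> 27 * Q"
  proof -
    have "300 \<le> 30 / \<epsilon>" using \<epsilon> by (simp add: le_divide_eq)
    then have n300: "300 \<le> real n" using n by linarith
    then have r: "real (n - 2) = real n - 2" by (simp add: of_nat_diff)
    have l: "ln (real (n - 2)) \<le> \<Lambda>" using n300 r by (simp add: \<Lambda>_def)
    \<comment> \<open>The factors lost to \<alpha>, \<eta> and the three missing vertices are made
      up by the 1 + \<epsilon> in \<open>Y\<close>, with \<epsilon> / 8 to spare.\<close>
    have main: "(1 + \<epsilon>/8) * \<Lambda> \<le> 1 / (1 + \<epsilon>/4) * (1 - \<epsilon>/4) * (real (n - 2) - 1) * Y"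
    proof -
      have "(1 + \<epsilon>/4) * (1 + \<epsilon>/4) \<le> (1 - \<epsilon>/4) * (1 + \<epsilon>)"
      proof -
        have "(1 - \<epsilon>/4) * (1 + \<epsilon>) - (1 + \<epsilon>/4) * (1 + \<epsilon>/4) = \<epsilon> * (1/4 - 5/16 * \<epsilon>)"
          by (simp add: field_simps)
        moreover have "0 \<le> \<epsilon> * (1/4 - 5/16 * \<epsilon>)" using \<epsilon> by (intro mult_nonneg_nonneg) auto
        ultimately show ?thesis by linarith
      qed
      then have 1: "1 + \<epsilon>/4 \<le> (1 - \<epsilon>/4) * (1 + \<epsilon>) / (1 + \<epsilon>/4)" using \<epsilon> by (simp add: le_divide_eq)
      have 2: "1 - \<epsilon>/10 \<le> (real n - 3) / real n" using n n0 \<epsilon> by (simp add: field_simps)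
      have "1 + \<epsilon>/8 \<le> (1 + \<epsilon>/4) * (1 - \<epsilon>/10)"
      proof -
        have "(1 + \<epsilon>/4) * (1 - \<epsilon>/10) - (1 + \<epsilon>/8) = \<epsilon> * (1/40 - 1/40 * \<epsilon>)"
          by (simp add: field_simps)
        moreover have "0 \<le> \<epsilon> * (1/40 - 1/40 * \<epsilon>)" using \<epsilon> by (intro mult_nonneg_nonneg) auto
        ultimately show ?thesis by linarith
      qed
      also have "\<dots> \<le> ((1 - \<epsilon>/4) * (1 + \<epsilon>) / (1 + \<epsilon>/4)) * ((real n - 3) / real n)"
        using 1 2 \<epsilon> by (intro mult_mono) auto
      finally have "(1 + \<epsilon>/8) * \<Lambda> \<le> ((1 - \<epsilon>/4) * (1 + \<epsilon>) / (1 + \<epsilon>/4)) * ((real n - 3) / real n) * \<Lambda>"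
        using L1 by (intro mult_right_mono) auto
      then show ?thesis unfolding x r by (simp add: mult_ac)
    qed
    have "\<epsilon>/4 * (1 + ln (real (n - 2))) - (\<epsilon>/4) / (1 + \<epsilon>/4) * (1 - \<epsilon>/4) * (real (n - 2) - 1) * Y =
        \<epsilon>/4 * (1 + ln (real (n - 2)) - 1 / (1 + \<epsilon>/4) * (1 - \<epsilon>/4) * (real (n - 2) - 1) * Y)"
    proof -
      have "a * u - a / b * c * d * v = a * (u - 1 / b * c * d * v)" for a b c d u v :: real
        by (simp add: right_diff_distrib)
      then show ?thesis .
    qed
    also have "\<dots> \<le> \<epsilon>/4 * (1 + \<Lambda> - (1 + \<epsilon>/8) * \<Lambda>)"
      using main l \<epsilon> by (intro mult_left_mono diff_mono) auto
    also have "\<dots> = \<epsilon>/4 + - c * \<Lambda>" by (simp add: c_def power2_eq_square algebra_simps)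
    also have "\<dots> \<le> 1 + - c * \<Lambda>" using \<epsilon> by simp
    finally have "exp (\<epsilon>/4 * (1 + ln (real (n - 2))) - (\<epsilon>/4) / (1 + \<epsilon>/4) * (1 - \<epsilon>/4) * (real (n - 2) - 1) * Y) \<le> exp (1 + - c * \<Lambda>)"
      by simp
    also have "\<dots> \<le> 3 * exp (- c * \<Lambda>)" unfolding exp_add using exp_le by (intro mult_right_mono) auto
    finally have "(real n)\<^sup>2 * (z\<^sup>2 * exp (\<epsilon>/4 * (1 + ln (real (n - 2))) -
         (\<epsilon>/4) / (1 + \<epsilon>/4) * (1 - \<epsilon>/4) * (real (n - 2) - 1) * Y)) \<le> (real n)\<^sup>2 * (z\<^sup>2 * (3 * exp (- c * \<Lambda>)))"
      by (intro mult_left_mono) auto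
    also have "\<dots> = 27 * (\<Lambda> ^ 16 * exp (- c * \<Lambda>))"
      unfolding z2 using n0 by simp
    also have "\<dots> \<le> 27 * Q" using QI[of 16 c] by simp
    finally show ?thesis using B4m by simp
  qed
  show ?thesis
  proof (rule that[of "B1 \<union> B2 \<union> (B3 \<union> B4)"])
    show "B1 \<union> B2 \<union> (B3 \<union> B4) \<in> sets M" using B1s B2s B3s B4s by auto
    have "measure M (B1 \<union> B2 \<union> (B3 \<union> B4)) \<le> measure M B1 + measure M B2 + (measure M B3 + measure M B4)"
      using measure_Un_le[of "B1 \<union> B2" M "B3 \<union> B4"] measure_Un_le[of B1 M B2] measure_Un_le[of B3 M B4] B1s B2s B3s B4s by auto
    also have "\<dots> \<le> 3 * Q + 2532 * C * Q + (36 / \<epsilon> * Q + 27 * Q)"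
      using B1 B2q \<open>measure M B3 \<le> 36 / \<epsilon> * Q\<close> B4q by linarith
    also have "\<dots> \<le> (30 + 36 / \<epsilon> + 2600 * C) * Q" using C0 Q0 by (simp add: distrib_right mult_right_mono)
    finally show "measure M (B1 \<union> B2 \<union> (B3 \<union> B4)) \<le> (30 + 36 / \<epsilon> + 2600 * C) * (ln (real n) ^ 32 * exp (- (\<epsilon>\<^sup>2 / 32) * ln (real n)))"
      unfolding Q_def c_def \<Lambda>_def .
    fix w k1 k
    assume w: "w \<in> space M - (B1 \<union> B2 \<union> (B3 \<union> B4))" and nn: "nonneg_weights {..<n} w" and k1: "k1 \<le> n - 1"
      and os: "order_stat n s w k1 \<le> x" "order_stat n t w k1 \<le> x" and k: "1 \<le> k" "k \<le> k1"
    interpret W: weighted_instance n s t w by (rule weighted_instanceI[OF nn])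
    have AE: "W.A = A" by (rule W.A_def)
    have Yz: "2 * x + Y \<le> z"
    proof -
      have "(1 + \<epsilon>) * \<Lambda> \<le> \<Lambda> * \<Lambda>" using \<epsilon> L1 by (intro mult_right_mono) auto
      also have "\<dots> \<le> \<Lambda> ^ 8" using power_increasing[of 2 8 \<Lambda>] L1 by (simp add: power2_eq_square)
      finally have "Y \<le> x" unfolding x using n0 by (intro divide_right_mono) auto
      then show ?thesis by (simp add: z_def)
    qed
    have zst: "z < w {s, t}" using w by (auto simp: B1_def)
    have w': "w \<in> space M - B2" "w \<in> space M - B3" "w \<in> space M - B4" using w by auto
    note sandwich = W.small_sandwich[OF k1 zst os Y0 Yz, unfolded AE, OF B4[OF w'(3)] B2[OF w'(1) nn] less_imp_le[OF B3[OF w'(2)]] k]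
    have "W.E k" "W.X k \<le> ends_stat k w + Y" "ends_stat k w + 3 * \<mu> - 2 * Y \<le> W.X k"
      by (rule sandwich; assumption)+
    then show "succ_path_exists n s t w k \<and> succ_cost n s t w k \<le> ends_stat k w + Y \<and>
       ends_stat k w + 3 * \<mu> - 2 * Y \<le> succ_cost n s t w k" by blast
  qed
qed

end

subsection \<open>Asymptotics\<close>

context edge_law
begin

lemma mean_order_stat_ge: "j < n - 1 \<Longrightarrow> 1 / real n \<le> mean_order_stat (n - 1) j"
  unfolding mean_order_stat_def by (auto intro!: divide_left_mono)

lemma expected_order_stat_ge:
  assumes "1 \<le> k" "k \<le> n - 1"
  shows "real k / real n \<le> expected_order_stat D n k"
proof -
  have "(\<Sum>j<k. 1 / real n) \<le> (\<Sum>j<k. mean_order_stat (n - 1) j)"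
    using assms by (intro sum_mono mean_order_stat_ge) auto
  then show ?thesis unfolding expected_order_stat_eq[OF assms] by simp
qed

lemma sum_inverse_ge_ln:
  "k \<le> n - 1 \<Longrightarrow> 1 \<le> n \<Longrightarrow> ln (real n) - ln (real (n - k)) \<le> (\<Sum>j<k. 1 / real (n - 1 - j))"
proof (induction k)
  case (Suc k)
  define m where "m = n - Suc k"
  have m: "0 < m" "n - k = Suc m" "n - 1 - k = m" using Suc.prems by (auto simp: m_def)
  have "ln (1 + 1 / real m) \<le> 1 / real m" by (rule ln_add_one_self_le_self) simp
  moreover have "1 + 1 / real m = real (Suc m) / real m" using m by (simp add: field_simps)
  ultimately have "ln (real (Suc m)) - ln (real m) \<le> 1 / real m" using m by (simp add: ln_div)
  then show ?case using Suc m m_def by simp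
qed simp

text \<open>The last spacing is a small part of the whole sum, which repairs the index lost to the
  direct path. Only the exponential law with k close to n needs care, as its spacings grow up to
  1.\<close>

lemma order_stat_gap:
  assumes \<epsilon>: "0 < \<epsilon>"
  shows "\<forall>\<^sub>F n in sequentially. \<forall>k. 2 / \<epsilon> \<le> real k \<longrightarrow> 2 \<le> k \<longrightarrow> k \<le> n - 1 \<longrightarrow>
     (1 - \<epsilon>) * expected_order_stat D n k \<le> expected_order_stat D n (k - 1)"
proof -
  have "\<forall>\<^sub>F n::nat in sequentially. 2 / \<epsilon> \<le> ln (real n)" "\<forall>\<^sub>F n::nat in sequentially. 2 / \<epsilon> \<le> sqrt (real n)"
    by real_asymp+
  then show ?thesis using eventually_ge_at_top[of 2]
  proof eventually_elim
    case (elim n)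
    show ?case
    proof (intro allI impI)
      fix k assume k: "2 / \<epsilon> \<le> real k" "2 \<le> k" "k \<le> n - 1"
      let ?S = "\<Sum>j<k. mean_order_stat (n - 1) j"
      have n0: "0 < real n" using elim by simp
      have "mean_order_stat (n - 1) (k - 1) \<le> \<epsilon> * ?S"
      proof -
        have S1: "real k / real n \<le> ?S"
          using expected_order_stat_ge[of k n] expected_order_stat_eq[of k n] k by simp
        have ek: "2 \<le> \<epsilon> * real k" using k(1) \<epsilon> by (simp add: divide_le_eq mult.commute)
        have S2: "2 / real n \<le> \<epsilon> * ?S"
        proof -
          have "2 / real n \<le> \<epsilon> * (real k / real n)" using ek n0 by (simp add: divide_right_mono)
          also have "\<dots> \<le> \<epsilon> * ?S" using S1 \<epsilon> by (intro mult_left_mono) auto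
          finally show ?thesis .
        qed
        define r where "r = n - k"
        have r: "1 \<le> r" "n - 1 - (k - 1) = r" "real r = real n - real k" using k elim by (auto simp: r_def)
        show ?thesis
        \<comment> \<open>In the first case the spacing is at most 2 / n, while the sum is at least
          k / n; so it suffices that \<epsilon> * k is at least 2.\<close>
        proof (cases "D = uniform_law \<or> 2 * r \<ge> n")
          case True
          have "mean_order_stat (n - 1) (k - 1) \<le> 2 / real n"
          proof (cases "D = uniform_law")
            case True
            then show ?thesis unfolding mean_order_stat_def using elim by (simp add: divide_right_mono)
          next
            case False
            then have "real n \<le> real (2 * r)" using \<open>D = uniform_law \<or> 2 * r \<ge> n\<close> by (simp only: of_nat_le_iff) simp
            then have "1 / real r \<le> 2 / real n" using r n0 by (simp add: field_simps)
            then show ?thesis using False r by (simp add: mean_order_stat_def)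
          qed
          then show ?thesis using S2 by linarith
        next
          case False
          then have eq: "?S = (\<Sum>j<k. 1 / real (n - 1 - j))" "mean_order_stat (n - 1) (k - 1) = 1 / real r"
            using r by (auto simp: mean_order_stat_def)
          have "ln (real n) - ln (real r) \<le> ?S" unfolding eq r_def by (rule sum_inverse_ge_ln) (use k elim in auto)
          then have S3: "ln (real n / real r) \<le> ?S" using r n0 by (simp add: ln_div)
          have r0: "0 < real r" using r by simp
          \<comment> \<open>For r below sqrt n the logarithm alone is at least half of ln n; for r
            between sqrt n and n / 2 it is at least 1/2 and the factor r is large.\<close>
          have "1 / \<epsilon> \<le> real r * ln (real n / real r)"
          proof (cases "real r \<le> sqrt (real n)")
            case True
            have "sqrt (real n) \<le> real n / real r"
            proof -
              have "sqrt (real n) * real r \<le> sqrt (real n) * sqrt (real n)" using True by (intro mult_left_mono) auto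
              then show ?thesis using r0 by (simp add: le_divide_eq)
            qed
            then have "ln (sqrt (real n)) \<le> ln (real n / real r)" using n0 by (subst ln_le_cancel_iff) (use r0 in auto)
            then have "1 / \<epsilon> \<le> ln (real n / real r)" using elim(1) n0 by (simp add: ln_sqrt)
            also have "\<dots> \<le> real r * ln (real n / real r)"
            proof -
              have "0 \<le> ln (real n / real r)" using r0 r(3) by (simp add: le_divide_eq)
              then show ?thesis using r(1) mult_right_mono[of 1 "real r" "ln (real n / real r)"] by simp
            qed
            finally show ?thesis .
          next
            case F: False
            have "real (2 * r) \<le> real n" using False by (simp only: of_nat_le_iff) simp
            then have "2 \<le> real n / real r" using r0 by (simp add: le_divide_eq)
            then have "ln 2 \<le> ln (real n / real r)" using n0 r0 by (subst ln_le_cancel_iff) auto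
            then have "1/2 \<le> ln (real n / real r)" using ln2_ge_two_thirds by linarith
            then have "sqrt (real n) * (1/2) \<le> real r * ln (real n / real r)" using F by (intro mult_mono) auto
            then show ?thesis using elim(2) by simp
          qed
          then have "1 / real r \<le> \<epsilon> * ln (real n / real r)" using \<epsilon> r0 by (simp add: field_simps)
          also have "\<dots> \<le> \<epsilon> * ?S" using S3 \<epsilon> by (intro mult_left_mono) auto
          finally show ?thesis unfolding eq(2) .
        qed
      qed
      moreover have "?S = (\<Sum>j<k - 1. mean_order_stat (n - 1) j) + mean_order_stat (n - 1) (k - 1)"
        using k by (cases k) auto
      moreover have "1 \<le> k - 1" "k - 1 \<le> n - 1" "1 \<le> k" using k by auto
      ultimately show "(1 - \<epsilon>) * expected_order_stat D n k \<le> expected_order_stat D n (k - 1)"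
        using expected_order_stat_eq[of k n] expected_order_stat_eq[of "k - 1" n] k unfolding left_diff_distrib by simp
    qed
  qed
qed

text \<open>The square counts the two attachment vertices of touching paths, and 4/5 is the ratio n
  / l for l = 5/4 * n.\<close>

lemma summable_square_geometric: "\<exists>C. \<forall>N. (\<Sum>k\<le>N. (real k)\<^sup>2 * (4/5) ^ k) \<le> C"
proof -
  have s: "summable (\<lambda>k. (real k)\<^sup>2 * (4/5) ^ k)"
  proof (rule summable_comparison_test_bigo)
    show "summable (\<lambda>k. norm ((9/10 :: real) ^ k))" by (simp add: summable_geometric)
    show "(\<lambda>k. (real k)\<^sup>2 * (4/5) ^ k) \<in> O(\<lambda>k. (9/10) ^ k)" by real_asymp
  qed
  show ?thesis
    by (rule exI[of _ "\<Sum>k. (real k)\<^sup>2 * (4/5) ^ k"]) (auto intro!: sum_le_suminf s)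
qed

definition scale :: "nat \<Rightarrow> nat \<Rightarrow> real" where
  "scale n k = 2 * expected_order_stat D n k + ln (real n) / real n"

text \<open>One eventuality has to serve all vertices and all k, so every asymptotic condition below
  concerns n alone. The two regimes meet at \<open>ln n ^ 7\<close>.\<close>

lemma uniform_estimate:
  assumes \<epsilon>: "0 < \<epsilon>" "\<epsilon> \<le> 1"
  shows "\<forall>\<^sub>F n in sequentially. \<forall>s t k. s < n \<longrightarrow> t < n \<longrightarrow> s \<noteq> t \<longrightarrow> 1 \<le> k \<longrightarrow> k \<le> n - 1 \<longrightarrow>
     1 - \<epsilon> \<le> measure (edge_weights D n) {w \<in> space (edge_weights D n). succ_path_exists n s t w k} \<and>
     (1 - \<epsilon>) * scale n k \<le> (\<integral>w. instance_law.cost_on D n s t k w \<partial>edge_weights D n) \<and>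
     (\<integral>w. instance_law.cost_on D n s t k w \<partial>edge_weights D n) \<le> (1 + \<epsilon>) * scale n k"
proof -
  \<comment> \<open>Only a few error terms of relative size \<open>e\<close> arise in either regime;
    20 of them are available.\<close>
  define e where "e = \<epsilon> / 20"
  have e: "0 < e" "e \<le> 1/10" "\<epsilon> = 20 * e" "e \<le> 1" using \<epsilon> by (auto simp: e_def)
  obtain C where C: "\<And>N. (\<Sum>k\<le>N. (real k)\<^sup>2 * (4/5) ^ k) \<le> C" using summable_square_geometric by blast
  define K where "K = 30 + 36 / e + 2600 * C"
  define c where "c = e\<^sup>2 / 32"
  have c0: "0 < c" using e by (simp add: c_def)
  let ?pL = "\<lambda>n::nat. (real n + 3) * (9 * exp (- (ln (real n) ^ 5) / 200))"
  let ?pS = "\<lambda>n::nat. K * (ln (real n) ^ 32 * exp (- c * ln (real n)))"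
  \<comment> \<open>On the exceptional event of the small regime the costs are of order ln^8 n / n.
    Relative to ln n / n its contribution is 4 * ln^7 n times its probability, which must
    vanish.\<close>
  have lim: "(\<lambda>n::nat. 4 * ln (real n) ^ 7 * (?pS n + 1 / real n ^ 20)) \<longlonglongrightarrow> 0"
  proof -
    have 1: "(\<lambda>n::nat. ln (real n) ^ 39 * real n powr - c) \<longlonglongrightarrow> 0" using c0 by real_asymp
    have 2: "(\<lambda>n::nat. 4 * ln (real n) ^ 7 * (1 / real n ^ 20)) \<longlonglongrightarrow> 0" by real_asymp
    have "(\<lambda>n::nat. 4 * K * (ln (real n) ^ 39 * real n powr - c) + 4 * ln (real n) ^ 7 * (1 / real n ^ 20)) \<longlonglongrightarrow> 4 * K * 0 + 0"
      by (intro tendsto_add tendsto_mult_left 1 2)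
    moreover have "\<forall>\<^sub>F n::nat in sequentially. 4 * K * (ln (real n) ^ 39 * real n powr - c) + 4 * ln (real n) ^ 7 * (1 / real n ^ 20) =
        4 * ln (real n) ^ 7 * (?pS n + 1 / real n ^ 20)"
      using eventually_gt_at_top[of 0]
    proof eventually_elim
      case (elim n)
      have "ln (real n) ^ 39 = ln (real n) ^ 7 * ln (real n) ^ 32" by (simp add: power_add[symmetric])
      then show ?case using elim by (simp add: powr_def distrib_left mult_ac)
    qed
    ultimately show ?thesis using Lim_transform_eventually by fastforce
  qed
  have ev: "\<forall>\<^sub>F n::nat in sequentially. 1000000 \<le> ln (real n)" "\<forall>\<^sub>F n::nat in sequentially. ln (real n) ^ 8 / real n \<le> 1/2"
    "\<forall>\<^sub>F n::nat in sequentially. 30 / e \<le> real n"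
    "\<forall>\<^sub>F n::nat in sequentially. ?pL n \<le> 1 / real n ^ 20"
    "\<forall>\<^sub>F n::nat in sequentially. 4 / real n ^ 8 \<le> e / real n"
    "\<forall>\<^sub>F n::nat in sequentially. 6 / ln (real n) + 160 / sqrt (ln (real n)) \<le> e"
    "\<forall>\<^sub>F n::nat in sequentially. ln (real n) ^ 7 + 2 \<le> real n" "\<forall>\<^sub>F n::nat in sequentially. ln (real n) ^ 7 + 1 \<le> ln (real n) ^ 8 / 50"
    "\<forall>\<^sub>F n::nat in sequentially. 2 / e \<le> ln (real n) ^ 7" "\<forall>\<^sub>F n::nat in sequentially. ln (real n) \<le> e * ln (real n) ^ 7"
    using e(1) by real_asymp+
  have ev2: "\<forall>\<^sub>F n::nat in sequentially. 4 * ln (real n) ^ 7 * (?pS n + 1 / real n ^ 20) < e"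
    using order_tendstoD(2)[OF lim e(1)] .
  from ev ev2 order_stat_gap[OF e(1)]
  show ?thesis
  proof eventually_elim
    case (elim n)
    show ?case
    proof (intro allI impI)
      fix s t k assume st: "s < n" "t < n" "s \<noteq> t" and k: "1 \<le> k" "k \<le> n - 1"
      interpret I: instance_law D n s t by unfold_locales (use st in auto)
      interpret P: prob_space "edge_weights D n" by (rule prob_space_edge_weights)
      define L where "L = ln (real n)"
      define W where "W = expected_order_stat D n k"
      \<comment> \<open>The square root of the bound n^(-20) for the superpolynomially rare event;
        it balances the two terms of the crude estimate.\<close>
      define \<delta> where "\<delta> = 1 / real n ^ 10"
      have L1: "1000000 \<le> L" using elim by (simp add: L_def)
      have n0: "0 < real n" using st by simp
      have \<delta>0: "0 < \<delta>" using n0 by (simp add: \<delta>_def)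
      have Wk: "real k / real n \<le> W" unfolding W_def by (rule expected_order_stat_ge[OF k])
      have W1: "1 / real n \<le> W"
        using Wk k n0 divide_right_mono[of 1 "real k" "real n"] by simp
      have fE: "scale n k = 2 * W + L / real n" by (simp add: scale_def W_def L_def)
      have tail: "(real n)\<^sup>2 * (\<delta> + measure (edge_weights D n) (I.big_bad k') / \<delta>) \<le> 2 / real n ^ 8 \<and>
          measure (edge_weights D n) (I.big_bad k') \<le> 1 / real n ^ 20 \<and> I.big_bad k' \<in> sets (edge_weights D n)"
        if k': "L ^ 7 \<le> real k'" "k' \<le> n - 1" for k'
      proof -
        note bb = I.big_bad_measure[OF elim(1,2), of k']
        have m: "measure (edge_weights D n) (I.big_bad k') \<le> 1 / real n ^ 20"
          using bb(2)[OF k'(1)[unfolded L_def] le_trans[OF k'(2) diff_le_self]] elim(4) by linarith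
        have "measure (edge_weights D n) (I.big_bad k') / \<delta> \<le> (1 / real n ^ 20) / \<delta>"
          using m \<delta>0 by (intro divide_right_mono) auto
        also have "\<dots> = \<delta>" using n0 by (simp add: \<delta>_def power_add[symmetric] divide_simps)
        finally have "(real n)\<^sup>2 * (\<delta> + measure (edge_weights D n) (I.big_bad k') / \<delta>) \<le> (real n)\<^sup>2 * (2 * \<delta>)"
          by (intro mult_left_mono) auto
        also have "\<dots> = 2 / real n ^ 8" using n0 by (simp add: \<delta>_def power_add[symmetric] divide_simps)
        finally show ?thesis using m bb(1) k' by (simp add: L_def)
      qed
      have small: "2 * (2 / real n ^ 8) \<le> e / real n" using elim(5) by simp
      show "1 - \<epsilon> \<le> measure (edge_weights D n) {w \<in> space (edge_weights D n). succ_path_exists n s t w k} \<and>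
         (1 - \<epsilon>) * scale n k \<le> (\<integral>w. I.cost_on k w \<partial>edge_weights D n) \<and>
         (\<integral>w. I.cost_on k w \<partial>edge_weights D n) \<le> (1 + \<epsilon>) * scale n k"
      proof (cases "L ^ 7 \<le> real k")
        case True
        note T = tail[OF True k(2)]
        define \<zeta> where "\<zeta> = real k / real n * (6 / ln (real n) + 160 / sqrt (ln (real n)))"
        have \<zeta>0: "0 \<le> \<zeta>" using L1 by (simp add: \<zeta>_def L_def)
        have "\<zeta> \<le> real k / real n * e" unfolding \<zeta>_def using elim(6) by (intro mult_left_mono) auto
        also have "\<dots> \<le> W * e" using Wk e by (intro mult_right_mono) auto
        finally have \<zeta>W: "\<zeta> \<le> e * W" by (simp add: mult.commute)
        have "1 \<le> L ^ 7" using L1 by (intro one_le_power) simp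
        have k2: "2 \<le> k" "2 / e \<le> real k"
        proof -
          have "L \<le> L ^ 7" using L1 power_increasing[of 1 7 L] by simp
          then show "2 \<le> k" using L1 True by linarith
          show "2 / e \<le> real k" using elim(9) True by (simp add: L_def)
        qed
        have lg: "succ_path_exists n s t w k \<and> succ_cost n s t w k \<le> I.ends_stat k w + \<zeta> \<and> I.ends_stat (k - 1) w + (- 2 * \<zeta>) \<le> succ_cost n s t w k"
          if "w \<in> space (edge_weights D n) - I.big_bad k" "nonneg_weights {..<n} w" for w
          using I.large_good[OF elim(1) True[unfolded L_def] k(2) that, folded \<zeta>_def] by auto
        have kj: "1 \<le> k - 1" "k - 1 \<le> n - 1" using k2 k by auto
        \<comment> \<open>In this regime both exceptional events coincide, so the intermediate case
          is vacuous and \<open>c = 0\<close> is admissible.\<close>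
        note ES = I.expectation_sandwich[OF k kj T[THEN conjunct2, THEN conjunct2] T[THEN conjunct2, THEN conjunct2] lg, where c = 0 and \<delta> = \<delta>]
        have up: "(\<integral>w. I.cost_on k w \<partial>edge_weights D n) \<le> 2 * W + \<zeta> + 2 / real n ^ 8"
          using ES(1) T \<zeta>0 \<delta>0 unfolding W_def by force
        have low: "2 * expected_order_stat D n (k - 1) - 2 * \<zeta> - 2 * (2 / real n ^ 8) \<le> (\<integral>w. I.cost_on k w \<partial>edge_weights D n)"
        proof -
          have "2 * expected_order_stat D n (k - 1) + - 2 * \<zeta> - (0 + - 2 * \<zeta>) * measure (edge_weights D n) (I.big_bad k) -
              2 * ((real n)\<^sup>2 * (\<delta> + measure (edge_weights D n) (I.big_bad k) / \<delta>)) \<le> (\<integral>w. I.cost_on k w \<partial>edge_weights D n)"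
            by (rule ES(2)) (use \<zeta>0 \<delta>0 in auto)
          moreover have "(0 + - 2 * \<zeta>) * measure (edge_weights D n) (I.big_bad k) \<le> 0"
            using \<zeta>0 by (intro mult_nonpos_nonneg) auto
          ultimately show ?thesis using T[THEN conjunct1] by linarith
        qed
        have gap: "(1 - e) * W \<le> expected_order_stat D n (k - 1)"
          using elim(12) k2 k unfolding W_def by blast
        have eW: "e / real n \<le> e * W" using mult_left_mono[OF W1, of e] e by simp
        have Lk: "L / real n \<le> e * W"
        proof -
          have "L \<le> e * L ^ 7" using elim(10) by (simp add: L_def)
          also have "\<dots> \<le> e * real k" using True e by (intro mult_left_mono) auto
          finally have "L \<le> e * real k" .
          then have "L / real n \<le> e * (real k / real n)" using n0 by (simp add: divide_right_mono)
          also have "\<dots> \<le> e * W" using Wk e by (intro mult_left_mono) auto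
          finally show ?thesis .
        qed
        have W0: "0 \<le> W" using W1 n0 by (meson divide_nonneg_nonneg of_nat_0_le_iff order_trans zero_le_one)
        have Ln: "0 \<le> L / real n" using L1 by simp
        have E: "1 - \<epsilon> \<le> measure (edge_weights D n) {w \<in> space (edge_weights D n). succ_path_exists n s t w k}"
        proof -
          have "1 - measure (edge_weights D n) (I.big_bad k) \<le> measure (edge_weights D n) {w \<in> space (edge_weights D n). succ_path_exists n s t w k}"
            by (rule ES(3)) (use \<zeta>0 \<delta>0 in auto)
          moreover have "1 / real n ^ 20 \<le> \<epsilon>"
          proof -
            have "0 \<le> 4 * L ^ 7 * ?pS n"
            proof -
              have "0 \<le> C" using C[of 0] by simp
              then show ?thesis using L1 e unfolding L_def K_def by (intro mult_nonneg_nonneg) auto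
            qed
            moreover have "1 / real n ^ 20 \<le> 4 * L ^ 7 * (1 / real n ^ 20)"
              using \<open>1 \<le> L ^ 7\<close> mult_right_mono[of 1 "4 * L ^ 7" "1 / real n ^ 20"] by simp
            ultimately show ?thesis using elim(11) e unfolding L_def distrib_left by linarith
          qed
          ultimately show ?thesis using T[THEN conjunct2, THEN conjunct1] by linarith
        qed
        have "(1 - \<epsilon>) * scale n k \<le> 2 * W - 5 * (e * W)"
        proof -
          have "(1 - \<epsilon>) * scale n k \<le> (1 - \<epsilon>) * (2 * W + e * W)"
            unfolding fE using Lk \<epsilon> by (intro mult_left_mono) auto
          also have "\<dots> = 2 * W - 39 * (e * W) - 20 * (e * (e * W))" unfolding e(3) by (simp add: algebra_simps)
          also have "\<dots> \<le> 2 * W - 5 * (e * W)"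
          proof -
            have "0 \<le> e * (e * W)" "0 \<le> e * W" using e W0 by auto
            then show ?thesis by linarith
          qed
          finally show ?thesis .
        qed
        also have "\<dots> \<le> (\<integral>w. I.cost_on k w \<partial>edge_weights D n)"
          using low gap small eW \<zeta>W by (simp add: algebra_simps)
        finally have lower: "(1 - \<epsilon>) * scale n k \<le> (\<integral>w. I.cost_on k w \<partial>edge_weights D n)" .
        have "(\<integral>w. I.cost_on k w \<partial>edge_weights D n) \<le> 2 * W + 2 * (e * W)"
        proof -
          have "0 \<le> 2 / real n ^ 8" by simp
          then show ?thesis using up small eW \<zeta>W by linarith
        qed
        also have "\<dots> \<le> (1 + \<epsilon>) * scale n k"
        proof -
          have "0 \<le> e * W" "0 \<le> e * (L / real n)" using e(1) by (intro mult_nonneg_nonneg W0 Ln; simp)+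
          moreover have "2 * W + 2 * (e * W) \<le> (1 + 20 * e) * (2 * W + q)" if "0 \<le> e * W" "0 \<le> e * q" "0 \<le> q" for q
            using that by (simp add: algebra_simps)
          ultimately show ?thesis unfolding fE e(3) using Ln by blast
        qed
        finally show ?thesis using E lower by blast
      next
        case False
        \<comment> \<open>The first index of the large regime. Its estimates bound the costs of all
          smaller indices by monotonicity, even where the small-regime estimates fail.\<close>
        define k1 where "k1 = nat \<lceil>L ^ 7\<rceil>"
        have L70: "1 \<le> L ^ 7" using L1 by (intro one_le_power) simp
        have k1: "L ^ 7 \<le> real k1" "real k1 \<le> L ^ 7 + 1" using L70 unfolding k1_def by linarith+
        have kk1: "k \<le> k1" using False k1 by linarith
        have k1n: "k1 \<le> n - 1"
        proof -
          have "real k1 + 1 \<le> real n" using k1 elim(7) unfolding L_def by linarith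
          then show ?thesis by linarith
        qed
        have k11: "1 \<le> k1" using k kk1 by simp
        have k18: "real k1 \<le> ln (real n) ^ 8 / 50" using k1 elim(8) unfolding L_def by linarith
        note T = tail[OF k1(1) k1n]
        define x where "x = L ^ 8 / real n"
        define Y where "Y = (1 + e) * L / real n"
        define \<mu> where "\<mu> = (1 - e) * L / real n"
        obtain B where Bs: "B \<in> sets (edge_weights D n)" and Bm: "measure (edge_weights D n) B \<le> ?pS n"
          and Bg: "\<And>w k1 k. w \<in> space (edge_weights D n) - B \<Longrightarrow> nonneg_weights {..<n} w \<Longrightarrow> k1 \<le> n - 1 \<Longrightarrow>
             order_stat n s w k1 \<le> x \<Longrightarrow> order_stat n t w k1 \<le> x \<Longrightarrow> 1 \<le> k \<Longrightarrow> k \<le> k1 \<Longrightarrow>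
             succ_path_exists n s t w k \<and> succ_cost n s t w k \<le> I.ends_stat k w + Y \<and>
             I.ends_stat k w + 3 * \<mu> - 2 * Y \<le> succ_cost n s t w k"
          unfolding K_def c_def x_def Y_def \<mu>_def L_def by (rule I.small_good[OF e(1,2) elim(1,3) C]) blast
        define B\<^sub>1 where "B\<^sub>1 = B \<union> I.big_bad k1"
        have B1s: "B\<^sub>1 \<in> sets (edge_weights D n)" unfolding B\<^sub>1_def by (intro sets.Un Bs T[THEN conjunct2, THEN conjunct2])
        have B1m: "measure (edge_weights D n) B\<^sub>1 \<le> ?pS n + 1 / real n ^ 20"
          using measure_Un_le[OF Bs T[THEN conjunct2, THEN conjunct2]] T[THEN conjunct2, THEN conjunct1] Bm unfolding B\<^sub>1_def by linarith
        have LB: "4 * L ^ 7 * measure (edge_weights D n) B\<^sub>1 \<le> e"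
        proof -
          have "4 * L ^ 7 * measure (edge_weights D n) B\<^sub>1 \<le> 4 * L ^ 7 * (?pS n + 1 / real n ^ 20)"
            using B1m L70 by (intro mult_left_mono) linarith+
          then show ?thesis using elim(11) by (simp add: L_def)
        qed
        define l where "l = 3 * \<mu> - 2 * Y"
        have lE: "l = (1 - 5 * e) * (L / real n)"
          by (simp add: l_def \<mu>_def Y_def add_divide_distrib[symmetric] diff_divide_distrib[symmetric] algebra_simps)
        have Y0: "0 \<le> Y" using e L1 by (simp add: Y_def)
        have xs: "order_stat n s w k1 \<le> x \<and> order_stat n t w k1 \<le> x"
          if "w \<in> space (edge_weights D n) - I.big_bad k1" "nonneg_weights {..<n} w" for w
          using I.large_good(4)[OF elim(1) k1(1)[unfolded L_def] k1n that k11 k1n k18] by (simp add: x_def L_def)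
        have good: "succ_path_exists n s t w k \<and> succ_cost n s t w k \<le> I.ends_stat k w + Y \<and> I.ends_stat k w + l \<le> succ_cost n s t w k"
          if w: "w \<in> space (edge_weights D n) - B\<^sub>1" "nonneg_weights {..<n} w" for w
          using Bg[of w k1 k] xs[of w] w k1n k kk1 by (auto simp: B\<^sub>1_def l_def)
        \<comment> \<open>Both order statistics at \<open>k1\<close> and the error \<zeta> are each
          at most \<open>x\<close>.\<close>
        define cc where "cc = 3 * x"
        have fair: "(succ_path_exists n s t w k \<longrightarrow> succ_cost n s t w k \<le> cc) \<and> I.ends_stat k w \<le> cc"
          if w: "w \<in> space (edge_weights D n) - I.big_bad k1" "w \<in> B\<^sub>1" "nonneg_weights {..<n} w" for w
        proof -
          define \<zeta> where "\<zeta> = real k1 / real n * (6 / ln (real n) + 160 / sqrt (ln (real n)))"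
          note lg = I.large_good[OF elim(1) k1(1)[unfolded L_def] k1n w(1,3), folded \<zeta>_def]
          have "\<zeta> \<le> real k1 / real n * 1" unfolding \<zeta>_def using elim(6) e by (intro mult_left_mono) auto
          also have "\<dots> \<le> x" unfolding x_def using k18 L1 n0 by (auto simp: L_def intro!: divide_right_mono)
          finally have z: "\<zeta> \<le> x" .
          have x0: "0 \<le> x" using L1 by (simp add: x_def)
          have "succ_cost n s t w k \<le> succ_cost n s t w k1" by (rule succ_cost_mono[OF lg(1) k(1) kk1])
          then have "succ_cost n s t w k \<le> cc" using lg(2) z xs[OF w(1,3)] unfolding cc_def by linarith
          moreover have "I.ends_stat k w \<le> cc"
            using order_stat_mono[OF k(1) kk1 k1n st(1), of w] order_stat_mono[OF k(1) kk1 k1n st(2), of w] xs[OF w(1,3)] x0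
            unfolding cc_def by linarith
          ultimately show ?thesis by blast
        qed
        have cc0: "0 \<le> cc" using L1 by (simp add: cc_def x_def)
        note ES = I.expectation_sandwich[OF k k B1s T[THEN conjunct2, THEN conjunct2] good fair cc0 Y0 \<delta>0]
        have Ln: "0 \<le> L / real n" using L1 by simp
        have W0: "0 \<le> W" using W1 n0 by (meson divide_nonneg_nonneg of_nat_0_le_iff order_trans zero_le_one)
        have ccP: "cc * measure (edge_weights D n) B\<^sub>1 \<le> e * (L / real n) \<and> (cc + l) * measure (edge_weights D n) B\<^sub>1 \<le> e * (L / real n)"
        proof -
          have a: "4 * x * measure (edge_weights D n) B\<^sub>1 \<le> e * (L / real n)"
          proof -
            have "4 * x * measure (edge_weights D n) B\<^sub>1 = (4 * L ^ 7 * measure (edge_weights D n) B\<^sub>1) * (L / real n)"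
              by (simp add: x_def eval_nat_numeral)
            also have "\<dots> \<le> e * (L / real n)" using LB Ln by (intro mult_right_mono)
            finally show ?thesis .
          qed
          have "l \<le> 1 * (L / real n)" unfolding lE using Ln e by (intro mult_right_mono) auto
          also have "\<dots> \<le> x" unfolding x_def using power_increasing[of 1 8 L] L1 n0 by (auto intro!: divide_right_mono)
          finally have "cc + l \<le> 4 * x" by (simp add: cc_def)
          moreover have "cc \<le> 4 * x" using cc0 by (simp add: cc_def)
          ultimately show ?thesis using a measure_nonneg[of "edge_weights D n" B\<^sub>1] mult_right_mono order_trans by meson
        qed
        have tailL: "2 * (2 / real n ^ 8) \<le> e * (L / real n)"
        proof -
          have "e / real n \<le> e * (L / real n)" using e L1 n0 by (simp add: divide_right_mono)
          then show ?thesis using small by linarith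
        qed
        have up: "(\<integral>w. I.cost_on k w \<partial>edge_weights D n) \<le> 2 * W + (1 + 3 * e) * (L / real n)"
        proof -
          have "Y = (1 + e) * (L / real n)" by (simp add: Y_def)
          moreover have "0 \<le> 2 / real n ^ 8" by simp
          ultimately have "(\<integral>w. I.cost_on k w \<partial>edge_weights D n) \<le> 2 * W + (1 + e) * (L / real n) + e * (L / real n) + e * (L / real n)"
            using ES(1) ccP[THEN conjunct1] T[THEN conjunct1] tailL unfolding W_def by linarith
          moreover have "2 * W + (1 + e) * q + e * q + e * q = 2 * W + (1 + 3 * e) * q" for q
            by (simp add: algebra_simps)
          ultimately show ?thesis by metis
        qed
        have low: "2 * W + (1 - 7 * e) * (L / real n) \<le> (\<integral>w. I.cost_on k w \<partial>edge_weights D n)"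
        proof -
          have "2 * W + (1 - 5 * e) * (L / real n) - e * (L / real n) - e * (L / real n) \<le> (\<integral>w. I.cost_on k w \<partial>edge_weights D n)"
            using ES(2) ccP[THEN conjunct2] T[THEN conjunct1] tailL unfolding W_def lE[symmetric] by linarith
          moreover have "2 * W + (1 - 5 * e) * q - e * q - e * q = 2 * W + (1 - 7 * e) * q" for q
            by (simp add: algebra_simps)
          ultimately show ?thesis by metis
        qed
        have eW: "0 \<le> e * W" "0 \<le> e * (L / real n)" using e(1) by (intro mult_nonneg_nonneg W0 Ln; simp)+
        have "(1 - \<epsilon>) * scale n k \<le> 2 * W + (1 - 7 * e) * (L / real n)"
        proof -
          have "(1 - 20 * e) * (2 * W + q) \<le> 2 * W + (1 - 7 * e) * q" if "0 \<le> e * W" "0 \<le> e * q" for q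
            using that by (simp add: algebra_simps)
          then show ?thesis unfolding fE e(3) using eW by blast
        qed
        moreover have "2 * W + (1 + 3 * e) * (L / real n) \<le> (1 + \<epsilon>) * scale n k"
        proof -
          have "2 * W + (1 + 3 * e) * q \<le> (1 + 20 * e) * (2 * W + q)" if "0 \<le> e * W" "0 \<le> e * q" for q
            using that by (simp add: algebra_simps)
          then show ?thesis unfolding fE e(3) using eW by blast
        qed
        moreover have "measure (edge_weights D n) B\<^sub>1 \<le> e"
        proof -
          have "1 * measure (edge_weights D n) B\<^sub>1 \<le> 4 * L ^ 7 * measure (edge_weights D n) B\<^sub>1"
            using L70 by (intro mult_right_mono) auto
          then show ?thesis using LB by linarith
        qed
        then have "1 - \<epsilon> \<le> measure (edge_weights D n) {w \<in> space (edge_weights D n). succ_path_exists n s t w k}"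
          using ES(3) e by linarith
        ultimately show ?thesis using low up by linarith
      qed
    qed
  qed
qed

end

theorem theorem1p5:
  fixes D :: "real measure" and s t :: "nat \<Rightarrow> nat"
  assumes "D = uniform_law \<or> D = exponential_law"
    and "\<And>n. n \<ge> 2 \<Longrightarrow> s n < n \<and> t n < n \<and> s n \<noteq> t n"
  shows "(\<forall>\<kappa> :: nat \<Rightarrow> nat. (\<forall>n\<ge>2. 1 \<le> \<kappa> n \<and> \<kappa> n \<le> n - 1) \<longrightarrow>
            (\<lambda>n. \<P>(w in edge_weights D n. succ_path_exists n (s n) (t n) w (\<kappa> n)))
              \<longlonglongrightarrow> 1) \<and>
         (\<exists>\<delta> :: nat \<Rightarrow> nat \<Rightarrow> real.
            (\<forall>n\<ge>2. \<forall>k\<in>{1..n - 1}.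
               cond_expectation (edge_weights D n)
                 (\<lambda>w. succ_cost n (s n) (t n) w k)
                 (\<lambda>w. succ_path_exists n (s n) (t n) w k)
               = (1 + \<delta> n k) * (2 * expected_order_stat D n k + ln (real n) / real n)) \<and>
            (\<forall>\<epsilon>>0. \<forall>\<^sub>F n in sequentially. \<forall>k\<in>{1..n - 1}. \<bar>\<delta> n k\<bar> < \<epsilon>))"
proof -
  interpret edge_law D using assms(1) by unfold_locales
  have law: "instance_law D n (s n) (t n)" if "2 \<le> n" for n
    using assms(2)[OF that] by unfold_locales auto
  define p where "p n k = \<P>(w in edge_weights D n. succ_path_exists n (s n) (t n) w k)" for n k
  define X where "X n k = (\<integral>w. instance_law.cost_on D n (s n) (t n) k w \<partial>edge_weights D n)" for n k
  \<comment> \<open>The relative error of the conditional expectation, solved for from the claimed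
    identity.\<close>
  define \<delta> where "\<delta> n k = X n k / p n k / scale n k - 1" for n k
  have p1: "p n k \<le> 1" for n k
    unfolding p_def by (rule prob_space.prob_le_1[OF prob_space_edge_weights])
  have scale0: "0 < scale n k" if "2 \<le> n" "k \<in> {1..n - 1}" for n k
  proof -
    have "0 \<le> real k / real n" by simp
    also have "\<dots> \<le> expected_order_stat D n k" using that by (intro expected_order_stat_ge) auto
    finally show ?thesis using that by (simp add: scale_def add_nonneg_pos)
  qed
  have close: "\<forall>\<^sub>F n in sequentially. \<forall>k\<in>{1..n - 1}. 1 - e \<le> p n k \<and> \<bar>\<delta> n k\<bar> \<le> 3 * e"
    if e: "0 < e" "e \<le> 1/4" for e
  proof -
    have e1: "e \<le> 1" using e by simp
    show ?thesis using uniform_estimate[OF e(1) e1] eventually_ge_at_top[of 2]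
    proof eventually_elim
      case (elim n)
      show ?case
      proof
        fix k assume k: "k \<in> {1..n - 1}"
        have est: "1 - e \<le> p n k" "(1 - e) * scale n k \<le> X n k" "X n k \<le> (1 + e) * scale n k"
          using elim(1) assms(2)[OF elim(2)] k unfolding p_def X_def by auto
        have S0: "0 < scale n k" by (rule scale0[OF elim(2) k])
        have p0: "0 < p n k" using est(1) e by linarith
        define r where "r = X n k / scale n k"
        have r: "1 - e \<le> r" "r \<le> 1 + e" using est S0 by (simp_all add: r_def le_divide_eq divide_le_eq)
        \<comment> \<open>Conditioning divides by a probability between 1 - e and 1. This
          inequality, valid since \<open>e\<close> is at most 1/3, turns that into a relative error
          3 * e.\<close>
        have "1 + e \<le> (1 + 3 * e) * (1 - e)"
        proof -
          have "(1 + 3 * e) * (1 - e) - (1 + e) = e * (1 - 3 * e)" by (simp add: algebra_simps)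
          moreover have "0 \<le> e * (1 - 3 * e)" using e by (intro mult_nonneg_nonneg) auto
          ultimately show ?thesis by linarith
        qed
        also have "\<dots> \<le> (1 + 3 * e) * p n k" using est(1) e by (intro mult_left_mono) auto
        finally have up: "r / p n k \<le> 1 + 3 * e" using r p0 by (simp add: divide_le_eq)
        have "(1 - e) * p n k \<le> (1 - e) * 1" using p1[of n k] e by (intro mult_left_mono) auto
        then have "1 - e \<le> r / p n k" using r p0 by (simp add: le_divide_eq)
        moreover have "\<delta> n k = r / p n k - 1" by (simp add: \<delta>_def r_def)
        ultimately show "1 - e \<le> p n k \<and> \<bar>\<delta> n k\<bar> \<le> 3 * e" using up est(1) e by linarith
      qed
    qed
  qed
  show ?thesis
  proof (intro conjI allI impI exI[of _ \<delta>] ballI)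
    fix \<kappa> :: "nat \<Rightarrow> nat" assume \<kappa>: "\<forall>n\<ge>2. 1 \<le> \<kappa> n \<and> \<kappa> n \<le> n - 1"
    have "(\<lambda>n. p n (\<kappa> n)) \<longlonglongrightarrow> 1"
    proof (rule order_tendstoI)
      fix a :: real assume a: "a < 1"
      define e where "e = min ((1 - a) / 4) (1/4)"
      have e: "0 < e" "e \<le> 1/4" using a by (simp_all add: e_def)
      have ea: "e \<le> (1 - a) / 4" unfolding e_def by (rule min.cobounded1)
      have ae: "a < 1 - e"
      proof -
        have "4 * e \<le> 1 - a" using ea by simp
        then show ?thesis using a e(1) by simp
      qed
      show "\<forall>\<^sub>F n in sequentially. a < p n (\<kappa> n)"
        using close[OF e(1,2)] eventually_ge_at_top[of 2]
      proof eventually_elim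
        case (elim n)
        then have "1 - e \<le> p n (\<kappa> n)" using \<kappa> by simp
        then show ?case using ae by (rule less_le_trans[rotated])
      qed
    next
      fix a :: real assume "1 < a"
      then show "\<forall>\<^sub>F n in sequentially. p n (\<kappa> n) < a"
        by (intro always_eventually allI le_less_trans[OF p1])
    qed
    then show "(\<lambda>n. \<P>(w in edge_weights D n. succ_path_exists n (s n) (t n) w (\<kappa> n))) \<longlonglongrightarrow> 1"
      by (simp add: p_def)
  next
    fix n k :: nat assume n: "2 \<le> n" and k: "k \<in> {1..n - 1}"
    have "cond_expectation (edge_weights D n) (\<lambda>w. succ_cost n (s n) (t n) w k)
        (\<lambda>w. succ_path_exists n (s n) (t n) w k) = X n k / p n k"
      unfolding X_def p_def by (rule instance_law.cond_expectation_eq[OF law[OF n]])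
    \<comment> \<open>Only the positive \<open>scale n k\<close> is cancelled, so the identity holds
      for every n from 2 on, whatever the value of \<open>p n k\<close>.\<close>
    also have "\<dots> = (1 + \<delta> n k) * scale n k" using scale0[OF n k] by (simp add: \<delta>_def)
    finally show "cond_expectation (edge_weights D n) (\<lambda>w. succ_cost n (s n) (t n) w k)
        (\<lambda>w. succ_path_exists n (s n) (t n) w k) =
        (1 + \<delta> n k) * (2 * expected_order_stat D n k + ln (real n) / real n)"
      by (simp add: scale_def)
  next
    fix \<epsilon> :: real assume "0 < \<epsilon>"
    then have e: "0 < min (\<epsilon> / 4) (1/4)" "min (\<epsilon> / 4) (1/4) \<le> 1/4" "3 * min (\<epsilon> / 4) (1/4) < \<epsilon>"
      by (auto simp: min_def)
    show "\<forall>\<^sub>F n in sequentially. \<forall>k\<in>{1..n - 1}. \<bar>\<delta> n k\<bar> < \<epsilon>"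
      using close[OF e(1,2)] by (rule eventually_mono) (use e(3) in fastforce)
  qed
qed

end
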